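(* Let $d_1,\dots,d_l\ge 2$ be natural numbers. The space of tensorial bodies $\mathcal{B}_\otimes(d_1,\dots,d_l)$, with the Hausdorff distance, is an absolute retract. In particular, the subspace $\mathcal{L}_\otimes(d_1,\dots,d_l)$ is also an absolute retract.
   Context: For $d\in\mathbb{N}$, $\mathbb{R}^d$ carries its standard inner product, with closed unit ball $B_2^d$. The tensor product $\otimes_{i=1}^l\mathbb{R}^{d_i}$ carries the inner product $\langle\cdot,\cdot\rangle_H$ determined by $\langle x^1\otimes\cdots\otimes x^l,y^1\otimes\cdots\otimes y^l\rangle_H=\prod_{i=1}^l\langle x^i,y^i\rangle$, with closed unit ball $B_2^{d_1,\dots,d_l}$. A 0-symmetric convex body is a compact convex set $P$ with nonempty interior and $P=-P$; $\mathcal{B}(d)$ is the set of these in $\mathbb{R}^d$. The polar is $P^\circ=\{y:\langle x,y\rangle\le 1\ \forall x\in P\}$ (using $\langle\cdot,\cdot\rangle_H$ in the tensor product). For $P_i\in\mathcal{B}(d_i)$, $i=1,\dots,l$, let $P_1\otimes_\pi\cdots\otimes_\pi P_l:=\mathrm{conv}\{x^1\otimes\cdots\otimes x^l: x^i\in P_i\}$ and $P_1\otimes_\epsilon\cdots\otimes_\epsilon P_l:=(P_1^\circ\otimes_\pi\cdots\otimes_\pi P_l^\circ)^\circ$. A 0-symmetric convex body $P\subset\otimes_{i=1}^l\mathbb{R}^{d_i}$ is a tensorial body if there are $P_i\in\mathcal{B}(d_i)$ with $P_1\otimes_\pi\cdots\otimes_\pi P_l\subseteq P\subseteq P_1\otimes_\epsilon\cdots\otimes_\epsilon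 P_l$. $\mathcal{B}_\otimes(d_1,\dots,d_l)$ is the set of all tensorial bodies in $\otimes_{i=1}^l\mathbb{R}^{d_i}$, a metric space with the Hausdorff distance induced by the Euclidean norm of $\langle\cdot,\cdot\rangle_H$. Let $\Sigma_{d_1,\dots,d_l}=\{x^1\otimes\cdots\otimes x^l:x^i\in\mathbb{R}^{d_i}\}$ and $conv_\otimes(P)=\mathrm{conv}(P\cap\Sigma_{d_1,\dots,d_l})$ for $P\in\mathcal{B}_\otimes(d_1,\dots,d_l)$ (this is again a 0-symmetric convex body). $Low(P)$ is the Löwner ellipsoid of $P$, i.e. the unique ellipsoid of minimal volume containing $P$. Set $\ell_\otimes(P)=Low(conv_\otimes(P))$ and $\mathcal{L}_\otimes(d_1,\dots,d_l)=\{P\in\mathcal{B}_\otimes(d_1,\dots,d_l):\ell_\otimes(P)=B_2^{d_1,\dots,d_l}\}$. A metrizable space $X$ is an absolute retract (AR) if for every metrizable space $Z$ containing $X$ as a closed subset there is a retraction $Z\to X$. *)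

theory Defs
  imports "HOL-Analysis.Analysis"
begin

text \<open>
  For a set \<open>J\<close> of indices, the Euclidean space \<open>\<real>\<^sup>J\<close> is realised as the coordinate subspace of
  vectors supported on \<open>J\<close>, with the inner product and norm of the ambient type. This is what
  allows factors \<open>\<real>\<^sup>d\<close> of different dimensions \<open>d = card J\<close> to live in one type. Interiors, polars
  and volumes below are all taken in \<open>\<real>\<^sup>J\<close>, not in the ambient type.
\<close>

definition coord_space :: "'k::finite set \<Rightarrow> (real^'k) set" where
  "coord_space J = {x. \<forall>k. k \<notin> J \<longrightarrow> x $ k = 0}"

definition unit_ball :: "'k::finite set \<Rightarrow> (real^'k) set" where
  "unit_ball J = cball 0 1 \<inter> coord_space J"

definition sym_convex_bodies :: "'k::finite set \<Rightarrow> (real^'k) set set" where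
  "sym_convex_bodies J =
     {P. P \<subseteq> coord_space J \<and> compact P \<and> convex P \<and> uminus ` P = P \<and>
         (top_of_set (coord_space J)) interior_of P \<noteq> {}}"

definition polar :: "'k::finite set \<Rightarrow> (real^'k) set \<Rightarrow> (real^'k) set" where
  "polar J P = {y \<in> coord_space J. \<forall>x\<in>P. x \<bullet> y \<le> 1}"

text \<open>Lebesgue measure of \<open>\<real>\<^sup>J\<close>, as the \<open>J\<close>-fold product of one-dimensional Lebesgue measure.\<close>

definition volume :: "'k::finite set \<Rightarrow> (real^'k) set \<Rightarrow> ennreal" where
  "volume J S = emeasure (Pi\<^sub>M J (\<lambda>_. lborel)) ((\<lambda>x. restrict (\<lambda>k. x $ k) J) ` S)"

definition ellipsoid :: "'k::finite set \<Rightarrow> (real^'k) set \<Rightarrow> bool" where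
  "ellipsoid J E \<longleftrightarrow>
     (\<exists>T c. linear T \<and> bij_betw T (coord_space J) (coord_space J) \<and> c \<in> coord_space J \<and>
            E = (\<lambda>x. c + T x) ` unit_ball J)"

definition Low :: "'k::finite set \<Rightarrow> (real^'k) set \<Rightarrow> (real^'k) set" where
  "Low J P = (THE E. ellipsoid J E \<and> P \<subseteq> E \<and>
                     (\<forall>E'. ellipsoid J E' \<and> P \<subseteq> E' \<longrightarrow> volume J E \<le> volume J E'))"

text \<open>
  The factors are \<open>coord_space (I i)\<close> for \<open>i\<close> in the finite type \<open>'l\<close>. Their tensor product is the space of
  arrays \<open>coord_space M\<close>, where \<open>M\<close> is the set of multi-indices \<open>m\<close> with \<open>m i \<in> I i\<close> for all \<open>i\<close>. Its standard
  inner product is \<open>\<langle>\<cdot>,\<cdot>\<rangle>\<^sub>H\<close> by lemma \<open>inner_tensor\<close>.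
\<close>

definition multi_indices :: "('l::finite \<Rightarrow> 'n::finite set) \<Rightarrow> ('l \<Rightarrow> 'n) set" where
  "multi_indices I = {m. \<forall>i. m i \<in> I i}"

definition tensor :: "('l::finite \<Rightarrow> real^'n::finite) \<Rightarrow> real^('l \<Rightarrow> 'n)" where
  "tensor x = (\<chi> m. \<Prod>i\<in>UNIV. x i $ m i)"

lemma inner_tensor: "tensor x \<bullet> tensor y = (\<Prod>i\<in>UNIV. x i \<bullet> y i)"
proof -
  have "(\<Prod>i\<in>UNIV. x i \<bullet> y i) = (\<Prod>i\<in>UNIV. \<Sum>j\<in>UNIV. x i $ j * y i $ j)"
    by (simp add: inner_vec_def)
  also have "\<dots> = (\<Sum>m\<in>PiE UNIV (\<lambda>_. UNIV). \<Prod>i\<in>UNIV. x i $ m i * y i $ m i)"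
    by (rule prod_sum_PiE) auto
  also have "\<dots> = tensor x \<bullet> tensor y"
    by (simp add: tensor_def inner_vec_def prod.distrib PiE_UNIV_domain)
  finally show ?thesis by simp
qed

lemma tensor_in_coord_space:
  assumes "\<And>i. x i \<in> coord_space (I i)"
  shows "tensor x \<in> coord_space (multi_indices I)"
  using assms by (fastforce simp: coord_space_def multi_indices_def tensor_def)

definition decomposables :: "('l::finite \<Rightarrow> 'n::finite set) \<Rightarrow> (real^('l \<Rightarrow> 'n)) set" where
  "decomposables I = {tensor x | x. \<forall>i. x i \<in> coord_space (I i)}"

definition proj_tensor :: "('l::finite \<Rightarrow> (real^'n::finite) set) \<Rightarrow> (real^('l \<Rightarrow> 'n)) set" where
  "proj_tensor P = convex hull {tensor x | x. \<forall>i. x i \<in> P i}"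

definition inj_tensor ::
    "('l::finite \<Rightarrow> 'n::finite set) \<Rightarrow> ('l \<Rightarrow> (real^'n) set) \<Rightarrow> (real^('l \<Rightarrow> 'n)) set" where
  "inj_tensor I P = polar (multi_indices I) (proj_tensor (\<lambda>i. polar (I i) (P i)))"

definition tensorial_bodies :: "('l::finite \<Rightarrow> 'n::finite set) \<Rightarrow> (real^('l \<Rightarrow> 'n)) set set" where
  "tensorial_bodies I =
     {P \<in> sym_convex_bodies (multi_indices I).
        \<exists>Q. (\<forall>i. Q i \<in> sym_convex_bodies (I i)) \<and> proj_tensor Q \<subseteq> P \<and> P \<subseteq> inj_tensor I Q}"

definition conv_tensor ::
    "('l::finite \<Rightarrow> 'n::finite set) \<Rightarrow> (real^('l \<Rightarrow> 'n)) set \<Rightarrow> (real^('l \<Rightarrow> 'n)) set" where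
  "conv_tensor I P = convex hull (P \<inter> decomposables I)"

definition low_tensor ::
    "('l::finite \<Rightarrow> 'n::finite set) \<Rightarrow> (real^('l \<Rightarrow> 'n)) set \<Rightarrow> (real^('l \<Rightarrow> 'n)) set" where
  "low_tensor I P = Low (multi_indices I) (conv_tensor I P)"

definition lowner_bodies :: "('l::finite \<Rightarrow> 'n::finite set) \<Rightarrow> (real^('l \<Rightarrow> 'n)) set set" where
  "lowner_bodies I = {P \<in> tensorial_bodies I. low_tensor I P = unit_ball (multi_indices I)}"

text \<open>
  The value \<open>0\<close> outside the bounded nonempty sets is a convention: the locale \<open>Metric_space\<close> asks
  for nonnegativity and symmetry on the whole type.
\<close>

definition hausdorff_dist :: "'a::metric_space set \<Rightarrow> 'a set \<Rightarrow> real" where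
  "hausdorff_dist A B =
     (if bounded A \<and> bounded B \<and> A \<noteq> {} \<and> B \<noteq> {}
      then max (SUP a\<in>A. infdist a B) (SUP b\<in>B. infdist b A) else 0)"

lemma bdd_above_infdist:
  fixes A B :: "'a::metric_space set"
  assumes "bounded A" "B \<noteq> {}"
  shows "bdd_above ((\<lambda>a. infdist a B) ` A)"
proof -
  obtain b where b: "b \<in> B" using assms by auto
  obtain e where e: "\<And>a. a \<in> A \<Longrightarrow> dist b a \<le> e"
    using assms(1) by (metis bounded_any_center)
  have "infdist a B \<le> e" if "a \<in> A" for a
    using infdist_le2[OF b] e[OF that] by (simp add: dist_commute)
  then show ?thesis by (intro bdd_aboveI2)
qed

lemma hausdorff_dist_le_iff:
  fixes A B :: "'a::metric_space set"
  assumes "bounded A" "A \<noteq> {}" "bounded B" "B \<noteq> {}"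
  shows "hausdorff_dist A B \<le> r \<longleftrightarrow> (\<forall>a\<in>A. infdist a B \<le> r) \<and> (\<forall>b\<in>B. infdist b A \<le> r)"
  using assms by (simp add: hausdorff_dist_def cSUP_le_iff bdd_above_infdist)

lemma hausdorff_dist_commute: "hausdorff_dist A B = hausdorff_dist B A"
  by (simp add: hausdorff_dist_def max.commute)

lemma hausdorff_dist_nonneg: "0 \<le> hausdorff_dist A B"
proof (cases "bounded A \<and> bounded B \<and> A \<noteq> {} \<and> B \<noteq> {}")
  case True
  then obtain a where "a \<in> A" by auto
  moreover have "\<forall>a\<in>A. infdist a B \<le> hausdorff_dist A B"
    using True hausdorff_dist_le_iff[of A B "hausdorff_dist A B"] by auto
  ultimately show ?thesis using infdist_nonneg order_trans by blast
qed (simp only: hausdorff_dist_def if_False order_refl)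

lemma Metric_space_hausdorff_dist:
  fixes \<S> :: "'a::heine_borel set set"
  assumes "\<And>A. A \<in> \<S> \<Longrightarrow> compact A \<and> A \<noteq> {}"
  shows "Metric_space \<S> hausdorff_dist"
proof
  have bd: "bounded A" "A \<noteq> {}" "closed A" if "A \<in> \<S>" for A
    using assms[OF that] by (auto simp: compact_imp_bounded compact_imp_closed)
  have le: "infdist a B \<le> hausdorff_dist A B" if "A \<in> \<S>" "B \<in> \<S>" "a \<in> A" for A B a
    using hausdorff_dist_le_iff[of A B "hausdorff_dist A B"] bd that by auto
  have tri: "infdist a C \<le> hausdorff_dist A B + hausdorff_dist B C"
    if "A \<in> \<S>" "B \<in> \<S>" "C \<in> \<S>" "a \<in> A" for A B C a
  proof -
    obtain b where b: "b \<in> B" "infdist a B = dist a b"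
      using infdist_attains_inf[of B a] bd[OF \<open>B \<in> \<S>\<close>] by auto
    have "infdist a C \<le> infdist b C + dist a b" by (rule infdist_triangle)
    then show ?thesis using le[of B C b] le[of A B a] b that by linarith
  qed
  show "0 \<le> hausdorff_dist A B" for A B :: "'a set" by (rule hausdorff_dist_nonneg)
  show "hausdorff_dist A B = hausdorff_dist B A" for A B :: "'a set"
    by (rule hausdorff_dist_commute)
  show "hausdorff_dist A B = 0 \<longleftrightarrow> A = B" if AB: "A \<in> \<S>" "B \<in> \<S>" for A B
  proof
    have *: "A \<subseteq> B" if "A \<in> \<S>" "B \<in> \<S>" "hausdorff_dist A B = 0" for A B
    proof
      fix a assume "a \<in> A"
      then have "infdist a B = 0" using le[of A B a] that infdist_nonneg[of a B] by simp
      then show "a \<in> B" using in_closed_iff_infdist_zero[of B a] bd[OF \<open>B \<in> \<S>\<close>] by simp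
    qed
    show "A = B" if "hausdorff_dist A B = 0"
      using *[OF AB that] *[OF AB(2,1)] that hausdorff_dist_commute[of A B] by simp
    show "hausdorff_dist A B = 0" if "A = B"
      using that bd[OF AB(1)] by (simp add: hausdorff_dist_def)
  qed
  show "hausdorff_dist A C \<le> hausdorff_dist A B + hausdorff_dist B C"
    if "A \<in> \<S>" "B \<in> \<S>" "C \<in> \<S>" for A B C
  proof -
    have "infdist c A \<le> hausdorff_dist A B + hausdorff_dist B C" if "c \<in> C" for c
      using tri[of C B A c] that \<open>A \<in> \<S>\<close> \<open>B \<in> \<S>\<close> \<open>C \<in> \<S>\<close>
      hausdorff_dist_commute[of A B] hausdorff_dist_commute[of B C] by simp
    moreover have "infdist a C \<le> hausdorff_dist A B + hausdorff_dist B C" if "a \<in> A" for a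
      using tri[OF \<open>A \<in> \<S>\<close> \<open>B \<in> \<S>\<close> \<open>C \<in> \<S>\<close> that] .
    ultimately show ?thesis
      using hausdorff_dist_le_iff[of A C] bd[OF \<open>A \<in> \<S>\<close>] bd[OF \<open>C \<in> \<S>\<close>] by blast
  qed
qed

definition tensorial_space :: "('l::finite \<Rightarrow> 'n::finite set) \<Rightarrow> (real^('l \<Rightarrow> 'n)) set topology" where
  "tensorial_space I = Metric_space.mtopology (tensorial_bodies I) hausdorff_dist"

definition lowner_space :: "('l::finite \<Rightarrow> 'n::finite set) \<Rightarrow> (real^('l \<Rightarrow> 'n)) set topology" where
  "lowner_space I = subtopology (tensorial_space I) (lowner_bodies I)"

lemma Metric_space_tensorial_bodies: "Metric_space (tensorial_bodies I) hausdorff_dist"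
proof (rule Metric_space_hausdorff_dist)
  fix P assume "P \<in> tensorial_bodies I"
  then have P: "P \<in> sym_convex_bodies (multi_indices I)" by (simp add: tensorial_bodies_def)
  then have "P \<noteq> {}"
    using interior_of_subset[of "top_of_set (coord_space (multi_indices I))" P]
    by (auto simp: sym_convex_bodies_def)
  with P show "compact P \<and> P \<noteq> {}" by (simp add: sym_convex_bodies_def)
qed

text \<open>
  The predicate \<open>AR\<close> of HOL-Analysis only tests against subsets of the fixed type \<open>'a \<times> real\<close>.
  Here the test spaces are all metrizable topologies on a type \<open>'z\<close>, and \<open>X\<close> is contained in
  \<open>Z\<close> via a closed embedding. HOL cannot quantify over types inside a definition, so a theorem
  asserting that a space is an absolute retract has to leave \<open>'z\<close> arbitrary.
\<close>

definition absolute_retract :: "'z itself \<Rightarrow> 'x topology \<Rightarrow> bool" where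
  "absolute_retract TYPE('z) X \<longleftrightarrow>
     metrizable_space X \<and>
     (\<forall>(Z :: 'z topology) f. metrizable_space Z \<and> embedding_map X Z f \<and> closedin Z (f ` topspace X)
        \<longrightarrow> (f ` topspace X) retract_of_space Z)"

end

(*
  Support functions are extended from a closed subset by Tietze's
  theorem, applied on the product with the unit sphere, and the extended function h is turned back into a
  body, the Wulff shape of h. So a family S of symmetric bodies is an absolute retract as soon as there is a
  retraction r onto S from all symmetric bodies such that X <= tY and Y <= tX (t >= 1) imply
  r X <= t^k r Y for some fixed k.

  The slices of a tensorial body through decomposable vectors are its factors Q_i up to positive scalars.
  For an arbitrary X, rescaled slices Q_i still make sense, and
  r X = conv (pi(Q) u (X n eps(Q))) is tensorial and equals X if X was.

  For the second space each Q_i is replaced by B n s Q_i, where s is the least scalar for which this body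
  satisfies John's condition tr H <= d max <Hx,x> for all quadratic forms H. This depends only on the ray of
  Q_i and fixes the bodies whose Loewner ellipsoid is the unit ball. The condition passes from the factors
  to their projective tensor product by taking partial traces, and back by testing it on forms that act on a
  single factor. It characterises the bodies in the unit ball whose Loewner ellipsoid is the unit ball.
*)
theory Submission
  imports Defs
begin

section \<open>Symmetric convex bodies and polars\<close>

text \<open>Closeness is measured by inclusions X <= tY because they pass through polars, hulls,
  intersections and, with a power of t, tensor products. This is also why logarithms of support
  functions are extended: a small difference of logarithms is a ratio near 1, and the exponential
  keeps the extension positive.

  The obstacle is that a tensorial body determines its factors only up to scalars with product 1.
  The retraction needs a choice of factors that is explicit, makes sense for every symmetric body
  and distorts t by a bounded power. Slices along fixed coordinate vectors are such a choice.

  The two tensor products are tied together by the fact that their gauges agree on decomposable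
  vectors. Hence every body between pi(Q) and eps(Q) has the same hull of decomposables, namely
  pi(Q), and the Loewner condition concerns the factors alone.

  John's condition stands in for the ellipsoid because it is inherited by larger sets. This allows
  the least scalar s to be compared for nearby bodies, with no linear map moving Q into
  position.\<close>

lemma subspace_coord_space: "subspace (coord_space J)"
  by (auto simp: coord_space_def subspace_def)

lemma closed_coord_space: "closed (coord_space J)"
  by (simp add: closed_subspace subspace_coord_space)

lemma convex_coord_space: "convex (coord_space J)"
  by (simp add: subspace_imp_convex subspace_coord_space)

lemma coord_space_add: "x \<in> coord_space J \<Longrightarrow> y \<in> coord_space J \<Longrightarrow> x + y \<in> coord_space J"
  and coord_space_diff: "x \<in> coord_space J \<Longrightarrow> y \<in> coord_space J \<Longrightarrow> x - y \<in> coord_space J"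
  and coord_space_scale: "x \<in> coord_space J \<Longrightarrow> c *\<^sub>R x \<in> coord_space J"
  and coord_space_minus: "x \<in> coord_space J \<Longrightarrow> - x \<in> coord_space J"
  and coord_space_zero: "0 \<in> coord_space J"
  by (auto simp: coord_space_def)

lemma axis_in_coord_space: "k \<in> J \<Longrightarrow> axis k c \<in> coord_space J"
  by (auto simp: coord_space_def axis_def)

lemma coord_space_scale_iff: "c \<noteq> 0 \<Longrightarrow> c *\<^sub>R x \<in> coord_space J \<longleftrightarrow> x \<in> coord_space J"
  by (auto simp: coord_space_def)

lemma sym_convex_bodiesI:
  assumes "P \<subseteq> coord_space J" "compact P" "convex P" "\<And>x. x \<in> P \<Longrightarrow> - x \<in> P"
    and "0 < m" "cball 0 m \<inter> coord_space J \<subseteq> P"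
  shows "P \<in> sym_convex_bodies J"
proof -
  have "uminus ` P = P"
  proof
    show "uminus ` P \<subseteq> P" using assms(4) by blast
    show "P \<subseteq> uminus ` P"
    proof
      fix x assume "x \<in> P"
      then show "x \<in> uminus ` P" using assms(4) by (intro image_eqI[of x uminus "- x"]) simp_all
    qed
  qed
  moreover have "0 \<in> (top_of_set (coord_space J)) interior_of P"
    unfolding interior_of_def
  proof (intro CollectI exI conjI)
    show "openin (top_of_set (coord_space J)) (coord_space J \<inter> ball 0 m)" by auto
    show "0 \<in> coord_space J \<inter> ball 0 m" using assms by (simp add: coord_space_zero)
    show "coord_space J \<inter> ball 0 m \<subseteq> P" using assms(6) by auto
  qed
  ultimately show ?thesis
    using assms by (auto simp: sym_convex_bodies_def)
qed

lemma sym_convex_bodiesD: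
  assumes "P \<in> sym_convex_bodies J"
  shows "P \<subseteq> coord_space J" "compact P" "convex P" "\<And>x. x \<in> P \<Longrightarrow> - x \<in> P"
  using assms by (auto simp: sym_convex_bodies_def)

text \<open>An interior point p and its mirror image give a ball about 0: x is the midpoint of p +
  2x and -p, and the radius e/3 keeps p + 2x in the ball of radius e about p.\<close>

lemma sym_convex_bodies_inner_ball:
  assumes "P \<in> sym_convex_bodies J"
  obtains m where "0 < m" "cball 0 m \<inter> coord_space J \<subseteq> P"
proof -
  note P = sym_convex_bodiesD[OF assms]
  obtain p where p: "p \<in> (top_of_set (coord_space J)) interior_of P"
    using assms by (auto simp: sym_convex_bodies_def)
  then obtain U where U: "openin (top_of_set (coord_space J)) U" "p \<in> U" "U \<subseteq> P"
    by (auto simp: interior_of_def)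
  then obtain e where e: "e > 0" "ball p e \<inter> coord_space J \<subseteq> U"
    unfolding openin_contains_ball by blast
  show ?thesis
  proof
    show "0 < e / 3" using e by simp
    show "cball 0 (e/3) \<inter> coord_space J \<subseteq> P"
    proof
      fix x assume x: "x \<in> cball 0 (e/3) \<inter> coord_space J"
      have "p + 2 *\<^sub>R x \<in> ball p e \<inter> coord_space J"
        using x e U P(1) by (auto simp: dist_norm intro!: coord_space_add coord_space_scale)
      then have 1: "p + 2 *\<^sub>R x \<in> P" using e U by auto
      have "- p \<in> P" using U P(4) by auto
      from convexD[OF P(3) 1 this, of "1/2" "1/2"]
      show "x \<in> P" by (simp add: algebra_simps)
    qed
  qed
qed

lemma sym_convex_bodies_zero:
  assumes "P \<in> sym_convex_bodies J" shows "0 \<in> P"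
proof -
  obtain m where "0 < m" "cball 0 m \<inter> coord_space J \<subseteq> P" by (rule sym_convex_bodies_inner_ball[OF assms])
  moreover from this have "0 \<in> cball 0 m \<inter> coord_space J" by (simp add: coord_space_zero)
  ultimately show ?thesis by blast
qed

lemma sym_convex_bodies_outer_ball:
  assumes "P \<in> sym_convex_bodies J"
  obtains R where "0 < R" "\<forall>x\<in>P. norm x \<le> R"
  using sym_convex_bodiesD(2)[OF assms] bounded_pos compact_imp_bounded by metis

lemma sym_convex_bodies_shrink:
  assumes "P \<in> sym_convex_bodies J" "x \<in> P" "\<bar>c\<bar> \<le> 1"
  shows "c *\<^sub>R x \<in> P"
proof -
  note P = sym_convex_bodiesD[OF assms(1)]
  have *: "c *\<^sub>R x \<in> P" if "0 \<le> c" "c \<le> 1" "x \<in> P" for c x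
    using convexD[OF P(3) that(3) sym_convex_bodies_zero[OF assms(1)], of c "1 - c"] that by simp
  show ?thesis
  proof (cases "0 \<le> c")
    case True then show ?thesis using * assms by auto
  next
    case False
    then show ?thesis using *[of "-c" "-x"] assms P(4)[OF assms(2)] by simp
  qed
qed

text \<open>For t > 0 this is X <= tY, in the pointwise form that maps into Y directly. Two such
  inclusions, one each way, are the notion of closeness in all estimates below.\<close>

definition scaled_within :: "real \<Rightarrow> 'a::real_vector set \<Rightarrow> 'a set \<Rightarrow> bool" where
  "scaled_within t X Y \<longleftrightarrow> (\<forall>x\<in>X. (1 / t) *\<^sub>R x \<in> Y)"

lemma scaled_withinD: "scaled_within t X Y \<Longrightarrow> x \<in> X \<Longrightarrow> (1 / t) *\<^sub>R x \<in> Y"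
  by (simp add: scaled_within_def)

lemma scaled_within_mono:
  assumes "scaled_within s X Y" "0 < s" "s \<le> t" "Y \<in> sym_convex_bodies J"
  shows "scaled_within t X Y"
proof -
  have "(1 / t) *\<^sub>R x \<in> Y" if "x \<in> X" for x
    using sym_convex_bodies_shrink[OF assms(4) scaled_withinD[OF assms(1) that], of "s / t"] assms(2,3)
    by (simp add: abs_of_pos)
  then show ?thesis by (simp add: scaled_within_def)
qed

lemma scaled_within_convex_hull:
  assumes "scaled_within t X Y"
  shows "scaled_within t (convex hull X) (convex hull Y)"
proof -
  have "(\<lambda>x. (1/t) *\<^sub>R x) ` X \<subseteq> Y" using assms by (auto simp: scaled_within_def)
  then have "(\<lambda>x. (1/t) *\<^sub>R x) ` (convex hull X) \<subseteq> convex hull Y"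
    by (metis (no_types) convex_hull_scaling hull_mono)
  then show ?thesis by (auto simp: scaled_within_def)
qed

text \<open>The normal is the difference of x and its nearest point in P, so it lies in
  \<open>coord_space J\<close>; an arbitrary separating vector of the ambient space might
  not.\<close>

lemma separating_in_coord_space:
  assumes "P \<in> sym_convex_bodies J" "x \<in> coord_space J" "x \<notin> P"
  obtains y where "y \<in> coord_space J" "\<And>p. p \<in> P \<Longrightarrow> p \<bullet> y \<le> 1" "x \<bullet> y > 1"
proof -
  note P = sym_convex_bodiesD[OF assms(1)]
  have cl: "closed P" using P(2) by (rule compact_imp_closed)
  have ne: "P \<noteq> {}" using sym_convex_bodies_zero[OF assms(1)] by auto
  define q where "q = closest_point P x"
  have q: "q \<in> P" using closest_point_in_set[OF cl ne] by (simp add: q_def)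
  define d where "d = x - q"
  have d: "d \<noteq> 0" using q assms(3) by (auto simp: d_def)
  have dJ: "d \<in> coord_space J" using assms(2) q P(1) by (auto simp: d_def intro: coord_space_diff)
  have le: "d \<bullet> p \<le> d \<bullet> q" if "p \<in> P" for p
    using closest_point_dot[OF P(3) cl that, of x] by (simp add: d_def q_def inner_diff_right)
  have pos: "0 \<le> d \<bullet> q" using le[OF sym_convex_bodies_zero[OF assms(1)]] by simp
  have "d \<bullet> x = d \<bullet> d + d \<bullet> q" by (simp add: d_def inner_diff_right)
  then have gt: "d \<bullet> x > d \<bullet> q" using d by simp
  \<comment> \<open>Dividing d by a value strictly between its maximum on P and its value at x
    normalises the bound to 1; b > 0 because 0 lies in P.\<close>
  obtain b where b: "d \<bullet> q < b" "b < d \<bullet> x" using dense[OF gt] by auto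
  then have b0: "b > 0" using pos by linarith
  show ?thesis
  proof
    show "(1/b) *\<^sub>R d \<in> coord_space J" using dJ by (rule coord_space_scale)
    show "p \<bullet> ((1/b) *\<^sub>R d) \<le> 1" if "p \<in> P" for p
      using le[OF that] b b0 by (simp add: inner_commute divide_simps)
    show "x \<bullet> ((1/b) *\<^sub>R d) > 1" using b b0 by (simp add: inner_commute divide_simps)
  qed
qed

lemma polar_sym_convex_bodies:
  assumes "P \<in> sym_convex_bodies J"
  shows "polar J P \<in> sym_convex_bodies J"
proof -
  note P = sym_convex_bodiesD[OF assms]
  obtain R where R: "0 < R" "\<forall>x\<in>P. norm x \<le> R" by (rule sym_convex_bodies_outer_ball[OF assms])
  obtain m where m: "0 < m" "cball 0 m \<inter> coord_space J \<subseteq> P" by (rule sym_convex_bodies_inner_ball[OF assms])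
  have eq: "polar J P = coord_space J \<inter> (\<Inter>x\<in>P. {y. x \<bullet> y \<le> 1})" by (auto simp: polar_def)
  have cl: "closed (polar J P)"
    unfolding eq by (intro closed_Int closed_INT ballI closed_coord_space closed_halfspace_le)
  have cv: "convex (polar J P)"
    unfolding eq by (intro convex_Int convex_INT ballI convex_coord_space convex_halfspace_le)
  have bd: "norm y \<le> 1 / m" if y: "y \<in> polar J P" for y
  proof (cases "y = 0")
    case False
    have "(m / norm y) *\<^sub>R y \<in> P"
      using m y False by (intro subsetD[OF m(2)]) (auto simp: polar_def intro: coord_space_scale)
    then have "((m / norm y) *\<^sub>R y) \<bullet> y \<le> 1" using y by (auto simp: polar_def)
    then have "m * norm y \<le> 1" using False by (simp add: dot_square_norm power2_eq_square)
    then show ?thesis using m by (simp add: field_simps)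
  qed (use m in auto)
  show ?thesis
  proof (rule sym_convex_bodiesI)
    show "polar J P \<subseteq> coord_space J" by (auto simp: polar_def)
    show "compact (polar J P)"
      using cl bd by (auto simp: compact_eq_bounded_closed bounded_iff)
    show "convex (polar J P)" by fact
    show "- y \<in> polar J P" if y: "y \<in> polar J P" for y
    proof -
      have "x \<bullet> - y \<le> 1" if "x \<in> P" for x
      proof -
        have "(- x) \<bullet> y \<le> 1" using y P(4)[OF that] unfolding polar_def by blast
        then show ?thesis by simp
      qed
      then show ?thesis using y by (simp add: polar_def coord_space_minus)
    qed
    show "0 < 1 / R" using R by simp
    show "cball 0 (1 / R) \<inter> coord_space J \<subseteq> polar J P"
    proof
      fix y assume y: "y \<in> cball 0 (1 / R) \<inter> coord_space J"
      have "x \<bullet> y \<le> 1" if "x \<in> P" for x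
      proof -
        have "x \<bullet> y \<le> norm x * norm y" by (rule norm_cauchy_schwarz)
        also have "\<dots> \<le> R * (1 / R)" using y R that by (intro mult_mono) auto
        finally show ?thesis using R by simp
      qed
      then show "y \<in> polar J P" using y by (simp add: polar_def)
    qed
  qed
qed

text \<open>Bipolar theorem relative to \<open>coord_space J\<close>; a point outside P is cut off
  by a separating vector, which belongs to the polar.\<close>

lemma polar_polar:
  assumes "P \<in> sym_convex_bodies J"
  shows "polar J (polar J P) = P"
proof
  show "P \<subseteq> polar J (polar J P)"
    using sym_convex_bodiesD(1)[OF assms] by (auto simp: polar_def inner_commute)
  show "polar J (polar J P) \<subseteq> P"
  proof
    fix x assume x: "x \<in> polar J (polar J P)"
    show "x \<in> P"
    proof (rule ccontr)
      assume "x \<notin> P"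
      moreover have "x \<in> coord_space J" using x by (simp add: polar_def)
      ultimately obtain y where "y \<in> coord_space J" "\<And>p. p \<in> P \<Longrightarrow> p \<bullet> y \<le> 1" "x \<bullet> y > 1"
        using separating_in_coord_space[OF assms] by metis
      then show False using x by (auto simp: polar_def inner_commute)
    qed
  qed
qed

lemma scaled_within_polar:
  assumes "scaled_within t X Y" "t > 0"
  shows "scaled_within t (polar J Y) (polar J X)"
proof -
  have "(1/t) *\<^sub>R y \<in> polar J X" if y: "y \<in> polar J Y" for y
  proof -
    have "x \<bullet> ((1/t) *\<^sub>R y) \<le> 1" if "x \<in> X" for x
    proof -
      have "((1/t) *\<^sub>R x) \<bullet> y \<le> 1" using y scaled_withinD[OF assms(1) that] by (auto simp: polar_def)
      then show ?thesis by simp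
    qed
    then show ?thesis using y by (auto simp: polar_def intro: coord_space_scale)
  qed
  then show ?thesis by (simp add: scaled_within_def)
qed

lemma scale_sym_convex_bodies:
  assumes "P \<in> sym_convex_bodies J" "c > 0"
  shows "(*\<^sub>R) c ` P \<in> sym_convex_bodies J"
proof -
  note P = sym_convex_bodiesD[OF assms(1)]
  obtain m where m: "0 < m" "cball 0 m \<inter> coord_space J \<subseteq> P" by (rule sym_convex_bodies_inner_ball[OF assms(1)])
  show ?thesis
  proof (rule sym_convex_bodiesI)
    show "(*\<^sub>R) c ` P \<subseteq> coord_space J" using P(1) by (auto intro: coord_space_scale)
    show "compact ((*\<^sub>R) c ` P)" by (rule compact_scaling[OF P(2)])
    show "convex ((*\<^sub>R) c ` P)" by (rule convex_scaling[OF P(3)])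
    show "- x \<in> (*\<^sub>R) c ` P" if "x \<in> (*\<^sub>R) c ` P" for x
    proof -
      obtain p where "p \<in> P" "x = c *\<^sub>R p" using \<open>x \<in> (*\<^sub>R) c ` P\<close> by blast
      then show ?thesis using P(4)[of p] by (intro image_eqI[of _ _ "- p"]) simp_all
    qed
    show "0 < c * m" using m assms by simp
    show "cball 0 (c * m) \<inter> coord_space J \<subseteq> (*\<^sub>R) c ` P"
    proof
      fix x assume x: "x \<in> cball 0 (c * m) \<inter> coord_space J"
      have "(1/c) *\<^sub>R x \<in> P" using x assms
        by (intro subsetD[OF m(2)]) (auto simp: field_simps intro: coord_space_scale)
      then show "x \<in> (*\<^sub>R) c ` P" using assms by (intro image_eqI[of _ _ "(1/c) *\<^sub>R x"]) auto
    qed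
  qed
qed

lemma polar_scale:
  assumes "c > 0"
  shows "polar J ((*\<^sub>R) c ` P) = (*\<^sub>R) (1/c) ` polar J P"
proof -
  have "y \<in> polar J ((*\<^sub>R) c ` P) \<longleftrightarrow> c *\<^sub>R y \<in> polar J P" for y
    using assms by (auto simp: polar_def coord_space_scale_iff)
  moreover have "y \<in> (*\<^sub>R) (1/c) ` polar J P \<longleftrightarrow> c *\<^sub>R y \<in> polar J P" for y
    using assms by (auto intro!: image_eqI[of _ _ "c *\<^sub>R y"])
  ultimately show ?thesis by blast
qed

section \<open>Extension by support functions\<close>

definition support_fun :: "'a::real_inner set \<Rightarrow> 'a \<Rightarrow> real" where
  "support_fun P u = (SUP x\<in>P. x \<bullet> u)"

text \<open>The absolute value makes the result symmetric for every h; the functions supplied by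
  Tietze's theorem are in general not even.\<close>

definition wulff_shape :: "'k::finite set \<Rightarrow> (real^'k \<Rightarrow> real) \<Rightarrow> (real^'k) set" where
  "wulff_shape J h = {x \<in> coord_space J. \<forall>u \<in> sphere 0 1 \<inter> coord_space J. \<bar>x \<bullet> u\<bar> \<le> h u}"

lemma support_fun_bdd:
  fixes P :: "'a::real_inner set"
  assumes "bounded P"
  shows "bdd_above ((\<lambda>x. x \<bullet> u) ` P)"
proof -
  obtain R where R: "\<And>x. x \<in> P \<Longrightarrow> norm x \<le> R" using assms unfolding bounded_iff by blast
  have "x \<bullet> u \<le> R * norm u" if "x \<in> P" for x
    using norm_cauchy_schwarz[of x u] R[OF that] by (meson mult_right_mono norm_ge_zero order_trans)
  then show ?thesis by (rule bdd_aboveI2)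
qed

lemma support_fun_upper:
  fixes P :: "'a::real_inner set"
  assumes "bounded P" "x \<in> P"
  shows "x \<bullet> u \<le> support_fun P u"
  unfolding support_fun_def using assms by (intro cSUP_upper support_fun_bdd)

lemma support_fun_least:
  assumes "P \<noteq> {}" "\<And>x. x \<in> P \<Longrightarrow> x \<bullet> u \<le> b"
  shows "support_fun P u \<le> b"
  unfolding support_fun_def using assms by (intro cSUP_least)

lemma support_fun_pos:
  assumes "P \<in> sym_convex_bodies J" "u \<in> sphere 0 1 \<inter> coord_space J"
  shows "0 < support_fun P u"
proof -
  obtain m where m: "0 < m" "cball 0 m \<inter> coord_space J \<subseteq> P" by (rule sym_convex_bodies_inner_ball[OF assms(1)])
  have "m *\<^sub>R u \<in> P" using m assms(2) by (intro subsetD[OF m(2)]) (auto intro: coord_space_scale)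
  then have "(m *\<^sub>R u) \<bullet> u \<le> support_fun P u"
    using sym_convex_bodiesD(2)[OF assms(1)] by (intro support_fun_upper compact_imp_bounded)
  then show ?thesis using m assms(2) by (simp add: dot_square_norm)
qed

lemma support_fun_hausdorff:
  fixes P Q :: "'a::{real_inner,heine_borel} set"
  assumes "compact P" "P \<noteq> {}" "compact Q" "Q \<noteq> {}" "norm u \<le> 1"
  shows "support_fun P u \<le> support_fun Q u + hausdorff_dist P Q"
proof (rule support_fun_least[OF assms(2)])
  fix x assume x: "x \<in> P"
  have b: "bounded P" "bounded Q" using assms compact_imp_bounded by auto
  obtain q where q: "q \<in> Q" "infdist x Q = dist x q"
    using infdist_attains_inf[of Q x] assms compact_imp_closed by metis
  have "infdist x Q \<le> hausdorff_dist P Q"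
    using hausdorff_dist_le_iff[OF b(1) assms(2) b(2) assms(4), of "hausdorff_dist P Q"] x by auto
  moreover have "(x - q) \<bullet> u \<le> dist x q"
  proof -
    have "(x - q) \<bullet> u \<le> norm (x - q) * norm u" by (rule norm_cauchy_schwarz)
    also have "\<dots> \<le> norm (x - q) * 1" using assms(5) by (intro mult_left_mono) auto
    finally show ?thesis by (simp add: dist_norm)
  qed
  moreover have "q \<bullet> u \<le> support_fun Q u" by (rule support_fun_upper[OF b(2) q(1)])
  ultimately show "x \<bullet> u \<le> support_fun Q u + hausdorff_dist P Q"
    using q by (simp add: inner_diff_left)
qed

lemma support_fun_lipschitz:
  fixes P :: "'a::real_inner set"
  assumes "P \<noteq> {}" "\<forall>x\<in>P. norm x \<le> R"
  shows "support_fun P u \<le> support_fun P v + R * dist u v"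
proof (rule support_fun_least[OF assms(1)])
  fix x assume x: "x \<in> P"
  have "x \<bullet> (u - v) \<le> norm x * norm (u - v)" by (rule norm_cauchy_schwarz)
  also have "\<dots> \<le> R * dist u v" using assms x by (auto simp: dist_norm intro: mult_right_mono)
  moreover have "x \<bullet> v \<le> support_fun P v"
    using assms x by (intro support_fun_upper) (auto simp: bounded_iff)
  ultimately show "x \<bullet> u \<le> support_fun P v + R * dist u v"
    by (simp add: inner_diff_right)
qed

text \<open>Turning support functions into bodies inverts the passage from bodies to support
  functions: a separating vector, normalised to the sphere, violates the constraint in its own
  direction.\<close>

lemma wulff_shape_support_fun:
  assumes "P \<in> sym_convex_bodies J" "\<And>u. u \<in> sphere 0 1 \<inter> coord_space J \<Longrightarrow> h u = support_fun P u"
  shows "wulff_shape J h = P"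
proof
  note P = sym_convex_bodiesD[OF assms(1)]
  have b: "bounded P" using P(2) by (rule compact_imp_bounded)
  have ne: "P \<noteq> {}" using sym_convex_bodies_zero[OF assms(1)] by auto
  show "P \<subseteq> wulff_shape J h"
  proof
    fix x assume x: "x \<in> P"
    have "\<bar>x \<bullet> u\<bar> \<le> h u" if u: "u \<in> sphere 0 1 \<inter> coord_space J" for u
      using support_fun_upper[OF b x, of u] support_fun_upper[OF b P(4)[OF x], of u] assms(2)[OF u]
      by (simp add: abs_le_iff)
    then show "x \<in> wulff_shape J h" using x P(1) by (auto simp: wulff_shape_def)
  qed
  show "wulff_shape J h \<subseteq> P"
  proof
    fix x assume x: "x \<in> wulff_shape J h"
    show "x \<in> P"
    proof (rule ccontr)
      assume "x \<notin> P"
      moreover have "x \<in> coord_space J" using x by (simp add: wulff_shape_def)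
      ultimately obtain y where y: "y \<in> coord_space J" "\<And>p. p \<in> P \<Longrightarrow> p \<bullet> y \<le> 1" "x \<bullet> y > 1"
        using separating_in_coord_space[OF assms(1)] by metis
      have y0: "norm y > 0" using y(3) by auto
      define u where "u = (1 / norm y) *\<^sub>R y"
      have u: "u \<in> sphere 0 1 \<inter> coord_space J" using y y0 by (auto simp: u_def intro: coord_space_scale)
      have "support_fun P u \<le> 1 / norm y"
        using y(2) y0 by (intro support_fun_least[OF ne]) (simp add: u_def divide_right_mono)
      moreover have "x \<bullet> u > 1 / norm y" using y(3) y0 by (simp add: u_def divide_strict_right_mono)
      moreover have "\<bar>x \<bullet> u\<bar> \<le> h u" using x u by (auto simp: wulff_shape_def)
      ultimately show False using assms(2)[OF u] by simp
    qed
  qed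
qed

lemma wulff_shape_sym_convex_bodies:
  assumes "continuous_on (sphere 0 1 \<inter> coord_space J) h"
    and "\<And>u. u \<in> sphere 0 1 \<inter> coord_space J \<Longrightarrow> 0 < h u"
  shows "wulff_shape J h \<in> sym_convex_bodies J"
proof -
  let ?S = "sphere 0 1 \<inter> coord_space J"
  have S: "compact ?S" by (simp add: compact_Int_closed closed_coord_space)
  obtain m where m: "0 < m" "\<And>u. u \<in> ?S \<Longrightarrow> m \<le> h u"
  proof (cases "?S = {}")
    case False
    obtain v where "v \<in> ?S" "\<forall>u\<in>?S. h v \<le> h u" using continuous_attains_inf[OF S False assms(1)] by auto
    then show ?thesis using that[of "h v"] assms(2) by blast
  qed (use that[of 1] in auto)
  obtain M where M: "0 < M" "\<And>u. u \<in> ?S \<Longrightarrow> h u \<le> M"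
  proof (cases "?S = {}")
    case False
    obtain v where "v \<in> ?S" "\<forall>u\<in>?S. h u \<le> h v" using continuous_attains_sup[OF S False assms(1)] by auto
    then show ?thesis using that[of "h v"] assms(2) by blast
  qed (use that[of 1] in auto)
  have eq: "wulff_shape J h = coord_space J \<inter> (\<Inter>u\<in>?S. {x. u \<bullet> x \<le> h u} \<inter> {x. (- u) \<bullet> x \<le> h u})"
    by (auto simp: wulff_shape_def abs_le_iff inner_commute)
  have cl: "closed (wulff_shape J h)"
    unfolding eq by (intro closed_Int closed_INT ballI closed_coord_space closed_halfspace_le)
  have cv: "convex (wulff_shape J h)"
    unfolding eq by (intro convex_Int convex_INT ballI convex_coord_space convex_halfspace_le)
  have bd: "norm x \<le> M" if x: "x \<in> wulff_shape J h" for x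
  proof (cases "x = 0")
    case False
    have u: "(1 / norm x) *\<^sub>R x \<in> ?S" using x False by (auto simp: wulff_shape_def intro: coord_space_scale)
    then have "\<bar>x \<bullet> ((1 / norm x) *\<^sub>R x)\<bar> \<le> h ((1 / norm x) *\<^sub>R x)"
      using x unfolding wulff_shape_def by blast
    also have "x \<bullet> ((1 / norm x) *\<^sub>R x) = norm x" using False by (simp add: dot_square_norm power2_eq_square)
    finally show ?thesis using M(2)[OF u] by simp
  qed (use M in auto)
  show ?thesis
  proof (rule sym_convex_bodiesI)
    show "wulff_shape J h \<subseteq> coord_space J" by (auto simp: wulff_shape_def)
    show "compact (wulff_shape J h)"
      using cl bd by (auto simp: compact_eq_bounded_closed bounded_iff)
    show "convex (wulff_shape J h)" by fact
    show "- x \<in> wulff_shape J h" if "x \<in> wulff_shape J h" for x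
      using that by (simp add: wulff_shape_def coord_space_minus)
    show "cball 0 m \<inter> coord_space J \<subseteq> wulff_shape J h"
    proof
      fix x assume x: "x \<in> cball 0 m \<inter> coord_space J"
      have "\<bar>x \<bullet> u\<bar> \<le> h u" if u: "u \<in> ?S" for u
      proof -
        have "\<bar>x \<bullet> u\<bar> \<le> norm x * norm u" by (rule Cauchy_Schwarz_ineq2)
        also have "\<dots> \<le> m" using u x by simp
        also have "\<dots> \<le> h u" by (rule m(2)[OF u])
        finally show ?thesis .
      qed
      then show "x \<in> wulff_shape J h" using x by (simp add: wulff_shape_def)
    qed
  qed (use m in auto)
qed

text \<open>Only the constraints are compared, so h and h' may be arbitrary functions that are not
  the support functions of their Wulff shapes.\<close>

lemma wulff_shape_within:
  assumes "t > 0" "\<And>u. u \<in> sphere 0 1 \<inter> coord_space J \<Longrightarrow> h u \<le> t * h' u"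
  shows "scaled_within t (wulff_shape J h) (wulff_shape J h')"
proof -
  have "(1/t) *\<^sub>R x \<in> wulff_shape J h'" if x: "x \<in> wulff_shape J h" for x
  proof -
    have "\<bar>((1/t) *\<^sub>R x) \<bullet> u\<bar> \<le> h' u" if u: "u \<in> sphere 0 1 \<inter> coord_space J" for u
    proof -
      have "\<bar>x \<bullet> u\<bar> \<le> t * h' u" using x assms(2)[OF u] u by (force simp: wulff_shape_def)
      then show ?thesis using assms(1) by (simp add: divide_simps mult.commute abs_mult)
    qed
    then show ?thesis using x by (auto simp: wulff_shape_def intro: coord_space_scale)
  qed
  then show ?thesis by (simp add: scaled_within_def)
qed

text \<open>A point x is matched with x/t at distance (1 - 1/t)|x|. Norms are at most R on P and
  hence at most tR on Q, so both directions stay below (t - 1)R and a norm bound for one of the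
  bodies suffices.\<close>

lemma hausdorff_dist_scaled_within:
  fixes P Q :: "'a::real_normed_vector set"
  assumes "scaled_within t P Q" "scaled_within t Q P" "1 \<le> t" "\<forall>x\<in>P. norm x \<le> R"
    and "P \<noteq> {}" "Q \<noteq> {}"
  shows "hausdorff_dist P Q \<le> (t - 1) * R"
proof -
  have R: "0 \<le> R" using assms(4,5) norm_ge_zero order_trans by blast
  have Q: "norm y \<le> t * R" if "y \<in> Q" for y
    using assms(4) scaled_withinD[OF assms(2) that] assms(3) by (force simp: field_simps)
  have b: "bounded P" "bounded Q" using assms(4) Q bounded_iff by blast+
  have s: "norm (x - (1 / t) *\<^sub>R x) = (1 - 1/t) * norm x" for x :: 'a
  proof -
    have "x - (1/t) *\<^sub>R x = (1 - 1/t) *\<^sub>R x" by (simp add: algebra_simps)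
    then show ?thesis using assms(3) by simp
  qed
  have le: "(1 - 1/t) * (t * R) = (t - 1) * R" "(1 - 1/t) * R \<le> (t - 1) * R"
  proof -
    show 1: "(1 - 1/t) * (t * R) = (t - 1) * R" using assms(3) by (simp add: field_simps)
    have "(1 - 1/t) * R \<le> (1 - 1/t) * (t * R)"
      using assms(3) R mult_right_mono[of 1 t R] by (intro mult_left_mono) auto
    then show "(1 - 1/t) * R \<le> (t - 1) * R" using 1 by simp
  qed
  have n0: "0 \<le> 1 - 1/t" using assms(3) by simp
  show ?thesis
    unfolding hausdorff_dist_le_iff[OF b(1) assms(5) b(2) assms(6)]
  proof (intro conjI ballI)
    fix x assume x: "x \<in> P"
    have "infdist x Q \<le> dist x ((1/t) *\<^sub>R x)" by (rule infdist_le[OF scaled_withinD[OF assms(1) x]])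
    also have "\<dots> = (1 - 1/t) * norm x" by (simp only: dist_norm s)
    also have "\<dots> \<le> (1 - 1/t) * R" using assms(4) x n0 by (intro mult_left_mono) auto
    finally show "infdist x Q \<le> (t - 1) * R" using le by simp
  next
    fix x assume x: "x \<in> Q"
    have "infdist x P \<le> dist x ((1/t) *\<^sub>R x)" by (rule infdist_le[OF scaled_withinD[OF assms(2) x]])
    also have "\<dots> = (1 - 1/t) * norm x" by (simp only: dist_norm s)
    also have "\<dots> \<le> (1 - 1/t) * (t * R)" using Q[OF x] n0 by (intro mult_left_mono) auto
    finally show "infdist x P \<le> (t - 1) * R" using le by simp
  qed
qed

text \<open>Joint continuity: for unit vectors u the value moves by at most the Hausdorff distance
  when P changes, and for fixed P it is Lipschitz in u with constant the outer radius R of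
  P.\<close>

lemma continuous_map_support_fun:
  assumes "\<S> \<subseteq> sym_convex_bodies J"
  shows "continuous_map (prod_topology (Metric_space.mtopology \<S> hausdorff_dist)
           (top_of_set (sphere 0 1 \<inter> coord_space J))) euclideanreal (\<lambda>(P, u). support_fun P u)"
proof -
  let ?S = "sphere 0 1 \<inter> coord_space J"
  have cp: "compact P \<and> P \<noteq> {}" if "P \<in> \<S>" for P
    using assms that sym_convex_bodiesD(2) sym_convex_bodies_zero by blast
  interpret M: Metric_space \<S> hausdorff_dist
    by (rule Metric_space_hausdorff_dist[OF cp])
  have "\<exists>U. openin (prod_topology M.mtopology (top_of_set ?S)) U \<and> (P, u) \<in> U \<and>
            (\<forall>(Q, v)\<in>U. dist (support_fun P u) (support_fun Q v) < e)"
    if P: "P \<in> \<S>" and u: "u \<in> ?S" and e: "e > 0" for P u e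
  proof -
    obtain R where R: "0 < R" "\<forall>x\<in>P. norm x \<le> R"
      using sym_convex_bodies_outer_ball assms P by blast
    \<comment> \<open>Changing the direction costs R * d and changing the body costs d, in total
      e/2.\<close>
    define d where "d = e / 2 / (1 + R)"
    have d: "0 < d" using e R by (simp add: d_def)
    have de: "d + R * d < e"
    proof -
      have "d + R * d = d * (1 + R)" by (simp add: algebra_simps)
      also have "\<dots> = e / 2"
        using nonzero_eq_divide_eq[of "1 + R" d "e / 2"] R d_def by simp
      finally show ?thesis using e by simp
    qed
    show ?thesis
    proof (intro exI conjI)
      show "openin (prod_topology M.mtopology (top_of_set ?S)) (M.mball P d \<times> (?S \<inter> ball u d))"
        by (auto simp: openin_prod_Times_iff)
      show "(P, u) \<in> M.mball P d \<times> (?S \<inter> ball u d)" using P u d by auto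
      show "\<forall>(Q, v)\<in>M.mball P d \<times> (?S \<inter> ball u d). dist (support_fun P u) (support_fun Q v) < e"
      proof clarify
        fix Q v assume Q: "Q \<in> M.mball P d" and v: "v \<in> sphere 0 1" "v \<in> coord_space J" "v \<in> ball u d"
        have n: "norm v \<le> 1" using v by simp
        have Qd: "Q \<in> \<S>" "hausdorff_dist P Q < d" using Q by auto
        have "support_fun P v \<le> support_fun Q v + hausdorff_dist P Q"
             "support_fun Q v \<le> support_fun P v + hausdorff_dist Q P"
          using cp[OF P] cp[OF Qd(1)] n by (auto intro!: support_fun_hausdorff)
        moreover have "support_fun P u \<le> support_fun P v + R * dist u v"
             "support_fun P v \<le> support_fun P u + R * dist v u"
          using cp[OF P] R by (auto intro!: support_fun_lipschitz)
        moreover have "R * dist u v \<le> R * d" using v R by (intro mult_left_mono) auto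
        ultimately show "dist (support_fun P u) (support_fun Q v) < e"
          using Qd(2) de by (simp add: dist_real_def hausdorff_dist_commute[of Q P] dist_commute[of v u])
      qed
    qed
  qed
  then have "continuous_map (prod_topology M.mtopology (top_of_set ?S)) Met_TC.mtopology (\<lambda>(P, u). support_fun P u)"
    unfolding Met_TC.continuous_map_to_metric by (fastforce simp: mball_eq_ball)
  then show ?thesis by simp
qed

section \<open>Absolute retracts from multiplicative retractions\<close>

lemma absolute_retract_hausdorff:
  fixes J :: "'k::finite set"
  assumes \<S>: "\<S> \<subseteq> sym_convex_bodies J"
    and r: "\<And>X. X \<in> sym_convex_bodies J \<Longrightarrow> r X \<in> \<S>"
    and r_id: "\<And>P. P \<in> \<S> \<Longrightarrow> r P = P"
    and r_within: "\<And>t X Y. \<lbrakk>1 \<le> t; X \<in> sym_convex_bodies J; Y \<in> sym_convex_bodies J;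
        scaled_within t X Y; scaled_within t Y X\<rbrakk> \<Longrightarrow> scaled_within (t ^ k) (r X) (r Y)"
  shows "absolute_retract TYPE('z) (Metric_space.mtopology \<S> hausdorff_dist)"
proof -
  let ?S = "sphere 0 1 \<inter> coord_space J"
  let ?Y = "top_of_set ?S"
  have cp: "compact P \<and> P \<noteq> {}" if "P \<in> \<S>" for P
    using \<S> that sym_convex_bodiesD(2) sym_convex_bodies_zero by blast
  interpret M: Metric_space \<S> hausdorff_dist
    by (rule Metric_space_hausdorff_dist[OF cp])
  have "(f ` \<S>) retract_of_space Z"
    if Z: "metrizable_space Z" and f: "embedding_map M.mtopology Z f" and cl: "closedin Z (f ` \<S>)"
    for Z :: "'z topology" and f
  proof -
    let ?A = "f ` \<S>"
    have "homeomorphic_map M.mtopology (subtopology Z ?A) f"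
      using f by (simp add: embedding_map_def)
    then obtain g where "homeomorphic_maps M.mtopology (subtopology Z ?A) f g"
      by (auto simp: homeomorphic_map_maps)
    then have cf: "continuous_map M.mtopology (subtopology Z ?A) f"
      and cg: "continuous_map (subtopology Z ?A) M.mtopology g" and gf: "\<And>P. P \<in> \<S> \<Longrightarrow> g (f P) = P"
      by (auto simp: homeomorphic_maps_def)
    let ?W = "prod_topology Z ?Y"
    \<comment> \<open>A product of normal spaces may fail to be normal; here both factors are
      metrizable, hence so is the product.\<close>
    have normal: "normal_space ?W"
      using Z by (intro metrizable_imp_normal_space)
        (simp add: metrizable_space_prod_topology metrizable_space_subtopology metrizable_space_euclidean)
    have clB: "closedin ?W (?A \<times> ?S)" using cl by (auto simp: closedin_prod_Times_iff)
    have sub: "subtopology ?W (?A \<times> ?S) = prod_topology (subtopology Z ?A) ?Y"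
      by (simp add: subtopology_Times subtopology_subtopology)
    have "continuous_map (subtopology ?W (?A \<times> ?S)) (prod_topology M.mtopology ?Y) (\<lambda>p. (g (fst p), snd p))"
      unfolding sub
      by (intro continuous_map_pairedI continuous_map_snd
            continuous_map_compose[OF continuous_map_fst cg, unfolded o_def])
    from continuous_map_compose[OF this continuous_map_support_fun[OF \<S>]]
    have "continuous_map (subtopology ?W (?A \<times> ?S)) euclideanreal (\<lambda>p. support_fun (g (fst p)) (snd p))"
      by (simp add: o_def)
    moreover have "support_fun (g (fst p)) (snd p) \<in> {0<..}" if "p \<in> topspace (subtopology ?W (?A \<times> ?S))" for p
    proof -
      have "p \<in> ?A \<times> ?S" using that unfolding topspace_subtopology by (rule IntD2)
      then have p: "fst p \<in> ?A" "snd p \<in> ?S" unfolding mem_Times_iff by blast+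
      from p(1) obtain P where P: "fst p = f P" "P \<in> \<S>" by (rule imageE)
      then show ?thesis using p(2) gf[OF P(2)] support_fun_pos[OF subsetD[OF \<S> P(2)]] by simp
    qed
    ultimately have h0: "continuous_map (subtopology ?W (?A \<times> ?S)) (top_of_set {0<..})
        (\<lambda>p. support_fun (g (fst p)) (snd p))"
      by (intro continuous_map_into_subtopology funcsetI)
    have ln0: "continuous_map (top_of_set {0<..}) euclideanreal ln"
      by (auto intro!: continuous_on_ln)
    have h: "continuous_map (subtopology ?W (?A \<times> ?S)) euclideanreal
        (\<lambda>p. ln (support_fun (g (fst p)) (snd p)))"
      using continuous_map_compose[OF h0 ln0] unfolding o_def .
    obtain L where L: "continuous_map ?W euclideanreal L"
      and LA: "\<And>p. p \<in> ?A \<times> ?S \<Longrightarrow> L p = ln (support_fun (g (fst p)) (snd p))"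
      by (rule Tietze_extension_realinterval[OF normal clB is_interval_univ UNIV_not_empty h subset_UNIV])
        metis
    define X where "X z = wulff_shape J (\<lambda>u. exp (L (z, u)))" for z
    have L_section: "continuous_on ?S (\<lambda>u. L (z, u))" if "z \<in> topspace Z" for z
    proof -
      have "continuous_map ?Y ?W (\<lambda>u. (z, u))"
        using that by (intro continuous_map_pairedI) auto
      from continuous_map_compose[OF this L] show ?thesis by (simp add: o_def)
    qed
    have X: "X z \<in> sym_convex_bodies J" if "z \<in> topspace Z" for z
      unfolding X_def using L_section[OF that]
      by (intro wulff_shape_sym_convex_bodies continuous_on_exp) auto
    have XA: "X (f P) = P" if P: "P \<in> \<S>" for P
      unfolding X_def
    proof (rule wulff_shape_support_fun)
      show "P \<in> sym_convex_bodies J" using P \<S> by blast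
      then show "exp (L (f P, u)) = support_fun P u" if "u \<in> ?S" for u
        using LA[of "(f P, u)"] P that gf support_fun_pos by simp
    qed
    have "continuous_map Z M.mtopology (\<lambda>z. r (X z))"
      unfolding M.continuous_map_to_metric
    proof (intro ballI allI impI)
      fix z and e :: real assume z: "z \<in> topspace Z" and e: "e > 0"
      have rz: "r (X z) \<in> \<S>" by (rule r[OF X[OF z]])
      obtain R where R: "0 < R" "\<forall>x\<in>r (X z). norm x \<le> R"
        using sym_convex_bodies_outer_ball \<S> rz by blast
      \<comment> \<open>With t = exp d this gives t^k <= 1 + e/(2R), hence (t^k - 1)R < e. Dividing
        by k + 1 instead of k covers k = 0.\<close>
      define d where "d = ln (1 + e / (2 * R)) / (real k + 1)"
      have q: "1 + e / (2 * R) > 1" using e R by simp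
      have d: "d > 0" using q by (simp add: d_def)
      define t where "t = exp d"
      have t: "1 \<le> t" using d by (simp add: t_def)
      have "t ^ k = exp (real k * d)" by (simp add: t_def exp_of_nat_mult)
      also have "\<dots> \<le> exp (ln (1 + e / (2 * R)))"
      proof -
        have "real k * d \<le> (real k + 1) * d" using d by simp
        also have "\<dots> = ln (1 + e / (2 * R))" by (simp add: d_def)
        finally show ?thesis by simp
      qed
      finally have "t ^ k - 1 \<le> e / (2 * R)" using q by simp
      then have "(t ^ k - 1) * R \<le> (e / (2 * R)) * R" using R by (intro mult_right_mono) auto
      then have small: "(t ^ k - 1) * R < e" using R e by simp
      \<comment> \<open>The estimate on logarithms is needed for all directions at once. Compactness
        of the sphere and the tube lemma provide one neighbourhood of z that works for every
        u.\<close>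
      let ?N = "{p \<in> topspace ?W. L p - L (z, snd p) \<in> {-d<..<d}}"
      have "continuous_map ?W ?W (\<lambda>p. (z, snd p))"
        using z by (intro continuous_map_pairedI continuous_map_snd) auto
      from continuous_map_compose[OF this L] have "continuous_map ?W euclideanreal (\<lambda>p. L (z, snd p))"
        by (simp add: o_def)
      then have N1: "openin ?W ?N"
        using L by (intro openin_continuous_map_preimage[where Y = euclideanreal]
            continuous_map_diff) auto
      have N2: "compactin ?Y ?S"
        by (simp add: compactin_subtopology compact_Int_closed closed_coord_space)
      have N3: "{z} \<times> ?S \<subseteq> ?N" using z d by auto
      from tube_lemma_right[OF N1 N2 z N3]
      obtain U V where U: "openin Z U" "z \<in> U" "?S \<subseteq> V" "U \<times> V \<subseteq> ?N"
        by (elim exE conjE)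
      have "r (X y) \<in> M.mball (r (X z)) e" if y: "y \<in> U" for y
      proof -
        have yZ: "y \<in> topspace Z" using y U(1) openin_subset by blast
        have close: "\<bar>L (y, u) - L (z, u)\<bar> < d" if u: "u \<in> ?S" for u
        proof -
          have "(y, u) \<in> ?N" using y u U by blast
          then show ?thesis by auto
        qed
        have "scaled_within t (X y) (X z)" "scaled_within t (X z) (X y)"
          unfolding X_def
          using close by (intro wulff_shape_within; force simp: t_def simp flip: exp_add)+
        then have "scaled_within (t ^ k) (r (X z)) (r (X y))" "scaled_within (t ^ k) (r (X y)) (r (X z))"
          using r_within[OF t] X yZ z by blast+
        then have "hausdorff_dist (r (X z)) (r (X y)) \<le> (t ^ k - 1) * R"
          using R t cp r[OF X[OF yZ]] rz
          by (intro hausdorff_dist_scaled_within) (auto simp: one_le_power)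
        then show ?thesis using small rz r[OF X[OF yZ]] by simp
      qed
      then show "\<exists>U. openin Z U \<and> z \<in> U \<and> (\<forall>y\<in>U. r (X y) \<in> M.mball (r (X z)) e)" using U by blast
    qed
    from continuous_map_compose[OF this cf]
    have "continuous_map Z (subtopology Z ?A) (\<lambda>z. f (r (X z)))" by (simp add: o_def)
    moreover have "f (r (X a)) = a" if "a \<in> ?A" for a
      using that XA r_id by auto
    ultimately show ?thesis
      using closedin_subset[OF cl] by (auto simp: retract_of_space_def)
  qed
  then show ?thesis
    by (simp add: absolute_retract_def M.metrizable_space_mtopology)
qed

section \<open>Tensor products of convex bodies\<close>

lemma tensor_scale: "tensor (\<lambda>i. c i *\<^sub>R x i) = (\<Prod>i\<in>UNIV. c i) *\<^sub>R tensor x"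
  by (simp add: tensor_def vec_eq_iff prod.distrib)

lemma tensor_fun_upd_nth:
  "tensor (x(i := v)) $ m = v $ m i * (\<Prod>j\<in>UNIV - {i}. x j $ m j)"
proof -
  have "tensor (x(i := v)) $ m = (\<Prod>j\<in>UNIV. (x(i := v)) j $ m j)" by (simp add: tensor_def)
  also have "\<dots> = (x(i := v)) i $ m i * (\<Prod>j\<in>UNIV - {i}. (x(i := v)) j $ m j)"
    by (rule prod.remove) auto
  also have "(\<Prod>j\<in>UNIV - {i}. (x(i := v)) j $ m j) = (\<Prod>j\<in>UNIV - {i}. x j $ m j)"
    by (rule prod.cong) auto
  finally show ?thesis by (simp only: fun_upd_same)
qed

lemma linear_tensor_fun_upd: "linear (\<lambda>v. tensor (x(i := v)))"
  by (rule linearI) (simp_all add: vec_eq_iff tensor_fun_upd_nth algebra_simps)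

lemma norm_tensor: "norm (tensor x) = (\<Prod>i\<in>UNIV. norm (x i))"
proof -
  have "(norm (tensor x))\<^sup>2 = (\<Prod>i\<in>UNIV. norm (x i))\<^sup>2"
    by (simp add: power2_norm_eq_inner inner_tensor prod_power_distrib)
  then show ?thesis by (simp add: prod_nonneg power2_eq_iff_nonneg)
qed

lemma tensor_axis: "tensor (\<lambda>i. axis (m i) 1) = axis m 1"
proof -
  have "(\<Prod>i\<in>UNIV. axis (m i) 1 $ n i) = (axis m 1 $ n :: real)" for n
  proof (cases "n = m")
    case False
    then obtain i where "n i \<noteq> m i" by auto
    then have "(\<Prod>i\<in>UNIV. axis (m i) 1 $ n i) = (0::real)"
      by (intro prod_zero) (auto simp: axis_def)
    then show ?thesis using False by (simp add: axis_def)
  qed (simp add: axis_def)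
  then show ?thesis by (simp add: tensor_def vec_eq_iff)
qed

definition tensors :: "('l::finite \<Rightarrow> (real^'n::finite) set) \<Rightarrow> (real^('l \<Rightarrow> 'n)) set" where
  "tensors Q = {tensor x | x. \<forall>i. x i \<in> Q i}"

lemma proj_tensor_eq: "proj_tensor Q = convex hull (tensors Q)"
  by (simp add: proj_tensor_def tensors_def)

lemma tensor_in_proj_tensor: "(\<And>i. x i \<in> Q i) \<Longrightarrow> tensor x \<in> proj_tensor Q"
  unfolding proj_tensor_eq by (intro hull_inc) (auto simp: tensors_def)

lemma compact_tensors:
  assumes "\<And>i. compact (Q i)"
  shows "compact (tensors Q)"
proof -
  have "compactin (product_topology (\<lambda>_. euclidean) UNIV) (PiE UNIV Q)"
    unfolding compactin_PiE using assms by simp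
  then have "compact (PiE UNIV Q)" by (simp add: euclidean_product_topology)
  moreover have "continuous_on (PiE UNIV Q) tensor"
    unfolding tensor_def
    by (intro continuous_intros continuous_on_subset[OF continuous_on_product_coordinates]) auto
  ultimately have "compact (tensor ` PiE UNIV Q)" by (rule compact_continuous_image[rotated])
  moreover have "tensor ` PiE UNIV Q = tensors Q" by (auto simp: tensors_def PiE_UNIV_domain)
  ultimately show ?thesis by simp
qed

lemma tensors_subset:
  assumes "\<And>i. Q i \<subseteq> coord_space (I i)"
  shows "tensors Q \<subseteq> coord_space (multi_indices I)"
  unfolding tensors_def using assms by (blast intro: tensor_in_coord_space)

lemma convex_hull_minus:
  assumes "\<And>x. x \<in> F \<Longrightarrow> - x \<in> F" "x \<in> convex hull F"
  shows "- x \<in> convex hull (F :: 'a::real_vector set)"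
proof -
  have "uminus ` F \<subseteq> F" using assms(1) by blast
  then have "uminus ` (convex hull F) \<subseteq> convex hull F"
    using convex_hull_linear_image[OF linear_uminus, of F] hull_mono[of "uminus ` F" F convex] by simp
  then show ?thesis using assms(2) by blast
qed

text \<open>Negating a single slot negates the tensor; \<open>undefined\<close> serves as an
  arbitrary index.\<close>

lemma tensors_minus:
  assumes "\<And>i x. x \<in> Q i \<Longrightarrow> - x \<in> Q i" "T \<in> tensors Q"
  shows "- T \<in> tensors Q"
proof -
  obtain x where x: "T = tensor x" "\<And>i. x i \<in> Q i" using assms(2) by (auto simp: tensors_def)
  have "- T = tensor (x(undefined := - x undefined))"
    using linear_neg[OF linear_tensor_fun_upd[of x undefined], of "x undefined"] x by simp
  moreover have "(x(undefined := - x undefined)) i \<in> Q i" for i using x assms(1) by auto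
  ultimately show ?thesis unfolding tensors_def by blast
qed

text \<open>The inner ball comes from coordinate vectors: \<open>axis m 1\<close> times the product
  \<delta> of the inner radii is a tensor of points of the factors, and the hull then contains all
  vectors of small norm.\<close>

lemma proj_tensor_sym_convex_bodies:
  fixes I :: "'l::finite \<Rightarrow> 'n::finite set"
  assumes Q: "\<And>i. Q i \<in> sym_convex_bodies (I i)"
  shows "proj_tensor Q \<in> sym_convex_bodies (multi_indices I)"
proof -
  let ?M = "multi_indices I"
  have "\<forall>i. \<exists>m>0. cball 0 m \<inter> coord_space (I i) \<subseteq> Q i"
    using sym_convex_bodies_inner_ball[OF Q] by metis
  then obtain \<rho> where \<rho>: "\<And>i. 0 < \<rho> i" "\<And>i. cball 0 (\<rho> i) \<inter> coord_space (I i) \<subseteq> Q i" by metis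
  define \<delta> where "\<delta> = (\<Prod>i\<in>UNIV. \<rho> i)"
  have \<delta>: "0 < \<delta>" using \<rho> by (simp add: \<delta>_def prod_pos)
  have cv: "convex (proj_tensor Q)" by (simp add: proj_tensor_eq)
  have minus: "- T \<in> proj_tensor Q" if "T \<in> proj_tensor Q" for T
    using that unfolding proj_tensor_eq
    by (intro convex_hull_minus tensors_minus) (auto intro: sym_convex_bodiesD(4)[OF Q])
  have zero: "0 \<in> proj_tensor Q"
  proof -
    have "tensor (\<lambda>_::'l. 0 :: real^'n) = 0"
      using norm_tensor[of "\<lambda>_. 0"] by (simp add: power_0_left)
    then show ?thesis
      using tensor_in_proj_tensor[of "\<lambda>_. 0" Q] sym_convex_bodies_zero[OF Q] by simp
  qed
  \<comment> \<open>The point divides the segment between the two opposite vectors with coefficients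
    \<delta> and -\<delta>.\<close>
  have axis: "c *\<^sub>R axis m 1 \<in> proj_tensor Q" if m: "m \<in> ?M" and c: "\<bar>c\<bar> \<le> \<delta>" for c m
  proof -
    have "tensor (\<lambda>i. \<rho> i *\<^sub>R axis (m i) 1) \<in> proj_tensor Q"
    proof (rule tensor_in_proj_tensor)
      show "\<rho> i *\<^sub>R axis (m i) 1 \<in> Q i" for i
        using \<rho>(1)[of i] m
        by (intro subsetD[OF \<rho>(2)]) (auto simp: multi_indices_def intro!: coord_space_scale axis_in_coord_space)
    qed
    then have d: "\<delta> *\<^sub>R axis m 1 \<in> proj_tensor Q" by (simp add: tensor_scale tensor_axis \<delta>_def)
    have "((1 + c / \<delta>) / 2) *\<^sub>R (\<delta> *\<^sub>R axis m 1) + ((1 - c / \<delta>) / 2) *\<^sub>R (- (\<delta> *\<^sub>R axis m (1::real)))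
        \<in> proj_tensor Q"
      using \<delta> c by (intro convexD[OF cv d minus[OF d]]) (auto simp: field_simps abs_le_iff)
    also have "((1 + c / \<delta>) / 2) *\<^sub>R (\<delta> *\<^sub>R axis m 1) + ((1 - c / \<delta>) / 2) *\<^sub>R (- (\<delta> *\<^sub>R axis m (1::real)))
        = ((1 + c / \<delta>) / 2 * \<delta> - (1 - c / \<delta>) / 2 * \<delta>) *\<^sub>R axis m 1"
      by (simp add: scaleR_left_diff_distrib)
    also have "(1 + c / \<delta>) / 2 * \<delta> - (1 - c / \<delta>) / 2 * \<delta> = c"
      using \<delta> by (simp add: field_simps)
    finally show ?thesis .
  qed
  let ?N = "real CARD('l \<Rightarrow> 'n)"
  show ?thesis
  proof (rule sym_convex_bodiesI)
    show "compact (proj_tensor Q)"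
      unfolding proj_tensor_eq by (intro compact_convex_hull compact_tensors sym_convex_bodiesD(2)[OF Q])
    show "proj_tensor Q \<subseteq> coord_space ?M"
      unfolding proj_tensor_eq
      by (intro hull_minimal tensors_subset convex_coord_space sym_convex_bodiesD(1)[OF Q])
    show "0 < \<delta> / ?N" using \<delta> by simp
    show "cball 0 (\<delta> / ?N) \<inter> coord_space ?M \<subseteq> proj_tensor Q"
    proof
      fix x assume x: "x \<in> cball 0 (\<delta> / ?N) \<inter> coord_space ?M"
      \<comment> \<open>x is the average of its N components, each blown up by N; components outside
        \<open>multi_indices I\<close> vanish and contribute 0. This explains the radius \<delta> /
        N.\<close>
      have "(\<Sum>m\<in>UNIV. (1 / ?N) *\<^sub>R ((?N * x $ m) *\<^sub>R axis m 1)) \<in> proj_tensor Q"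
      proof (rule convex_sum[OF _ cv])
        show "(?N * x $ m) *\<^sub>R axis m 1 \<in> proj_tensor Q" for m
        proof (cases "m \<in> ?M")
          case True
          have "\<bar>x $ m\<bar> \<le> \<delta> / ?N" using component_le_norm_cart[of x m] x by simp
          then have "\<bar>?N * x $ m\<bar> \<le> \<delta>" by (simp add: abs_mult pos_le_divide_eq mult.commute)
          then show ?thesis by (rule axis[OF True])
        next
          case False
          then show ?thesis using x zero by (simp add: coord_space_def)
        qed
      qed auto
      also have "(\<Sum>m\<in>UNIV. (1 / ?N) *\<^sub>R ((?N * x $ m) *\<^sub>R axis m 1)) = x"
        using basis_expansion[of x] by (simp add: scalar_mult_eq_scaleR)
      finally show "x \<in> proj_tensor Q" .
    qed
  qed (use cv minus in auto)
qed

lemma inj_tensor_sym_convex_bodies: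
  assumes "\<And>i. Q i \<in> sym_convex_bodies (I i)"
  shows "inj_tensor I Q \<in> sym_convex_bodies (multi_indices I)"
  unfolding inj_tensor_def
  by (intro polar_sym_convex_bodies proj_tensor_sym_convex_bodies assms)

lemma polar_convex_hull: "polar J (convex hull F) = polar J F"
proof
  show "polar J (convex hull F) \<subseteq> polar J F" by (auto simp: polar_def hull_inc)
  show "polar J F \<subseteq> polar J (convex hull F)"
  proof
    fix y assume y: "y \<in> polar J F"
    have "convex hull F \<subseteq> {x. y \<bullet> x \<le> 1}"
      using y by (intro hull_minimal convex_halfspace_le) (auto simp: polar_def inner_commute)
    then show "y \<in> polar J (convex hull F)" using y by (auto simp: polar_def inner_commute)
  qed
qed

lemma mem_inj_tensor:
  "T \<in> inj_tensor I Q \<longleftrightarrow> T \<in> coord_space (multi_indices I) \<and>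
     (\<forall>y. (\<forall>i. y i \<in> polar (I i) (Q i)) \<longrightarrow> tensor y \<bullet> T \<le> 1)"
  unfolding inj_tensor_def proj_tensor_eq polar_convex_hull
  by (auto simp: polar_def[of "multi_indices I"] tensors_def)

lemma abs_inner_polar_le:
  assumes "Q \<in> sym_convex_bodies J" "x \<in> Q" "y \<in> polar J Q"
  shows "\<bar>x \<bullet> y\<bar> \<le> 1"
proof -
  have "x \<bullet> y \<le> 1" using assms by (simp add: polar_def)
  moreover have "(- x) \<bullet> y \<le> 1" using assms(3) sym_convex_bodiesD(4)[OF assms(1,2)] unfolding polar_def by blast
  ultimately show ?thesis by (simp add: abs_le_iff)
qed

lemma proj_tensor_subset_inj_tensor:
  assumes "\<And>i. Q i \<in> sym_convex_bodies (I i)"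
  shows "proj_tensor Q \<subseteq> inj_tensor I Q"
  unfolding proj_tensor_eq
proof (rule hull_minimal)
  show "convex (inj_tensor I Q)" by (rule sym_convex_bodiesD(3)[OF inj_tensor_sym_convex_bodies[OF assms]])
  show "tensors Q \<subseteq> inj_tensor I Q"
  proof
    fix T assume "T \<in> tensors Q"
    then obtain x where x: "T = tensor x" "\<And>i. x i \<in> Q i" by (auto simp: tensors_def)
    have "tensor y \<bullet> tensor x \<le> 1" if y: "\<And>i. y i \<in> polar (I i) (Q i)" for y
    proof -
      have "(\<Prod>i\<in>UNIV. y i \<bullet> x i) \<le> \<bar>\<Prod>i\<in>UNIV. y i \<bullet> x i\<bar>" by simp
      also have "\<dots> = (\<Prod>i\<in>UNIV. \<bar>x i \<bullet> y i\<bar>)" by (simp add: abs_prod inner_commute)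
      also have "\<dots> \<le> 1" by (intro prod_le_1) (auto intro: abs_inner_polar_le[OF assms x(2) y])
      finally show ?thesis by (simp add: inner_tensor)
    qed
    moreover have "T \<in> coord_space (multi_indices I)"
      unfolding x(1) using x(2) sym_convex_bodiesD(1)[OF assms] by (blast intro: tensor_in_coord_space)
    ultimately show "T \<in> inj_tensor I Q" by (simp add: mem_inj_tensor x(1))
  qed
qed

text \<open>X is first cut down to the upper bound and then enlarged by the lower one. The hull
  stays below the upper bound, which is convex and contains the lower one, and an X already between
  the bounds is unchanged.\<close>

definition sandwich ::
    "('l::finite \<Rightarrow> 'n::finite set) \<Rightarrow> ('l \<Rightarrow> (real^'n) set) \<Rightarrow> (real^('l \<Rightarrow> 'n)) set \<Rightarrow> (real^('l \<Rightarrow> 'n)) set" where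
  "sandwich I Q X = convex hull (proj_tensor Q \<union> (X \<inter> inj_tensor I Q))"

lemma sandwich_bounds:
  assumes "\<And>i. Q i \<in> sym_convex_bodies (I i)"
  shows "proj_tensor Q \<subseteq> sandwich I Q X" "sandwich I Q X \<subseteq> inj_tensor I Q"
proof -
  show "proj_tensor Q \<subseteq> sandwich I Q X"
    unfolding sandwich_def using hull_subset[of "proj_tensor Q \<union> (X \<inter> inj_tensor I Q)" convex] by blast
  show "sandwich I Q X \<subseteq> inj_tensor I Q"
    unfolding sandwich_def
    using proj_tensor_subset_inj_tensor[of Q I, OF assms]
    by (intro hull_minimal sym_convex_bodiesD(3)[OF inj_tensor_sym_convex_bodies[OF assms]]) auto
qed

lemma sandwich_sym_convex_bodies:
  assumes Q: "\<And>i. Q i \<in> sym_convex_bodies (I i)" and X: "X \<in> sym_convex_bodies (multi_indices I)"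
  shows "sandwich I Q X \<in> sym_convex_bodies (multi_indices I)"
proof -
  note p = proj_tensor_sym_convex_bodies[of Q I, OF Q] and j = inj_tensor_sym_convex_bodies[of Q I, OF Q]
  obtain m where m: "0 < m" "cball 0 m \<inter> coord_space (multi_indices I) \<subseteq> proj_tensor Q"
    by (rule sym_convex_bodies_inner_ball[OF p])
  show ?thesis
  proof (rule sym_convex_bodiesI)
    show "compact (sandwich I Q X)"
      unfolding sandwich_def
      by (intro compact_convex_hull compact_Un compact_Int sym_convex_bodiesD(2)[OF p]
          sym_convex_bodiesD(2)[OF j] sym_convex_bodiesD(2)[OF X])
    show "convex (sandwich I Q X)" by (simp add: sandwich_def)
    show "sandwich I Q X \<subseteq> coord_space (multi_indices I)"
      using sandwich_bounds(2)[of Q I X, OF Q] sym_convex_bodiesD(1)[OF j] by blast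
    show "- x \<in> sandwich I Q X" if "x \<in> sandwich I Q X" for x
      using that unfolding sandwich_def
      by (intro convex_hull_minus)
        (auto intro: sym_convex_bodiesD(4)[OF p] sym_convex_bodiesD(4)[OF j] sym_convex_bodiesD(4)[OF X])
    show "cball 0 m \<inter> coord_space (multi_indices I) \<subseteq> sandwich I Q X"
      using m(2) sandwich_bounds(1)[of Q I X, OF Q] by blast
  qed (rule m)
qed

lemma sandwich_tensorial_bodies:
  assumes "\<And>i. Q i \<in> sym_convex_bodies (I i)" "X \<in> sym_convex_bodies (multi_indices I)"
  shows "sandwich I Q X \<in> tensorial_bodies I"
  using sandwich_sym_convex_bodies[of Q I X] sandwich_bounds[of Q I X] assms
  unfolding tensorial_bodies_def by blast

lemma sandwich_eq:
  assumes "proj_tensor Q \<subseteq> P" "P \<subseteq> inj_tensor I Q" "convex P"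
  shows "sandwich I Q P = P"
proof -
  have "proj_tensor Q \<union> (P \<inter> inj_tensor I Q) = P" using assms by blast
  then show ?thesis using assms(3) by (simp add: sandwich_def convex_hull_eq)
qed

text \<open>Each slot of an elementary tensor absorbs one factor 1/t.\<close>

lemma scaled_within_proj_tensor:
  assumes "\<And>i. scaled_within t (Q i) (Q' i)"
  shows "scaled_within (t ^ CARD('l)) (proj_tensor Q) (proj_tensor (Q' :: 'l::finite \<Rightarrow> (real^'n::finite) set))"
  unfolding proj_tensor_eq
proof (rule scaled_within_convex_hull)
  have "(1 / t ^ CARD('l)) *\<^sub>R T \<in> tensors Q'" if "T \<in> tensors Q" for T
  proof -
    obtain x where x: "T = tensor x" "\<And>i. x i \<in> Q i"
      using \<open>T \<in> tensors Q\<close> unfolding tensors_def by blast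
    have "(1 / t ^ CARD('l)) *\<^sub>R T = tensor (\<lambda>i. (1 / t) *\<^sub>R x i)"
      by (simp add: x tensor_scale power_one_over)
    moreover have "(1 / t) *\<^sub>R x i \<in> Q' i" for i using assms x(2) by (rule scaled_withinD)
    ultimately show ?thesis unfolding tensors_def by blast
  qed
  then show "scaled_within (t ^ CARD('l)) (tensors Q) (tensors Q')" by (simp add: scaled_within_def)
qed

lemma scaled_within_inj_tensor:
  fixes I :: "'l::finite \<Rightarrow> 'n::finite set"
  assumes "\<And>i. scaled_within t (Q i) (Q' i)" "0 < t"
  shows "scaled_within (t ^ CARD('l)) (inj_tensor I Q) (inj_tensor I Q')"
  unfolding inj_tensor_def
  by (intro scaled_within_polar scaled_within_proj_tensor assms) (use assms in simp)

text \<open>Intersection and union need one common factor. The bounds change by t to the number of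
  slots and X by s; the product dominates both because each is at least 1.\<close>

lemma scaled_within_sandwich:
  fixes I :: "'l::finite \<Rightarrow> 'n::finite set"
  assumes "\<And>i. scaled_within t (Q i) (Q' i)" "1 \<le> t" "scaled_within s X Y" "1 \<le> s"
    and Q': "\<And>i. Q' i \<in> sym_convex_bodies (I i)" and Y: "Y \<in> sym_convex_bodies (multi_indices I)"
  shows "scaled_within (s * t ^ CARD('l)) (sandwich I Q X) (sandwich I Q' Y)"
  unfolding sandwich_def
proof (rule scaled_within_convex_hull)
  let ?t = "t ^ CARD('l)"
  have t: "1 \<le> ?t" "0 < t" "0 < ?t" using assms(2) by (auto intro: one_le_power)
  have le: "?t \<le> s * ?t" "s \<le> s * ?t"
    using assms(4) t mult_right_mono[of 1 s ?t] mult_left_mono[of 1 ?t s] by auto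
  have "scaled_within (s * ?t) (proj_tensor Q) (proj_tensor Q')"
    by (rule scaled_within_mono[OF scaled_within_proj_tensor[of t Q Q', OF assms(1)] t(3) le(1)
          proj_tensor_sym_convex_bodies[of Q' I, OF Q']])
  moreover have "scaled_within (s * ?t) (inj_tensor I Q) (inj_tensor I Q')"
    by (rule scaled_within_mono[OF scaled_within_inj_tensor[of t Q Q' I, OF assms(1) t(2)] t(3) le(1)
          inj_tensor_sym_convex_bodies[of Q' I, OF Q']])
  moreover have "scaled_within (s * ?t) X Y"
    by (rule scaled_within_mono[OF assms(3) _ le(2) Y]) (use assms in simp)
  ultimately show "scaled_within (s * ?t) (proj_tensor Q \<union> (X \<inter> inj_tensor I Q)) (proj_tensor Q' \<union> (Y \<inter> inj_tensor I Q'))"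
    unfolding scaled_within_def by blast
qed

lemma scaled_within_scale:
  assumes "scaled_within t X Y" "0 < a" "a \<le> s * b" "0 < b" "0 < t" "Y \<in> sym_convex_bodies J"
  shows "scaled_within (s * t) ((*\<^sub>R) a ` X) ((*\<^sub>R) b ` Y)"
proof -
  have "0 < s * b" using assms(2,3) by linarith
  then have s: "0 < s" using assms(4) by (simp add: zero_less_mult_iff)
  have "(1 / (s * t)) *\<^sub>R (a *\<^sub>R x) \<in> (*\<^sub>R) b ` Y" if "x \<in> X" for x
  proof (rule image_eqI)
    show "(1 / (s * t)) *\<^sub>R (a *\<^sub>R x) = b *\<^sub>R ((a / (s * b)) *\<^sub>R ((1 / t) *\<^sub>R x))"
      using assms s by simp
    show "(a / (s * b)) *\<^sub>R ((1 / t) *\<^sub>R x) \<in> Y"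
      using assms s by (intro sym_convex_bodies_shrink[OF assms(6)] scaled_withinD[OF assms(1) that])
        (simp add: abs_of_pos)
  qed
  then show ?thesis unfolding scaled_within_def by blast
qed

section \<open>Gauges and decomposable vectors\<close>

text \<open>\<gamma> is the gauge of Q at e, obtained dually as the maximum of the inner product
  with e over the compact polar. The vector y is a norming functional, and the bipolar theorem
  returns e/\<gamma> to Q.\<close>

lemma gauge_attained:
  assumes Q: "Q \<in> sym_convex_bodies J" and e: "e \<in> coord_space J" "e \<noteq> 0"
  obtains \<gamma> y where "0 < \<gamma>" "(1 / \<gamma>) *\<^sub>R e \<in> Q" "y \<in> polar J Q" "e \<bullet> y = \<gamma>"
proof -
  note p = polar_sym_convex_bodies[OF Q]
  have "polar J Q \<noteq> {}" using sym_convex_bodies_zero[OF p] by auto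
  moreover have "continuous_on (polar J Q) (\<lambda>y. e \<bullet> y)" by (intro continuous_intros)
  ultimately obtain y where y: "y \<in> polar J Q" "\<forall>z\<in>polar J Q. e \<bullet> z \<le> e \<bullet> y"
    using continuous_attains_sup[OF sym_convex_bodiesD(2)[OF p]] by blast
  obtain m where m: "0 < m" "cball 0 m \<inter> coord_space J \<subseteq> polar J Q"
    by (rule sym_convex_bodies_inner_ball[OF p])
  have "(m / norm e) *\<^sub>R e \<in> polar J Q"
    using m e by (intro subsetD[OF m(2)]) (auto intro: coord_space_scale)
  then have "e \<bullet> ((m / norm e) *\<^sub>R e) \<le> e \<bullet> y" using y by blast
  moreover have "e \<bullet> ((m / norm e) *\<^sub>R e) > 0" using m e by simp
  ultimately have pos: "0 < e \<bullet> y" by linarith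
  have "z \<bullet> ((1 / (e \<bullet> y)) *\<^sub>R e) \<le> 1" if "z \<in> polar J Q" for z
  proof -
    have "e \<bullet> z \<le> e \<bullet> y" using y that by blast
    then show ?thesis using pos by (simp add: inner_commute)
  qed
  then have "(1 / (e \<bullet> y)) *\<^sub>R e \<in> polar J (polar J Q)"
    using e by (simp add: polar_def[of J "polar J Q"] coord_space_scale)
  then have "(1 / (e \<bullet> y)) *\<^sub>R e \<in> Q" by (simp add: polar_polar[OF Q])
  then show ?thesis using that[OF pos _ y(1)] by blast
qed

lemma proj_tensor_scale:
  "proj_tensor (\<lambda>i. (*\<^sub>R) (c i) ` Q i) = (*\<^sub>R) (\<Prod>i\<in>UNIV. c i) ` proj_tensor Q"
proof -
  have "tensors (\<lambda>i. (*\<^sub>R) (c i) ` Q i) = (*\<^sub>R) (\<Prod>i\<in>UNIV. c i) ` tensors Q"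
  proof (intro set_eqI iffI)
    fix T assume "T \<in> tensors (\<lambda>i. (*\<^sub>R) (c i) ` Q i)"
    then obtain x where x: "T = tensor x" "\<forall>i. \<exists>q\<in>Q i. x i = c i *\<^sub>R q"
      unfolding tensors_def by blast
    then obtain q where q: "\<And>i. q i \<in> Q i" "\<And>i. x i = c i *\<^sub>R q i" by metis
    have "x = (\<lambda>i. c i *\<^sub>R q i)" using q(2) by (rule ext)
    then have "T = (\<Prod>i\<in>UNIV. c i) *\<^sub>R tensor q" using x(1) by (simp add: tensor_scale)
    moreover have "tensor q \<in> tensors Q" using q(1) by (auto simp: tensors_def)
    ultimately show "T \<in> (*\<^sub>R) (\<Prod>i\<in>UNIV. c i) ` tensors Q" by (rule image_eqI)
  next
    fix T assume "T \<in> (*\<^sub>R) (\<Prod>i\<in>UNIV. c i) ` tensors Q"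
    then obtain q where q: "T = (\<Prod>i\<in>UNIV. c i) *\<^sub>R tensor q" "\<And>i. q i \<in> Q i"
      unfolding tensors_def by blast
    have "T = tensor (\<lambda>i. c i *\<^sub>R q i)" using q by (simp add: tensor_scale)
    moreover have "c i *\<^sub>R q i \<in> (*\<^sub>R) (c i) ` Q i" for i using q(2) by (rule imageI)
    ultimately show "T \<in> tensors (\<lambda>i. (*\<^sub>R) (c i) ` Q i)" unfolding tensors_def by blast
  qed
  then show ?thesis by (simp add: proj_tensor_eq convex_hull_scaling)
qed

lemma image_scaleR_one: "(*\<^sub>R) 1 ` S = (S :: 'a::real_vector set)"
  by force

text \<open>This is the ambiguity in the factors of a tensorial body. Polars scale by 1/c_i, and
  these reciprocals multiply to 1 as well.\<close>

lemma proj_inj_tensor_rescale: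
  assumes "\<And>i. 0 < c i" "(\<Prod>i\<in>UNIV. c i) = 1"
  shows "proj_tensor (\<lambda>i. (*\<^sub>R) (c i) ` Q i) = proj_tensor Q"
    and "inj_tensor I (\<lambda>i. (*\<^sub>R) (c i) ` Q i) = inj_tensor I Q"
proof -
  show "proj_tensor (\<lambda>i. (*\<^sub>R) (c i) ` Q i) = proj_tensor Q"
    using proj_tensor_scale[of c Q] assms(2) by simp
  have "proj_tensor (\<lambda>i. (*\<^sub>R) (1 / c i) ` polar (I i) (Q i)) = proj_tensor (\<lambda>i. polar (I i) (Q i))"
    using proj_tensor_scale[of "\<lambda>i. 1 / c i" "\<lambda>i. polar (I i) (Q i)"] assms(2)
    by (simp add: prod_dividef image_scaleR_one)
  then show "inj_tensor I (\<lambda>i. (*\<^sub>R) (c i) ` Q i) = inj_tensor I Q"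
    by (simp add: inj_tensor_def polar_scale assms(1))
qed

text \<open>On decomposable vectors both tensor gauges equal the product of the gauges of the
  components. Hence P has the same decomposable vectors as \<open>proj_tensor Q\<close>, wherever it
  lies between the bounds.\<close>

lemma conv_tensor_eq_proj_tensor:
  assumes Q: "\<And>i. Q i \<in> sym_convex_bodies (I i)" and P: "proj_tensor Q \<subseteq> P" "P \<subseteq> inj_tensor I Q"
  shows "conv_tensor I P = proj_tensor Q"
proof
  note p = proj_tensor_sym_convex_bodies[of Q I, OF Q]
  show "conv_tensor I P \<subseteq> proj_tensor Q"
    unfolding conv_tensor_def
  proof (rule hull_minimal)
    show "convex (proj_tensor Q)" by (simp add: proj_tensor_eq)
    show "P \<inter> decomposables I \<subseteq> proj_tensor Q"
    proof
      fix T assume T: "T \<in> P \<inter> decomposables I"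
      then obtain x where x: "T = tensor x" "\<And>i. x i \<in> coord_space (I i)" by (auto simp: decomposables_def)
      show "T \<in> proj_tensor Q"
      \<comment> \<open>A zero component has gauge 0 and no norming functional in the sense of
        \<open>gauge_attained\<close>, but then the tensor itself is 0.\<close>
      proof (cases "\<exists>i. x i = 0")
        case True
        then have "norm (tensor x) = 0" unfolding norm_tensor by (intro prod_zero) auto
        then show ?thesis using sym_convex_bodies_zero[OF p] x(1) by simp
      next
        case False
        have "\<exists>\<gamma> y. 0 < \<gamma> \<and> (1 / \<gamma>) *\<^sub>R x i \<in> Q i \<and> y \<in> polar (I i) (Q i) \<and> x i \<bullet> y = \<gamma>" for i
        proof -
          have "x i \<noteq> 0" using False by blast
          from gauge_attained[OF Q x(2) this] show ?thesis by blast
        qed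
        then obtain \<gamma> y where g: "\<And>i. 0 < \<gamma> i" "\<And>i. (1 / \<gamma> i) *\<^sub>R x i \<in> Q i"
          "\<And>i. y i \<in> polar (I i) (Q i)" "\<And>i. x i \<bullet> y i = \<gamma> i" by metis
        have pos: "0 < (\<Prod>i\<in>UNIV. \<gamma> i)" using g(1) by (simp add: prod_pos)
        have nz: "\<gamma> i \<noteq> 0" for i using g(1)[of i] by simp
        \<comment> \<open>Testing T against the tensor of norming functionals bounds the product of
          the gauges by 1; T is then that product times a tensor of points of the factors.\<close>
        have "tensor y \<bullet> T \<le> 1" using T P(2) g(3) by (auto simp: mem_inj_tensor)
        then have le: "(\<Prod>i\<in>UNIV. \<gamma> i) \<le> 1" using g(4) by (simp add: x(1) inner_tensor inner_commute)
        have "T = (\<Prod>i\<in>UNIV. \<gamma> i) *\<^sub>R tensor (\<lambda>i. (1 / \<gamma> i) *\<^sub>R x i)"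
          using nz by (simp add: tensor_scale x(1) prod_dividef)
        moreover have "(\<Prod>i\<in>UNIV. \<gamma> i) *\<^sub>R tensor (\<lambda>i. (1 / \<gamma> i) *\<^sub>R x i) \<in> proj_tensor Q"
          using pos le g(2) by (intro sym_convex_bodies_shrink[OF p] tensor_in_proj_tensor) auto
        ultimately show ?thesis by simp
      qed
    qed
  qed
  show "proj_tensor Q \<subseteq> conv_tensor I P"
    unfolding proj_tensor_eq conv_tensor_def
  proof (rule hull_mono)
    show "tensors Q \<subseteq> P \<inter> decomposables I"
    proof
      fix T assume T: "T \<in> tensors Q"
      then have "T \<in> P" using P(1) hull_inc[OF T, of convex] unfolding proj_tensor_eq by blast
      moreover have "T \<in> decomposables I"
        using T sym_convex_bodiesD(1)[OF Q] unfolding tensors_def decomposables_def by blast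
      ultimately show "T \<in> P \<inter> decomposables I" by blast
    qed
  qed
qed

section \<open>Slices and factors\<close>

text \<open>A unit vector chosen from J alone. Since it does not vary with the body, slices of
  comparable bodies are comparable.\<close>

definition base_vec :: "'n::finite set \<Rightarrow> real^'n" where
  "base_vec J = axis (SOME k. k \<in> J) 1"

lemma base_vec_in_coord_space: "J \<noteq> {} \<Longrightarrow> base_vec J \<in> coord_space J"
  unfolding base_vec_def by (rule axis_in_coord_space) (simp add: some_in_eq)

lemma norm_base_vec: "norm (base_vec J) = 1"
  by (simp add: base_vec_def norm_axis_1)

lemma inner_tensor_fun_upd:
  "tensor (x(i := a)) \<bullet> tensor (y(i := b)) = (a \<bullet> b) * (\<Prod>j\<in>UNIV - {i}. x j \<bullet> y j)"
proof -
  have "tensor (x(i := a)) \<bullet> tensor (y(i := b)) = (\<Prod>j\<in>UNIV. (x(i := a)) j \<bullet> (y(i := b)) j)"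
    by (rule inner_tensor)
  also have "\<dots> = ((x(i := a)) i \<bullet> (y(i := b)) i) * (\<Prod>j\<in>UNIV - {i}. (x(i := a)) j \<bullet> (y(i := b)) j)"
    by (rule prod.remove) auto
  also have "(\<Prod>j\<in>UNIV - {i}. (x(i := a)) j \<bullet> (y(i := b)) j) = (\<Prod>j\<in>UNIV - {i}. x j \<bullet> y j)"
    by (rule prod.cong) auto
  finally show ?thesis by (simp only: fun_upd_same)
qed

definition slice :: "('l::finite \<Rightarrow> 'n::finite set) \<Rightarrow> (real^('l \<Rightarrow> 'n)) set \<Rightarrow> 'l \<Rightarrow> (real^'n) set" where
  "slice I P i = {v \<in> coord_space (I i). tensor ((\<lambda>j. base_vec (I j))(i := v)) \<in> P}"

lemma norm_tensor_base_vec: "norm (tensor ((\<lambda>j. base_vec (I j))(i := v))) = norm v"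
proof -
  have "(norm (tensor ((\<lambda>j. base_vec (I j))(i := v))))\<^sup>2 = (norm v)\<^sup>2"
    unfolding power2_norm_eq_inner inner_tensor_fun_upd
    by (simp add: norm_base_vec dot_square_norm)
  then show ?thesis by (simp add: power2_eq_iff_nonneg)
qed

text \<open>Inserting v into slot i among unit vectors is an isometric linear embedding, so the
  slice is a preimage with the same inner and outer radii available.\<close>

lemma slice_sym_convex_bodies:
  assumes P: "P \<in> sym_convex_bodies (multi_indices I)" and I: "\<And>j. I j \<noteq> {}"
  shows "slice I P i \<in> sym_convex_bodies (I i)"
proof -
  define f where "f v = tensor ((\<lambda>j. base_vec (I j))(i := v))" for v
  have f: "linear f" unfolding f_def by (rule linear_tensor_fun_upd)
  have norm_f: "norm (f v) = norm v" for v unfolding f_def by (rule norm_tensor_base_vec)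
  have eq: "slice I P i = coord_space (I i) \<inter> f -` P" by (auto simp: slice_def f_def)
  obtain m where m: "0 < m" "cball 0 m \<inter> coord_space (multi_indices I) \<subseteq> P"
    by (rule sym_convex_bodies_inner_ball[OF P])
  obtain R where R: "0 < R" "\<forall>x\<in>P. norm x \<le> R" by (rule sym_convex_bodies_outer_ball[OF P])
  show ?thesis
  proof (rule sym_convex_bodiesI)
    show "slice I P i \<subseteq> coord_space (I i)" by (auto simp: slice_def)
    have "closed (f -` P)"
      using f by (intro continuous_closed_vimage compact_imp_closed[OF sym_convex_bodiesD(2)[OF P]])
        (simp add: linear_continuous_at linear_conv_bounded_linear)
    then have "closed (slice I P i)" unfolding eq by (intro closed_Int closed_coord_space)
    moreover have "\<forall>v\<in>slice I P i. norm v \<le> R" using R(2) norm_f by (auto simp: eq)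
    ultimately show "compact (slice I P i)" by (auto simp: compact_eq_bounded_closed bounded_iff)
    show "convex (slice I P i)"
      unfolding eq
      by (intro convex_Int convex_coord_space convex_linear_vimage f sym_convex_bodiesD(3)[OF P])
    show "- v \<in> slice I P i" if "v \<in> slice I P i" for v
      using that sym_convex_bodiesD(4)[OF P, of "f v"]
      by (simp add: eq linear_neg[OF f] coord_space_minus)
    show "cball 0 m \<inter> coord_space (I i) \<subseteq> slice I P i"
    proof
      fix v assume v: "v \<in> cball 0 m \<inter> coord_space (I i)"
      have "f v \<in> coord_space (multi_indices I)"
        unfolding f_def using v base_vec_in_coord_space[OF I] by (intro tensor_in_coord_space) auto
      then have "f v \<in> P" using v norm_f by (intro subsetD[OF m(2)]) simp
      then show "v \<in> slice I P i" using v by (simp add: eq)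
    qed
  qed (rule m)
qed

lemma scaled_within_slice:
  assumes "scaled_within t X Y"
  shows "scaled_within t (slice I X i) (slice I Y i)"
proof -
  have "(1 / t) *\<^sub>R v \<in> slice I Y i" if v: "v \<in> slice I X i" for v
    using v linear_cmul[OF linear_tensor_fun_upd[of "\<lambda>j. base_vec (I j)" i], of "1 / t" v]
      scaled_withinD[OF assms, of "tensor ((\<lambda>j. base_vec (I j))(i := v))"]
    by (simp add: slice_def coord_space_scale del: fun_upd_apply)
  then show ?thesis unfolding scaled_within_def by blast
qed

text \<open>The reciprocal of the gauge of \<open>P\<close> at the tensor product of the base vectors.\<close>

definition base_radius :: "('l::finite \<Rightarrow> 'n::finite set) \<Rightarrow> (real^('l \<Rightarrow> 'n)) set \<Rightarrow> real" where
  "base_radius I P = Sup {c. c *\<^sub>R tensor (\<lambda>j. base_vec (I j)) \<in> P}"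

lemma base_radius_bdd:
  assumes P: "P \<in> sym_convex_bodies (multi_indices I)"
  shows "bdd_above {c. c *\<^sub>R tensor (\<lambda>j. base_vec (I j)) \<in> P}"
proof -
  obtain R where R: "0 < R" "\<forall>x\<in>P. norm x \<le> R" by (rule sym_convex_bodies_outer_ball[OF P])
  have "c \<le> R" if "c *\<^sub>R tensor (\<lambda>j. base_vec (I j)) \<in> P" for c
  proof -
    have "norm (c *\<^sub>R tensor (\<lambda>j. base_vec (I j))) \<le> R" using R that by blast
    then show ?thesis by (simp add: norm_tensor norm_base_vec)
  qed
  then show ?thesis by (intro bdd_aboveI) blast
qed

lemma base_radius_pos:
  assumes P: "P \<in> sym_convex_bodies (multi_indices I)" and I: "\<And>j. I j \<noteq> {}"
  shows "0 < base_radius I P"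
proof -
  obtain m where m: "0 < m" "cball 0 m \<inter> coord_space (multi_indices I) \<subseteq> P"
    by (rule sym_convex_bodies_inner_ball[OF P])
  have "m *\<^sub>R tensor (\<lambda>j. base_vec (I j)) \<in> P"
    using m(1) tensor_in_coord_space[of "\<lambda>j. base_vec (I j)" I, OF base_vec_in_coord_space[OF I]]
    by (intro subsetD[OF m(2)]) (simp add: norm_tensor norm_base_vec coord_space_scale)
  then have "m \<le> base_radius I P"
    unfolding base_radius_def by (intro cSup_upper base_radius_bdd[OF P]) simp
  then show ?thesis using m by simp
qed

lemma base_radius_scaled_within:
  assumes "scaled_within t X Y" "0 < t" "X \<in> sym_convex_bodies (multi_indices I)"
    "Y \<in> sym_convex_bodies (multi_indices I)"
  shows "base_radius I X \<le> t * base_radius I Y"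
  unfolding base_radius_def[of I X]
proof (rule cSup_least)
  show "{c. c *\<^sub>R tensor (\<lambda>j. base_vec (I j)) \<in> X} \<noteq> {}"
    using sym_convex_bodies_zero[OF assms(3)] by (auto intro: exI[of _ 0])
  fix c assume "c \<in> {c. c *\<^sub>R tensor (\<lambda>j. base_vec (I j)) \<in> X}"
  then have "(c / t) *\<^sub>R tensor (\<lambda>j. base_vec (I j)) \<in> Y"
    using scaled_withinD[OF assms(1)] by fastforce
  then have "c / t \<le> base_radius I Y"
    unfolding base_radius_def by (intro cSup_upper base_radius_bdd[OF assms(4)]) simp
  then show "c \<le> t * base_radius I Y" using assms(2) by (simp add: field_simps)
qed

text \<open>Let \<gamma>_i be the gauge of Q_i at the base vector and \<Gamma> their product. The
  base tensor with v in slot i has gauge \<Gamma>/\<gamma>_i times the gauge of v, so the slice is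
  Q_i scaled by the inverse of \<Gamma>/\<gamma>_i.\<close>

lemma slice_eq_scaled_factor:
  assumes Q: "\<And>i. Q i \<in> sym_convex_bodies (I i)" and P: "proj_tensor Q \<subseteq> P" "P \<subseteq> inj_tensor I Q"
    and I: "\<And>j. I j \<noteq> {}"
  obtains \<gamma> where "\<And>i. 0 < \<gamma> i" "\<And>i. slice I P i = (*\<^sub>R) (\<gamma> i / (\<Prod>j\<in>UNIV. \<gamma> j)) ` Q i"
    "base_radius I P = 1 / (\<Prod>j\<in>UNIV. \<gamma> j)"
proof -
  let ?e = "\<lambda>j. base_vec (I j)"
  have "\<exists>\<gamma> y. 0 < \<gamma> \<and> (1 / \<gamma>) *\<^sub>R ?e i \<in> Q i \<and> y \<in> polar (I i) (Q i) \<and> ?e i \<bullet> y = \<gamma>" for i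
  proof -
    have "?e i \<noteq> 0" using norm_base_vec[of "I i"] by auto
    from gauge_attained[OF Q base_vec_in_coord_space[OF I] this] show ?thesis by blast
  qed
  then obtain \<gamma> y where g: "\<And>i. 0 < \<gamma> i" "\<And>i. (1 / \<gamma> i) *\<^sub>R ?e i \<in> Q i"
    "\<And>i. y i \<in> polar (I i) (Q i)" "\<And>i. ?e i \<bullet> y i = \<gamma> i" by metis
  define \<Gamma> where "\<Gamma> = (\<Prod>j\<in>UNIV. \<gamma> j)"
  have \<Gamma>: "0 < \<Gamma>" using g(1) by (simp add: \<Gamma>_def prod_pos)
  have rem: "\<Gamma> = \<gamma> i * (\<Prod>j\<in>UNIV - {i}. \<gamma> j)" for i
    unfolding \<Gamma>_def by (rule prod.remove) auto
  have "slice I P i = (*\<^sub>R) (\<gamma> i / \<Gamma>) ` Q i" for i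
  proof (intro set_eqI iffI)
    fix v assume v: "v \<in> slice I P i"
    define v' where "v' = (\<Gamma> / \<gamma> i) *\<^sub>R v"
    have "z \<bullet> v' \<le> 1" if z: "z \<in> polar (I i) (Q i)" for z
    proof -
      have "tensor ((\<lambda>j. base_vec (I j))(i := v)) \<in> inj_tensor I Q"
        using v P(2) by (auto simp: slice_def)
      moreover have "(y(i := z)) j \<in> polar (I j) (Q j)" for j using z g(3) by simp
      \<comment> \<open>A free functional z in slot i and the norming functionals in the others; the
        latter contribute exactly their gauges.\<close>
      ultimately have "tensor (y(i := z)) \<bullet> tensor (?e(i := v)) \<le> 1"
        unfolding mem_inj_tensor by blast
      then have "(z \<bullet> v) * (\<Prod>j\<in>UNIV - {i}. \<gamma> j) \<le> 1"
        unfolding inner_tensor_fun_upd using g(4) by (simp add: inner_commute)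
      moreover have "(\<Prod>j\<in>UNIV - {i}. \<gamma> j) = \<Gamma> / \<gamma> i" using rem[of i] g(1)[of i] by simp
      ultimately show ?thesis by (simp add: v'_def mult.commute)
    qed
    moreover have "v' \<in> coord_space (I i)" using v by (simp add: v'_def slice_def coord_space_scale)
    ultimately have "v' \<in> polar (I i) (polar (I i) (Q i))" by (simp add: polar_def[of _ "polar _ _"])
    then have "v' \<in> Q i" by (simp add: polar_polar[OF Q])
    moreover have "v = (\<gamma> i / \<Gamma>) *\<^sub>R v'" using \<Gamma> g(1)[of i] by (simp add: v'_def)
    ultimately show "v \<in> (*\<^sub>R) (\<gamma> i / \<Gamma>) ` Q i" by blast
  next
    fix v assume "v \<in> (*\<^sub>R) (\<gamma> i / \<Gamma>) ` Q i"
    then obtain q where q: "q \<in> Q i" "v = (\<gamma> i / \<Gamma>) *\<^sub>R q" by blast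
    \<comment> \<open>w has all its components in the factors, and c collects the coefficients that
      turn w into the base tensor with v in slot i. Division by \<Gamma> in slot i makes them
      multiply to 1.\<close>
    define w where "w = (\<lambda>j. (1 / \<gamma> j) *\<^sub>R ?e j)(i := q)"
    define c where "c = \<gamma>(i := \<gamma> i / \<Gamma>)"
    have "?e(i := v) = (\<lambda>j. c j *\<^sub>R w j)"
    proof
      fix j show "(?e(i := v)) j = c j *\<^sub>R w j"
        using g(1)[of j] by (simp add: c_def w_def q(2))
    qed
    then have "tensor (?e(i := v)) = (\<Prod>j\<in>UNIV. c j) *\<^sub>R tensor w" by (simp only: tensor_scale)
    also have "(\<Prod>j\<in>UNIV. c j) = 1"
    proof -
      have "(\<Prod>j\<in>UNIV. c j) = c i * (\<Prod>j\<in>UNIV - {i}. c j)" by (rule prod.remove) auto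
      also have "(\<Prod>j\<in>UNIV - {i}. c j) = (\<Prod>j\<in>UNIV - {i}. \<gamma> j)" by (rule prod.cong) (auto simp: c_def)
      also have "c i * (\<Prod>j\<in>UNIV - {i}. \<gamma> j) = (\<gamma> i * (\<Prod>j\<in>UNIV - {i}. \<gamma> j)) / \<Gamma>"
        by (simp add: c_def)
      also have "\<dots> = 1" unfolding rem[of i, symmetric] using \<Gamma> by simp
      finally show ?thesis .
    qed
    finally have "tensor (?e(i := v)) = tensor w" by (simp only: scaleR_one)
    moreover have "tensor w \<in> P"
      using g(2) q(1) by (intro subsetD[OF P(1)] tensor_in_proj_tensor) (simp add: w_def)
    moreover have "v \<in> coord_space (I i)"
      using q sym_convex_bodiesD(1)[OF Q] by (auto intro: coord_space_scale)
    ultimately show "v \<in> slice I P i" unfolding slice_def by simp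
  qed
  moreover have "base_radius I P = 1 / \<Gamma>"
    unfolding base_radius_def
  proof (rule cSup_eq_maximum)
    have "(1 / \<Gamma>) *\<^sub>R tensor ?e = tensor (\<lambda>j. (1 / \<gamma> j) *\<^sub>R ?e j)"
      by (simp add: tensor_scale \<Gamma>_def prod_dividef)
    also have "\<dots> \<in> P" using g(2) by (intro subsetD[OF P(1)] tensor_in_proj_tensor)
    finally show "1 / \<Gamma> \<in> {c. c *\<^sub>R tensor ?e \<in> P}" by simp
    fix c assume "c \<in> {c. c *\<^sub>R tensor ?e \<in> P}"
    then have "tensor y \<bullet> (c *\<^sub>R tensor ?e) \<le> 1" using P(2) g(3) by (auto simp: mem_inj_tensor)
    then have "c * \<Gamma> \<le> 1" using g(4) by (simp add: inner_tensor inner_commute \<Gamma>_def)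
    then show "c \<le> 1 / \<Gamma>" using \<Gamma> by (simp add: field_simps)
  qed
  ultimately show ?thesis using that[of \<gamma>] g(1) unfolding \<Gamma>_def by blast
qed

text \<open>
  All the correction that turns the slices into factors is put into one arbitrarily chosen index.
\<close>

definition factor :: "('l::finite \<Rightarrow> 'n::finite set) \<Rightarrow> (real^('l \<Rightarrow> 'n)) set \<Rightarrow> 'l \<Rightarrow> (real^'n) set" where
  "factor I P i = (*\<^sub>R) (if i = undefined then (1 / base_radius I P) ^ (CARD('l) - 1) else 1) ` slice I P i"

lemma factor_sym_convex_bodies:
  assumes "P \<in> sym_convex_bodies (multi_indices I)" "\<And>j. I j \<noteq> {}"
  shows "factor I P i \<in> sym_convex_bodies (I i)"
  unfolding factor_def
  using base_radius_pos[of P I] assms by (intro scale_sym_convex_bodies slice_sym_convex_bodies) auto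

lemma proj_inj_tensor_factor:
  fixes I :: "'l::finite \<Rightarrow> 'n::finite set"
  assumes Q: "\<And>i. Q i \<in> sym_convex_bodies (I i)" and P: "proj_tensor Q \<subseteq> P" "P \<subseteq> inj_tensor I Q"
    and I: "\<And>j. I j \<noteq> {}"
  shows "proj_tensor (factor I P) = proj_tensor Q" "inj_tensor I (factor I P) = inj_tensor I Q"
proof -
  obtain \<gamma> where \<gamma>: "\<And>i. 0 < \<gamma> i" "\<And>i. slice I P i = (*\<^sub>R) (\<gamma> i / (\<Prod>j\<in>UNIV. \<gamma> j)) ` Q i"
    "base_radius I P = 1 / (\<Prod>j\<in>UNIV. \<gamma> j)"
    using slice_eq_scaled_factor[of Q I P, OF Q P I] by blast
  let ?\<Gamma> = "\<Prod>j\<in>UNIV. \<gamma> j"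
  have \<Gamma>: "0 < ?\<Gamma>" using \<gamma>(1) by (simp add: prod_pos)
  \<comment> \<open>The slices carry the scalars \<gamma>_i/\<Gamma>, whose product over l slots is
    \<Gamma>^(1-l). The power with exponent l - 1 in the chosen slot cancels it, since
    \<open>base_radius I P\<close> is 1/\<Gamma>.\<close>
  define c where "c i = (if i = undefined then ?\<Gamma> ^ (CARD('l) - 1) else 1) * (\<gamma> i / ?\<Gamma>)" for i
  have "factor I P = (\<lambda>i. (*\<^sub>R) (c i) ` Q i)"
    by (rule ext) (simp add: factor_def \<gamma>(2,3) c_def image_image)
  moreover have "0 < c i" for i using \<gamma>(1) \<Gamma> by (simp add: c_def)
  moreover have "(\<Prod>i\<in>UNIV. c i) = 1"
  proof -
    have "(\<Prod>i\<in>UNIV. c i) = ?\<Gamma> ^ (CARD('l) - 1) * (?\<Gamma> / ?\<Gamma> ^ CARD('l))"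
      by (simp add: c_def prod.distrib prod.delta prod_dividef)
    also have "?\<Gamma> ^ CARD('l) = ?\<Gamma> ^ (CARD('l) - 1) * ?\<Gamma>"
      by (metis Suc_diff_1 power_Suc2 zero_less_card_finite)
    finally show ?thesis using less_imp_neq[OF \<gamma>(1)] by simp
  qed
  ultimately show "proj_tensor (factor I P) = proj_tensor Q" "inj_tensor I (factor I P) = inj_tensor I Q"
    using proj_inj_tensor_rescale[of c] by metis+
qed

text \<open>One factor t comes from the slice and t^(l-1) from the power of
  \<open>base_radius\<close>; the inclusion of Y in tX is what controls the latter.\<close>

lemma scaled_within_factor:
  fixes I :: "'l::finite \<Rightarrow> 'n::finite set"
  assumes t: "1 \<le> t" and within: "scaled_within t X Y" "scaled_within t Y X" and I: "\<And>j. I j \<noteq> {}"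
    and X: "X \<in> sym_convex_bodies (multi_indices I)" and Y: "Y \<in> sym_convex_bodies (multi_indices I)"
  shows "scaled_within (t ^ CARD('l)) (factor I X i) (factor I Y i)"
proof -
  let ?l = "CARD('l) - 1"
  have pos: "0 < base_radius I X" "0 < base_radius I Y"
    using base_radius_pos X Y I by blast+
  have "base_radius I Y \<le> t * base_radius I X" using within t X Y by (intro base_radius_scaled_within) auto
  then have "1 / base_radius I X \<le> t * (1 / base_radius I Y)" using pos by (simp add: field_simps)
  then have "(1 / base_radius I X) ^ ?l \<le> (t * (1 / base_radius I Y)) ^ ?l"
    using pos by (intro power_mono) auto
  then have "(1 / base_radius I X) ^ ?l \<le> t ^ ?l * (1 / base_radius I Y) ^ ?l"
    by (simp only: power_mult_distrib)
  moreover have "1 \<le> t ^ ?l" using t by (rule one_le_power)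
  ultimately have "scaled_within (t ^ ?l * t) (factor I X i) (factor I Y i)"
    unfolding factor_def
    using pos t scaled_within_slice[OF within(1)]
    by (intro scaled_within_scale[OF _ _ _ _ _ slice_sym_convex_bodies[OF Y I]]) auto
  moreover have "t ^ CARD('l) = t ^ ?l * t" by (metis Suc_diff_1 power_Suc2 zero_less_card_finite)
  ultimately show ?thesis by simp
qed

lemma absolute_retract_tensorial_space:
  fixes I :: "'l::finite \<Rightarrow> 'n::finite set"
  assumes I: "\<And>j. I j \<noteq> {}"
  shows "absolute_retract TYPE('z) (tensorial_space I)"
  unfolding tensorial_space_def
proof (rule absolute_retract_hausdorff)
  show "tensorial_bodies I \<subseteq> sym_convex_bodies (multi_indices I)" by (auto simp: tensorial_bodies_def)
  show "sandwich I (factor I X) X \<in> tensorial_bodies I" if "X \<in> sym_convex_bodies (multi_indices I)" for X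
    using that I by (intro sandwich_tensorial_bodies factor_sym_convex_bodies)
  show "sandwich I (factor I P) P = P" if "P \<in> tensorial_bodies I" for P
  proof -
    obtain Q where Q: "\<And>i. Q i \<in> sym_convex_bodies (I i)" "proj_tensor Q \<subseteq> P" "P \<subseteq> inj_tensor I Q"
      using \<open>P \<in> tensorial_bodies I\<close> unfolding tensorial_bodies_def by blast
    then show ?thesis
      using that proj_inj_tensor_factor[of Q I P, OF Q I] sym_convex_bodiesD(3)
      by (intro sandwich_eq) (auto simp: tensorial_bodies_def)
  qed
  \<comment> \<open>One t for X itself; each of the l factors changes by t^l, and the tensor bounds
    multiply l such changes.\<close>
  show "scaled_within (t ^ (1 + CARD('l) * CARD('l))) (sandwich I (factor I X) X) (sandwich I (factor I Y) Y)"
    if "1 \<le> t" "X \<in> sym_convex_bodies (multi_indices I)" "Y \<in> sym_convex_bodies (multi_indices I)"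
      "scaled_within t X Y" "scaled_within t Y X" for t X Y
  proof -
    have "scaled_within (t * (t ^ CARD('l)) ^ CARD('l)) (sandwich I (factor I X) X) (sandwich I (factor I Y) Y)"
      using that I
      by (intro scaled_within_sandwich scaled_within_factor factor_sym_convex_bodies one_le_power)
    then show ?thesis by (simp add: power_mult)
  qed
qed

section \<open>John's condition\<close>

text \<open>
  John's condition: for \<open>K\<close> inside the unit ball it says that the identity is a positive combination of
  projections onto contact points of \<open>K\<close> with the unit sphere, stated dually to avoid contact points.
\<close>

definition john :: "'k::finite set \<Rightarrow> (real^'k) set \<Rightarrow> bool" where
  "john J K \<longleftrightarrow> (\<forall>h M. linear h \<and> (\<forall>x\<in>K. x \<bullet> h x \<le> M)
     \<longrightarrow> (\<Sum>k\<in>J. axis k 1 \<bullet> h (axis k 1)) \<le> real (card J) * M)"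

lemma johnD:
  "john J K \<Longrightarrow> linear h \<Longrightarrow> (\<And>x. x \<in> K \<Longrightarrow> x \<bullet> h x \<le> M) \<Longrightarrow>
     (\<Sum>k\<in>J. axis k 1 \<bullet> h (axis k 1)) \<le> real (card J) * M"
  unfolding john_def by blast

lemma john_mono: "john J K \<Longrightarrow> K \<subseteq> L \<Longrightarrow> john J L"
  unfolding john_def by blast

lemma inner_axis_axis: "axis k (1::real) \<bullet> axis k 1 = 1"
  by (simp add: inner_axis)

lemma john_unit_ball: "john J (unit_ball J)"
  unfolding john_def
proof (intro allI impI)
  fix h :: "real^'a \<Rightarrow> real^'a" and M
  assume h: "linear h \<and> (\<forall>x\<in>unit_ball J. x \<bullet> h x \<le> M)"
  have "(\<Sum>k\<in>J. axis k 1 \<bullet> h (axis k 1)) \<le> (\<Sum>k\<in>J. M)"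
    using h by (intro sum_mono) (auto simp: unit_ball_def axis_in_coord_space norm_axis_1)
  then show "(\<Sum>k\<in>J. axis k 1 \<bullet> h (axis k 1)) \<le> real (card J) * M" by simp
qed

text \<open>Test with the identity, whose trace is \<open>card J\<close>. A set satisfying the
  condition therefore cannot lie in a ball about 0 of radius below 1.\<close>

lemma john_norm_bound:
  assumes "john J K" "J \<noteq> {}" "\<And>x. x \<in> K \<Longrightarrow> norm x \<le> r" "0 \<le> r"
  shows "1 \<le> r"
proof -
  have "x \<bullet> id x \<le> r\<^sup>2" if "x \<in> K" for x
    using power_mono[OF assms(3)[OF that], of 2] by (simp add: power2_norm_eq_inner)
  from johnD[OF assms(1) linear_id this]
  have "real (card J) \<le> real (card J) * r\<^sup>2" by (simp add: inner_axis_axis)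
  moreover have "0 < real (card J)" using assms(2) by (simp add: card_gt_0_iff)
  ultimately have "1 \<le> r\<^sup>2" by (simp add: mult_le_cancel_left1)
  then show ?thesis using assms(4) power2_le_imp_le[of 1 r] by simp
qed

lemma mem_scale_iff: "s \<noteq> 0 \<Longrightarrow> x \<in> (*\<^sub>R) s ` Q \<longleftrightarrow> (1 / s) *\<^sub>R x \<in> (Q :: 'a::real_vector set)"
  by (auto intro: image_eqI[of x "(*\<^sub>R) s" "(1 / s) *\<^sub>R x"])

section \<open>Scaling a body into John's condition\<close>

definition john_scale :: "'k::finite set \<Rightarrow> (real^'k) set \<Rightarrow> real" where
  "john_scale J Q = Inf {s. 0 < s \<and> john J (unit_ball J \<inter> (*\<^sub>R) s ` Q)}"

definition john_body :: "'k::finite set \<Rightarrow> (real^'k) set \<Rightarrow> (real^'k) set" where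
  "john_body J Q = unit_ball J \<inter> (*\<^sub>R) (john_scale J Q) ` Q"

lemma john_scale_lower:
  assumes "J \<noteq> {}" "\<forall>x\<in>Q. norm x \<le> R" "0 < R" "0 < s" "john J (unit_ball J \<inter> (*\<^sub>R) s ` Q)"
  shows "1 / R \<le> s"
proof -
  have "1 \<le> s * R"
    using assms(2-4) by (intro john_norm_bound[OF assms(5,1)]) auto
  then show ?thesis using assms(3) by (simp add: field_simps)
qed

lemma john_scale_exists:
  assumes "Q \<in> sym_convex_bodies J"
  shows "\<exists>s>0. john J (unit_ball J \<inter> (*\<^sub>R) s ` Q)"
proof -
  obtain m where m: "0 < m" "cball 0 m \<inter> coord_space J \<subseteq> Q"
    by (rule sym_convex_bodies_inner_ball[OF assms])
  have "x \<in> (*\<^sub>R) (1 / m) ` Q" if "x \<in> unit_ball J" for x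
  proof -
    have "m *\<^sub>R x \<in> Q"
      using that m(1) by (intro subsetD[OF m(2)]) (auto simp: unit_ball_def mult_le_cancel_left1 coord_space_scale)
    then show ?thesis using m(1) by (simp add: mem_scale_iff)
  qed
  then have "unit_ball J \<inter> (*\<^sub>R) (1 / m) ` Q = unit_ball J" by blast
  then show ?thesis using m(1) john_unit_ball by (intro exI[of _ "1 / m"]) auto
qed

lemma john_scale_le:
  assumes "0 < s" "john J (unit_ball J \<inter> (*\<^sub>R) s ` Q)"
  shows "john_scale J Q \<le> s"
  unfolding john_scale_def using assms by (intro cInf_lower bdd_belowI[of _ 0]) auto

lemma john_scale_pos:
  assumes "Q \<in> sym_convex_bodies J" "J \<noteq> {}"
  shows "0 < john_scale J Q"
proof -
  obtain R where R: "0 < R" "\<forall>x\<in>Q. norm x \<le> R" by (rule sym_convex_bodies_outer_ball[OF assms(1)])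
  have "1 / R \<le> john_scale J Q"
    unfolding john_scale_def
    using john_scale_exists[OF assms(1)] john_scale_lower[OF assms(2) R(2,1)]
    by (intro cInf_greatest) auto
  then show ?thesis using R(1) by (meson divide_pos_pos less_le_trans zero_less_one)
qed

lemma scale_image_mono:
  assumes "Q \<in> sym_convex_bodies J" "0 < s" "s \<le> s'" "x \<in> (*\<^sub>R) s ` Q"
  shows "x \<in> (*\<^sub>R) s' ` Q"
proof -
  have "(1 / s) *\<^sub>R x \<in> Q" using assms by (simp add: mem_scale_iff)
  from sym_convex_bodies_shrink[OF assms(1) this, of "s / s'"]
  have "(1 / s') *\<^sub>R x \<in> Q" using assms(2,3) by (simp add: abs_of_pos)
  then show ?thesis using assms(2,3) by (simp add: mem_scale_iff)
qed

text \<open>The infimum is attained. A form bounded by M on the body at scale s is bounded by t^2 M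
  on the body at scale ts, for t > 1, because x/t lies in the former; the condition holds at scale
  ts, and t tends to 1.\<close>

lemma john_john_body:
  assumes Q: "Q \<in> sym_convex_bodies J" and J: "J \<noteq> {}"
  shows "john J (john_body J Q)"
  unfolding john_def
proof (intro allI impI)
  fix h :: "real^'a \<Rightarrow> real^'a" and M
  assume h: "linear h \<and> (\<forall>x\<in>john_body J Q. x \<bullet> h x \<le> M)"
  let ?tr = "\<Sum>k\<in>J. axis k 1 \<bullet> h (axis k 1)"
  let ?s = "john_scale J Q"
  have s: "0 < ?s" by (rule john_scale_pos[OF Q J])
  have le: "?tr \<le> real (card J) * (t\<^sup>2 * M)" if t: "1 < t" for t
  proof -
    let ?A = "{s. 0 < s \<and> john J (unit_ball J \<inter> (*\<^sub>R) s ` Q)}"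
    have "Inf ?A < t * ?s" using s t by (simp add: john_scale_def)
    moreover have "?A \<noteq> {}" using john_scale_exists[OF Q] by simp
    ultimately have "\<exists>s'\<in>?A. s' < t * ?s" by (rule cInf_lessD[rotated])
    then obtain s' where s': "0 < s'" "john J (unit_ball J \<inter> (*\<^sub>R) s' ` Q)" "s' < t * ?s" by blast
    have "unit_ball J \<inter> (*\<^sub>R) s' ` Q \<subseteq> unit_ball J \<inter> (*\<^sub>R) (t * ?s) ` Q"
      using scale_image_mono[OF Q s'(1) less_imp_le[OF s'(3)]] by blast
    then have "john J (unit_ball J \<inter> (*\<^sub>R) (t * ?s) ` Q)" by (rule john_mono[OF s'(2)])
    then show ?thesis
    proof (rule johnD)
      fix x assume x: "x \<in> unit_ball J \<inter> (*\<^sub>R) (t * ?s) ` Q"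
      have "(1 / t) *\<^sub>R x \<in> john_body J Q"
      proof -
        have "norm x \<le> 1" "x \<in> coord_space J" "(1 / (t * ?s)) *\<^sub>R x \<in> Q"
          using x t s mem_scale_iff[of "t * ?s" x Q] by (auto simp: unit_ball_def)
        moreover from this have "norm ((1 / t) *\<^sub>R x) \<le> 1" using t by (simp add: divide_le_eq)
        ultimately show ?thesis
          using s by (simp add: john_body_def unit_ball_def mem_scale_iff coord_space_scale mult.commute)
      qed
      then have "((1 / t) *\<^sub>R x) \<bullet> h ((1 / t) *\<^sub>R x) \<le> M" using h by blast
      then have "(x \<bullet> h x) / t\<^sup>2 \<le> M"
        using h by (simp add: linear_cmul power2_eq_square)
      then show "x \<bullet> h x \<le> t\<^sup>2 * M" using t by (simp add: field_simps)
    qed (use h in simp)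
  qed
  have "((\<lambda>t. real (card J) * (t\<^sup>2 * M)) \<longlongrightarrow> real (card J) * (1\<^sup>2 * M)) (at_right 1)"
    by (intro tendsto_intros)
  moreover have "eventually (\<lambda>t. ?tr \<le> real (card J) * (t\<^sup>2 * M)) (at_right 1)"
    using le by (auto simp: eventually_at_right_less intro: eventually_mono[OF eventually_at_right_less])
  ultimately have "?tr \<le> real (card J) * (1\<^sup>2 * M)"
    by (rule tendsto_lowerbound) simp
  then show "?tr \<le> real (card J) * M" by simp
qed

lemma john_body_sym_convex_bodies:
  assumes Q: "Q \<in> sym_convex_bodies J" and J: "J \<noteq> {}"
  shows "john_body J Q \<in> sym_convex_bodies J"
proof -
  let ?Q = "(*\<^sub>R) (john_scale J Q) ` Q"
  have sQ: "?Q \<in> sym_convex_bodies J" by (rule scale_sym_convex_bodies[OF Q john_scale_pos[OF Q J]])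
  obtain m where m: "0 < m" "cball 0 m \<inter> coord_space J \<subseteq> ?Q"
    by (rule sym_convex_bodies_inner_ball[OF sQ])
  have eq: "john_body J Q = cball 0 1 \<inter> ?Q"
    using sym_convex_bodiesD(1)[OF sQ] by (auto simp: john_body_def unit_ball_def)
  show ?thesis
    unfolding eq
  proof (rule sym_convex_bodiesI)
    show "0 < min m 1" using m by simp
    show "cball 0 (min m 1) \<inter> coord_space J \<subseteq> cball 0 1 \<inter> ?Q" using m(2) by auto
    show "cball 0 1 \<inter> ?Q \<subseteq> coord_space J" using sym_convex_bodiesD(1)[OF sQ] by blast
  qed (use sym_convex_bodiesD[OF sQ] in \<open>auto intro: convex_Int compact_Int\<close>)
qed

lemma john_body_subset: "john_body J Q \<subseteq> unit_ball J"
  by (simp add: john_body_def)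

text \<open>The scale 1/c restores D, which is admissible. At a smaller scale the body would lie in
  a ball of radius below 1, against \<open>john_norm_bound\<close>.\<close>

lemma john_body_scale:
  assumes D: "D \<in> sym_convex_bodies J" and J: "J \<noteq> {}" and "john J D" "D \<subseteq> unit_ball J" "0 < c"
  shows "john_body J ((*\<^sub>R) c ` D) = D"
proof -
  have img: "(*\<^sub>R) s ` (*\<^sub>R) c ` D = (*\<^sub>R) (s * c) ` D" for s by (simp add: image_image)
  have 1: "(*\<^sub>R) (1 / c) ` (*\<^sub>R) c ` D = D" using assms(5) by (simp add: img image_scaleR_one)
  have int: "unit_ball J \<inter> D = D" using assms(4) by blast
  have "john_scale J ((*\<^sub>R) c ` D) \<le> 1 / c"
    using assms(3,5) by (intro john_scale_le) (simp_all only: 1 int, simp)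
  moreover have "1 / c \<le> john_scale J ((*\<^sub>R) c ` D)"
  proof -
    have "norm x \<le> c" if "x \<in> (*\<^sub>R) c ` D" for x
      using that assms(4,5) by (auto simp: unit_ball_def mult_le_cancel_left2)
    then show ?thesis
      unfolding john_scale_def
      using john_scale_exists[OF scale_sym_convex_bodies[OF D assms(5)]] assms(5)
        john_scale_lower[OF J, of "(*\<^sub>R) c ` D" c]
      by (intro cInf_greatest) auto
  qed
  ultimately have "john_scale J ((*\<^sub>R) c ` D) = 1 / c" by (rule order_antisym)
  then show ?thesis by (simp only: john_body_def 1 int)
qed

text \<open>Since sY <= tsX, the scale of X is at most t times that of Y by monotonicity of the
  condition. The square arises from this factor and the inclusion of X in tY.\<close>

lemma scaled_within_john_body:
  assumes t: "1 \<le> t" and within: "scaled_within t X Y" "scaled_within t Y X" and J: "J \<noteq> {}"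
    and X: "X \<in> sym_convex_bodies J" and Y: "Y \<in> sym_convex_bodies J"
  shows "scaled_within (t\<^sup>2) (john_body J X) (john_body J Y)"
proof -
  have pos: "0 < john_scale J X" "0 < john_scale J Y" by (intro john_scale_pos X Y J)+
  have sub: "(*\<^sub>R) s ` Y \<subseteq> (*\<^sub>R) (t * s) ` X" if "0 < s" for s
  proof
    fix y assume "y \<in> (*\<^sub>R) s ` Y"
    then have "(1 / s) *\<^sub>R y \<in> Y" using that by (simp add: mem_scale_iff)
    from scaled_withinD[OF within(2) this]
    show "y \<in> (*\<^sub>R) (t * s) ` X" using that t by (simp add: mem_scale_iff)
  qed
  have le: "john_scale J X \<le> t * john_scale J Y"
  proof (rule john_scale_le)
    show "0 < t * john_scale J Y" using pos t by simp
    show "john J (unit_ball J \<inter> (*\<^sub>R) (t * john_scale J Y) ` X)"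
      using sub[OF pos(2)] by (intro john_mono[OF john_john_body[OF Y J]]) (auto simp: john_body_def)
  qed
  have "(1 / t\<^sup>2) *\<^sub>R x \<in> john_body J Y" if x: "x \<in> john_body J X" for x
  proof -
    have "x \<in> (*\<^sub>R) (t * john_scale J Y) ` X"
      using x by (intro scale_image_mono[OF X pos(1) le]) (simp add: john_body_def)
    then have "(1 / (t * john_scale J Y)) *\<^sub>R x \<in> X" using pos t by (simp add: mem_scale_iff)
    from scaled_withinD[OF within(1) this]
    have "(1 / t\<^sup>2) *\<^sub>R x \<in> (*\<^sub>R) (john_scale J Y) ` Y"
      using pos by (simp add: mem_scale_iff power2_eq_square mult_ac)
    moreover have "(1 / t\<^sup>2) *\<^sub>R x \<in> unit_ball J"
    proof -
      have "norm x \<le> 1" "x \<in> coord_space J" using x by (auto simp: john_body_def unit_ball_def)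
      moreover have "1 \<le> t\<^sup>2" using t by (rule one_le_power)
      ultimately show ?thesis by (simp add: unit_ball_def coord_space_scale divide_le_eq)
    qed
    ultimately show ?thesis by (simp add: john_body_def)
  qed
  then show ?thesis unfolding scaled_within_def by blast
qed

section \<open>John's condition and tensor products\<close>

lemma sum_PiE_insert:
  assumes "finite S" "j \<notin> S" "\<And>i. finite (I i)"
  shows "(\<Sum>m\<in>PiE (insert j S) I. F m) = (\<Sum>k\<in>I j. \<Sum>m\<in>PiE S I. F (m(j := k)))"
proof -
  have "(\<Sum>m\<in>PiE (insert j S) I. F m) = (\<Sum>(k, m)\<in>I j \<times> PiE S I. F (m(j := k)))"
    unfolding PiE_insert_eq
    by (subst sum.reindex[OF inj_combinator[OF assms(2)]]) (simp add: case_prod_unfold o_def)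
  also have "\<dots> = (\<Sum>k\<in>I j. \<Sum>m\<in>PiE S I. F (m(j := k)))" by (rule sum.cartesian_product[symmetric])
  finally show ?thesis .
qed

lemma multi_indices_eq_PiE: "multi_indices I = PiE UNIV I"
  by (auto simp: multi_indices_def PiE_UNIV_domain)

text \<open>
  The trace over the tensor product is an iterated partial trace. Each partial trace is a quadratic form
  in one factor, to which the condition for that factor applies.
\<close>

lemma john_tensors:
  fixes I :: "'l::finite \<Rightarrow> 'n::finite set"
  assumes Q: "\<And>i. john (I i) (Q i)"
  shows "john (multi_indices I) (tensors Q)"
  unfolding john_def
proof (intro allI impI)
  fix H :: "real^('l \<Rightarrow> 'n) \<Rightarrow> real^('l \<Rightarrow> 'n)" and M
  assume H: "linear H \<and> (\<forall>T\<in>tensors Q. T \<bullet> H T \<le> M)"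
  define q where "q T = T \<bullet> H T" for T
  \<comment> \<open>Slots in S have been traced out while the others still hold points of the Q_i.
    For S empty this is the hypothesis on H, for S = UNIV the claim.\<close>
  have "(\<Sum>m\<in>PiE S I. q (tensor (\<lambda>i. if i \<in> S then axis (m i) 1 else x i))) \<le> real (\<Prod>i\<in>S. card (I i)) * M"
    if "finite S" "\<forall>i. i \<notin> S \<longrightarrow> x i \<in> Q i" for S x
    using that
  proof (induction S arbitrary: x rule: finite_induct)
    case empty
    then have "tensor x \<in> tensors Q" by (auto simp: tensors_def)
    then show ?case using H by (simp add: q_def)
  next
    case (insert j S)
    define L where "L m v = tensor ((\<lambda>i. if i \<in> S then axis (m i) 1 else x i)(j := v))" for m v
    have L: "linear (L m)" for m unfolding L_def by (rule linear_tensor_fun_upd)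
    \<comment> \<open>The partial trace as a form in slot j: H is pulled back along each insertion
      \<open>L m\<close> and the results are summed.\<close>
    define h where "h v = (\<Sum>m\<in>PiE S I. adjoint (L m) (H (L m v)))" for v
    have h: "linear h"
      unfolding h_def using H
      by (intro linear_compose_sum ballI
          linear_compose[OF linear_compose[OF L], unfolded o_def, OF _ adjoint_linear[OF L]]) auto
    have qh: "v \<bullet> h v = (\<Sum>m\<in>PiE S I. q (L m v))" for v
      unfolding h_def by (simp add: inner_sum_right adjoint_works[OF L] q_def)
    have "v \<bullet> h v \<le> real (\<Prod>i\<in>S. card (I i)) * M" if v: "v \<in> Q j" for v
    proof -
      have eq: "L m v = tensor (\<lambda>i. if i \<in> S then axis (m i) 1 else (x(j := v)) i)" for m
        unfolding L_def using insert.hyps(2) by (intro arg_cong[where f = tensor]) auto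
      have "(\<Sum>m\<in>PiE S I. q (tensor (\<lambda>i. if i \<in> S then axis (m i) 1 else (x(j := v)) i)))
          \<le> real (\<Prod>i\<in>S. card (I i)) * M"
        using insert.prems v by (intro insert.IH) auto
      then show ?thesis by (simp only: qh eq)
    qed
    from johnD[OF Q h this]
    have "(\<Sum>k\<in>I j. \<Sum>m\<in>PiE S I. q (L m (axis k 1))) \<le> real (card (I j)) * (real (\<Prod>i\<in>S. card (I i)) * M)"
      by (simp only: qh)
    also have "\<dots> = real (\<Prod>i\<in>insert j S. card (I i)) * M"
      using insert.hyps by simp
    also have "(\<Sum>k\<in>I j. \<Sum>m\<in>PiE S I. q (L m (axis k 1)))
        = (\<Sum>m\<in>PiE (insert j S) I. q (tensor (\<lambda>i. if i \<in> insert j S then axis (m i) 1 else x i)))"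
    proof -
      have "tensor (\<lambda>i. if i \<in> insert j S then axis ((m(j := k)) i) 1 else x i) = L m (axis k 1)" for m k
        unfolding L_def using insert.hyps(2) by (intro arg_cong[where f = tensor]) auto
      moreover have "(\<Sum>m\<in>PiE (insert j S) I. F m) = (\<Sum>k\<in>I j. \<Sum>m\<in>PiE S I. F (m(j := k)))"
        for F :: "('l \<Rightarrow> 'n) \<Rightarrow> real"
        using insert.hyps by (intro sum_PiE_insert) auto
      ultimately show ?thesis by (simp only:)
    qed
    finally show ?case .
  qed
  from this[of UNIV] have "(\<Sum>m\<in>PiE UNIV I. q (tensor (\<lambda>i. axis (m i) 1))) \<le> real (\<Prod>i\<in>UNIV. card (I i)) * M"
    by simp
  then show "(\<Sum>m\<in>multi_indices I. axis m 1 \<bullet> H (axis m 1)) \<le> real (card (multi_indices I)) * M"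
    by (simp add: tensor_axis q_def multi_indices_eq_PiE card_PiE)
qed

text \<open>Adding B times the identity raises the trace by \<open>card J\<close> times B and the
  bound on a subset of the unit ball by at most B, so John's inequality may be tested on positive
  semidefinite forms there.\<close>

lemma linear_shift_psd:
  fixes h :: "'a::euclidean_space \<Rightarrow> 'a"
  assumes "linear h"
  obtains B where "0 \<le> B" "\<And>x. 0 \<le> x \<bullet> (h x + B *\<^sub>R x)"
proof -
  obtain B where B: "0 < B" "\<And>x. norm (h x) \<le> B * norm x" using linear_bounded_pos[OF assms] by blast
  have "0 \<le> x \<bullet> (h x + B *\<^sub>R x)" for x
  proof -
    have "\<bar>x \<bullet> h x\<bar> \<le> norm x * norm (h x)" by (rule Cauchy_Schwarz_ineq2)
    also have "\<dots> \<le> norm x * (B * norm x)" using B(2) by (intro mult_left_mono) auto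
    also have "\<dots> = B * (x \<bullet> x)" by (simp add: dot_square_norm power2_eq_square)
    finally show ?thesis by (simp add: inner_add_right)
  qed
  then show ?thesis using that[of B] B(1) by simp
qed

text \<open>Along a segment the form is the linear interpolation of its end values minus u(1-u)
  times its value at the difference of the end points.\<close>

lemma convex_psd_sublevel:
  fixes g :: "'a::real_inner \<Rightarrow> 'a"
  assumes g: "linear g" and psd: "\<And>x. 0 \<le> x \<bullet> g x"
  shows "convex {x. x \<bullet> g x \<le> c}"
  unfolding convex_alt
proof (intro ballI allI impI)
  fix x y and u :: real
  assume x: "x \<in> {x. x \<bullet> g x \<le> c}" and y: "y \<in> {x. x \<bullet> g x \<le> c}" and u: "0 \<le> u \<and> u \<le> 1"
  let ?z = "(1 - u) *\<^sub>R x + u *\<^sub>R y"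
  have "?z \<bullet> g ?z = (1 - u) * (x \<bullet> g x) + u * (y \<bullet> g y) - u * (1 - u) * ((x - y) \<bullet> g (x - y))"
    by (simp add: linear_add[OF g] linear_diff[OF g] linear_cmul[OF g] inner_add_left inner_add_right
        inner_diff_left inner_diff_right algebra_simps)
  also have "\<dots> \<le> (1 - u) * (x \<bullet> g x) + u * (y \<bullet> g y)" using psd[of "x - y"] u by simp
  also have "\<dots> \<le> (1 - u) * c + u * c" using x y u by (intro add_mono mult_left_mono) auto
  finally show "?z \<in> {x. x \<bullet> g x \<le> c}" by (simp add: algebra_simps)
qed

lemma sum_axis_shift:
  fixes h :: "real^'k::finite \<Rightarrow> real^'k"
  shows "(\<Sum>k\<in>J. axis k 1 \<bullet> (h (axis k 1) + B *\<^sub>R axis k 1)) = (\<Sum>k\<in>J. axis k 1 \<bullet> h (axis k 1)) + real (card J) * B"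
  by (simp add: inner_add_right sum.distrib inner_axis_axis)

text \<open>An indefinite form can exceed on the hull its bound on F. The shifted form is convex and
  cannot; the norm bound on F limits the cost of the shift to B.\<close>

lemma john_convex_hullD:
  assumes K: "john J (convex hull F)" and F: "\<And>x. x \<in> F \<Longrightarrow> norm x \<le> 1"
  shows "john J F"
  unfolding john_def
proof (intro allI impI)
  fix h :: "real^'a \<Rightarrow> real^'a" and M
  assume h: "linear h \<and> (\<forall>x\<in>F. x \<bullet> h x \<le> M)"
  obtain B where B: "0 \<le> B" "\<And>x. 0 \<le> x \<bullet> (h x + B *\<^sub>R x)" using linear_shift_psd h by blast
  define g where "g x = h x + B *\<^sub>R x" for x
  have g: "linear g" unfolding g_def using h by (intro linear_compose_add linear_scaleR) auto
  have "convex hull F \<subseteq> {x. x \<bullet> g x \<le> M + B}"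
  proof (rule hull_minimal)
    show "convex {x. x \<bullet> g x \<le> M + B}" using B(2) by (intro convex_psd_sublevel g) (simp add: g_def)
    have "x \<bullet> g x \<le> M + B" if "x \<in> F" for x
    proof -
      have "x \<bullet> x \<le> 1" using F[OF that] by (simp add: dot_square_norm abs_square_le_1)
      then have "B * (x \<bullet> x) \<le> B" using B(1) by (simp add: mult_left_le)
      then show ?thesis using h that by (force simp: g_def inner_add_right)
    qed
    then show "F \<subseteq> {x. x \<bullet> g x \<le> M + B}" by blast
  qed
  then have "(\<Sum>k\<in>J. axis k 1 \<bullet> g (axis k 1)) \<le> real (card J) * (M + B)"
    by (intro johnD[OF K g]) blast
  then show "(\<Sum>k\<in>J. axis k 1 \<bullet> h (axis k 1)) \<le> real (card J) * M"
    unfolding g_def sum_axis_shift by (simp add: distrib_left)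
qed

text \<open>Test with g in slot j and the identity elsewhere. On tensors this is the form g times
  squared norms of the other components, and positivity of g permits bounding these by 1. In the
  trace the other slots contribute the product N of their dimensions, which cancels.\<close>

lemma john_tensor_factor:
  fixes I :: "'l::finite \<Rightarrow> 'n::finite set"
  assumes K: "john (multi_indices I) (tensors D)" and D: "\<And>i x. x \<in> D i \<Longrightarrow> norm x \<le> 1"
    and I: "\<And>i. I i \<noteq> {}"
  shows "john (I j) (D j)"
  unfolding john_def
proof (intro allI impI)
  fix h :: "real^'n \<Rightarrow> real^'n" and M
  assume h: "linear h \<and> (\<forall>x\<in>D j. x \<bullet> h x \<le> M)"
  obtain B where B: "0 \<le> B" "\<And>x. 0 \<le> x \<bullet> (h x + B *\<^sub>R x)" using linear_shift_psd h by blast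
  define g where "g x = h x + B *\<^sub>R x" for x
  have g: "linear g" unfolding g_def using h by (intro linear_compose_add linear_scaleR) auto
  \<comment> \<open>g applied along coordinate j of an array, written entrywise so that it is
    defined and linear on all arrays, not only on tensors.\<close>
  define H :: "real^('l \<Rightarrow> 'n) \<Rightarrow> real^('l \<Rightarrow> 'n)" where
    "H T = (\<chi> m. \<Sum>k\<in>UNIV. T $ m(j := k) * g (axis k 1) $ m j)" for T
  have H: "linear H"
    by (rule linearI) (simp_all add: H_def vec_eq_iff distrib_right sum.distrib sum_distrib_left mult.assoc)
  have H_tensor: "H (tensor x) = tensor (x(j := g (x j)))" for x
  proof -
    have "H (tensor x) $ m = tensor (x(j := g (x j))) $ m" for m
    proof -
      have "tensor x $ m(j := k) = x j $ k * (\<Prod>i\<in>UNIV - {j}. x i $ m i)" for k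
        using tensor_fun_upd_nth[of x j "x j" "m(j := k)"] by simp
      then have "H (tensor x) $ m = (\<Sum>k\<in>UNIV. x j $ k * g (axis k 1) $ m j) * (\<Prod>i\<in>UNIV - {j}. x i $ m i)"
        by (simp add: H_def sum_distrib_left mult_ac)
      also have "(\<Sum>k\<in>UNIV. x j $ k * g (axis k 1) $ m j) = g (\<Sum>k\<in>UNIV. x j $ k *\<^sub>R axis k 1) $ m j"
        by (simp add: linear_sum[OF g] linear_cmul[OF g] sum_component)
      also have "(\<Sum>k\<in>UNIV. x j $ k *\<^sub>R axis k 1) = x j"
        using basis_expansion[of "x j"] by (simp add: scalar_mult_eq_scaleR)
      finally show ?thesis by (simp only: tensor_fun_upd_nth)
    qed
    then show ?thesis by (simp add: vec_eq_iff)
  qed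
  have q: "tensor x \<bullet> H (tensor x) = (x j \<bullet> g (x j)) * (\<Prod>i\<in>UNIV - {j}. x i \<bullet> x i)" for x
    unfolding H_tensor using inner_tensor_fun_upd[of x j "x j" x "g (x j)"] by simp
  have "T \<bullet> H T \<le> M + B" if "T \<in> tensors D" for T
  proof -
    obtain x where x: "T = tensor x" "\<And>i. x i \<in> D i" using \<open>T \<in> tensors D\<close> unfolding tensors_def by blast
    have le1: "x i \<bullet> x i \<le> 1" for i using D[OF x(2), of i] by (simp add: dot_square_norm abs_square_le_1)
    have "(\<Prod>i\<in>UNIV - {j}. x i \<bullet> x i) \<le> 1" using le1 by (intro prod_le_1) auto
    then have "T \<bullet> H T \<le> x j \<bullet> g (x j)"
      unfolding x(1) q using B(2)[of "x j"] by (simp add: g_def mult_left_le)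
    also have "\<dots> \<le> M + B"
    proof -
      have "B * (x j \<bullet> x j) \<le> B" using B(1) le1 by (simp add: mult_left_le)
      moreover have "x j \<bullet> h (x j) \<le> M" using h x(2) by blast
      ultimately show ?thesis by (simp add: g_def inner_add_right)
    qed
    finally show ?thesis .
  qed
  from johnD[OF K H this]
  have le: "(\<Sum>m\<in>multi_indices I. axis m 1 \<bullet> H (axis m 1)) \<le> real (card (multi_indices I)) * (M + B)" .
  define \<phi> where "\<phi> k = axis k 1 \<bullet> g (axis k 1)" for k
  define N where "N = (\<Prod>i\<in>UNIV - {j}. real (card (I i)))"
  have N: "0 < N" using I by (auto simp: N_def card_gt_0_iff intro: prod_pos)
  \<comment> \<open>The diagonal entry depends on \<open>m j\<close> alone; as a product over all
    slots it lets the sum over multi-indices factor.\<close>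
  have "axis m 1 \<bullet> H (axis m 1) = (\<Prod>i\<in>UNIV. if i = j then \<phi> (m i) else 1)" for m
    using q[of "\<lambda>i. axis (m i) 1"] by (simp add: tensor_axis inner_axis_axis \<phi>_def prod.delta)
  then have "(\<Sum>m\<in>multi_indices I. axis m 1 \<bullet> H (axis m 1))
      = (\<Sum>m\<in>PiE UNIV I. \<Prod>i\<in>UNIV. if i = j then \<phi> (m i) else 1)"
    by (simp add: multi_indices_eq_PiE)
  also have "\<dots> = (\<Prod>i\<in>UNIV. \<Sum>k\<in>I i. if i = j then \<phi> k else 1)"
    by (rule prod_sum_PiE[symmetric]) auto
  also have "\<dots> = (\<Sum>k\<in>I j. if j = j then \<phi> k else 1) * (\<Prod>i\<in>UNIV - {j}. \<Sum>k\<in>I i. if i = j then \<phi> k else 1)"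
    by (rule prod.remove) auto
  also have "(\<Prod>i\<in>UNIV - {j}. \<Sum>k\<in>I i. if i = j then \<phi> k else 1) = N"
    unfolding N_def by (rule prod.cong) auto
  finally have tr: "(\<Sum>m\<in>multi_indices I. axis m 1 \<bullet> H (axis m 1)) = (\<Sum>k\<in>I j. \<phi> k) * N" by simp
  have "real (card (multi_indices I)) = (\<Prod>i\<in>UNIV. real (card (I i)))"
    by (simp add: multi_indices_eq_PiE card_PiE)
  also have "\<dots> = real (card (I j)) * N" unfolding N_def by (rule prod.remove) auto
  finally have "(\<Sum>k\<in>I j. \<phi> k) * N \<le> (real (card (I j)) * (M + B)) * N" using le tr by (simp add: mult_ac)
  then have "(\<Sum>k\<in>I j. \<phi> k) \<le> real (card (I j)) * (M + B)" using N by simp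
  then show "(\<Sum>k\<in>I j. axis k 1 \<bullet> h (axis k 1)) \<le> real (card (I j)) * M"
    unfolding \<phi>_def g_def sum_axis_shift by (simp add: distrib_left)
qed

section \<open>Determinants\<close>

lemma det_scaleR: "det (c *\<^sub>R A) = c ^ CARD('n) * det (A :: real^'n^'n)"
proof -
  have "c *\<^sub>R A = (\<chi> i. c *s (A $ i))" by (simp add: vec_eq_iff)
  then show ?thesis using det_rows_mul[of "\<lambda>_. c" "\<lambda>i. A $ i"] by simp
qed

lemma continuous_on_det: "continuous_on S (\<lambda>A :: real^'n^'n. det A)"
  unfolding det_def by (intro continuous_intros)

lemma norm_matrix_rows: "(norm (A :: real^'m^'n))\<^sup>2 = (\<Sum>i\<in>UNIV. (norm (A $ i))\<^sup>2)"
  by (simp add: power2_norm_eq_inner inner_vec_def)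

lemma norm_vec_power2: "(norm (x :: real^'n))\<^sup>2 = (\<Sum>k\<in>UNIV. (x $ k)\<^sup>2)"
  by (simp only: power2_norm_eq_inner inner_vec_def) (simp add: power2_eq_square)

lemma norm_matrix_split:
  assumes "i \<noteq> j"
  shows "(norm (A :: real^'m^'n))\<^sup>2
    = (norm (A $ i))\<^sup>2 + (norm (A $ j))\<^sup>2 + (\<Sum>k\<in>UNIV - {i, j}. (norm (A $ k))\<^sup>2)"
proof -
  have "UNIV - {i} - {j} = UNIV - {i, j}" by auto
  then show ?thesis
    unfolding norm_matrix_rows
    using sum.remove[of UNIV i "\<lambda>i. (norm (A $ i))\<^sup>2"] sum.remove[of "UNIV - {i}" j "\<lambda>i. (norm (A $ i))\<^sup>2"] assms
    by simp
qed

lemma norm_matrix_columns: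
  assumes "linear f"
  shows "(norm (matrix f :: real^'m^'n))\<^sup>2 = (\<Sum>k\<in>UNIV. (norm (f (axis k 1)))\<^sup>2)"
proof -
  have "(norm (matrix f :: real^'m^'n))\<^sup>2 = (\<Sum>i\<in>UNIV. \<Sum>k\<in>UNIV. (f (axis k 1) $ i)\<^sup>2)"
    by (simp add: norm_matrix_rows norm_vec_power2 matrix_def)
  also have "\<dots> = (\<Sum>k\<in>UNIV. \<Sum>i\<in>UNIV. (f (axis k 1) $ i)\<^sup>2)" by (rule sum.swap)
  finally show ?thesis by (simp add: norm_vec_power2)
qed

lemma norm_mat_1: "(norm (mat 1 :: real^'n^'n))\<^sup>2 = CARD('n)"
proof -
  have "(mat 1 :: real^'n^'n) $ i = axis i 1" for i by (simp add: mat_def axis_def vec_eq_iff)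
  then show ?thesis by (simp add: norm_matrix_rows norm_axis_1)
qed

text \<open>If B had smaller norm, it could be stretched by some c > 1 within the ball, multiplying
  its determinant by c^n. The determinant is nonzero because the identity is a competitor.\<close>

lemma norm_det_maximizer:
  fixes A B :: "real^'n^'n"
  assumes max: "\<And>B :: real^'n^'n. (norm B)\<^sup>2 \<le> CARD('n) \<Longrightarrow> \<bar>det B\<bar> \<le> \<bar>det A\<bar>"
    and B: "\<bar>det B\<bar> = \<bar>det A\<bar>"
  shows "CARD('n) \<le> (norm B)\<^sup>2"
proof (rule ccontr)
  assume less: "\<not> CARD('n) \<le> (norm B)\<^sup>2"
  have "1 \<le> \<bar>det A\<bar>" using max[of "mat 1"] by (simp add: norm_mat_1)
  with B have dB: "0 < \<bar>det B\<bar>" by simp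
  have "det (0 :: real^'n^'n) = 0" using det_scaleR[of 0 "0 :: real^'n^'n"] by (simp add: power_0_left)
  then have nB: "norm B \<noteq> 0" using dB by auto
  \<comment> \<open>This stretches B exactly to the sphere of radius sqrt n.\<close>
  define c where "c = sqrt (CARD('n)) / norm B"
  have "1 < c"
  proof -
    have "norm B < sqrt (CARD('n))" using less by (simp add: real_less_rsqrt)
    then show ?thesis using nB by (simp add: c_def)
  qed
  have "(norm (c *\<^sub>R B))\<^sup>2 \<le> CARD('n)" using nB by (simp add: c_def power_mult_distrib)
  then have "\<bar>det (c *\<^sub>R B)\<bar> \<le> \<bar>det B\<bar>" using max B by simp
  then have "c ^ CARD('n) * \<bar>det B\<bar> \<le> \<bar>det B\<bar>" using \<open>1 < c\<close> by (simp add: det_scaleR abs_mult)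
  moreover have "1 < c ^ CARD('n)" using \<open>1 < c\<close> by (simp add: one_less_power)
  ultimately show False using dB by simp
qed

text \<open>
  Hadamard's inequality combined with the arithmetic-geometric mean inequality. At a maximizer of \<open>\<bar>det\<bar>\<close>
  on the Frobenius sphere, making two rows orthogonal or balancing their lengths keeps the determinant and
  would decrease the norm, so the rows are already orthogonal and of equal length.
\<close>

lemma det_maximizer_orthogonal:
  fixes A :: "real^'n^'n"
  assumes max: "\<And>B :: real^'n^'n. (norm B)\<^sup>2 \<le> CARD('n) \<Longrightarrow> \<bar>det B\<bar> \<le> \<bar>det A\<bar>"
    and A: "(norm A)\<^sup>2 \<le> CARD('n)"
  shows "orthogonal_matrix A"
proof -
  have "1 \<le> \<bar>det A\<bar>" using max[of "mat 1"] by (simp add: norm_mat_1)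
  then have dA: "det A \<noteq> 0" by auto
  have nA: "(norm A)\<^sup>2 = CARD('n)" using A norm_det_maximizer[of A A, OF max] by simp
  have row0: "A $ i \<noteq> 0" for i using dA det_zero_row(1)[of i A] by (auto simp: row_def)
  have orth: "A $ i \<bullet> A $ j = 0" if ij: "i \<noteq> j" for i j
  proof (rule ccontr)
    assume nz: "A $ i \<bullet> A $ j \<noteq> 0"
    \<comment> \<open>Gram-Schmidt coefficient: adding c times row j makes row i orthogonal to it
      and shortens row i.\<close>
    define c where "c = - (A $ i \<bullet> A $ j) / (A $ j \<bullet> A $ j)"
    define B where "B = (\<chi> k. if k = i then row i A + c *s row j A else row k A)"
    have "det B = det A" unfolding B_def by (rule det_row_operation[OF ij])
    then have "CARD('n) \<le> (norm B)\<^sup>2" using norm_det_maximizer[of A B, OF max] by simp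
    moreover have "(norm B)\<^sup>2 = (norm (B $ i))\<^sup>2 + (norm (A $ j))\<^sup>2 + (\<Sum>k\<in>UNIV - {i, j}. (norm (A $ k))\<^sup>2)"
      unfolding norm_matrix_split[OF ij, of B] using ij by (simp add: B_def row_def)
    moreover have "(norm (B $ i))\<^sup>2 = (norm (A $ i))\<^sup>2 - (A $ i \<bullet> A $ j)\<^sup>2 / (A $ j \<bullet> A $ j)"
    proof -
      have "B $ i = A $ i + c *\<^sub>R A $ j" by (simp add: B_def row_def scalar_mult_eq_scaleR)
      then have "(norm (B $ i))\<^sup>2 = A $ i \<bullet> A $ i + 2 * c * (A $ i \<bullet> A $ j) + c\<^sup>2 * (A $ j \<bullet> A $ j)"
        by (simp only: power2_norm_eq_inner)
          (simp add: inner_add_left inner_add_right inner_commute power2_eq_square algebra_simps)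
      moreover have "2 * c * (A $ i \<bullet> A $ j) + c\<^sup>2 * (A $ j \<bullet> A $ j) = - ((A $ i \<bullet> A $ j)\<^sup>2 / (A $ j \<bullet> A $ j))"
        using row0[of j] by (simp add: c_def power2_eq_square field_simps)
      ultimately show ?thesis unfolding power2_norm_eq_inner[of "A $ i"] by linarith
    qed
    moreover have "0 < (A $ i \<bullet> A $ j)\<^sup>2 / (A $ j \<bullet> A $ j)" using nz row0[of j] by simp
    ultimately show False using nA norm_matrix_split[OF ij, of A] by linarith
  qed
  have eq: "norm (A $ i) = norm (A $ j)" for i j
  proof (cases "i = j")
    case ij: False
    let ?p = "norm (A $ i)" and ?q = "norm (A $ j)"
    have pq: "0 < ?p" "0 < ?q" using row0 by auto
    \<comment> \<open>Rows of lengths p and q both become of length sqrt(pq), replacing p^2 + q^2 by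
      2pq in the squared norm.\<close>
    define s where "s = sqrt (?q / ?p)"
    have s: "0 < s" "s\<^sup>2 = ?q / ?p" using pq by (auto simp: s_def)
    define B where "B = (\<chi> k. if k = j then (1 / s) *s A $ k else if k = i then s *s A $ k else A $ k)"
    have "det B = (1 / s) * det (\<chi> k. if k = j then A $ k else if k = i then s *s A $ k else A $ k)"
      unfolding B_def by (rule det_row_mul)
    also have "(\<chi> k. if k = j then A $ k else if k = i then s *s A $ k else A $ k) =
        (\<chi> k. if k = i then s *s A $ k else A $ k)" using ij by (simp add: vec_eq_iff)
    also have "det \<dots> = s * det (\<chi> k. if k = i then A $ k else A $ k)" by (rule det_row_mul)
    finally have "det B = det A" using s by simp
    then have "CARD('n) \<le> (norm B)\<^sup>2" using norm_det_maximizer[of A B, OF max] by simp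
    moreover have "(norm B)\<^sup>2 = 2 * ?p * ?q + (\<Sum>k\<in>UNIV - {i, j}. (norm (A $ k))\<^sup>2)"
    proof -
      have "(norm (B $ i))\<^sup>2 = s\<^sup>2 * ?p\<^sup>2" "(norm (B $ j))\<^sup>2 = ?q\<^sup>2 / s\<^sup>2"
        using ij s(1) by (simp_all add: B_def scalar_mult_eq_scaleR power_mult_distrib power_divide)
      moreover have "s\<^sup>2 * ?p\<^sup>2 = ?p * ?q" "?q\<^sup>2 / s\<^sup>2 = ?p * ?q"
        unfolding s(2) using pq by (simp_all add: power2_eq_square)
      moreover have "(\<Sum>k\<in>UNIV - {i, j}. (norm (B $ k))\<^sup>2) = (\<Sum>k\<in>UNIV - {i, j}. (norm (A $ k))\<^sup>2)"
        by (rule sum.cong) (auto simp: B_def)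
      ultimately show ?thesis by (simp add: norm_matrix_split[OF ij, of B])
    qed
    ultimately have "?p\<^sup>2 + ?q\<^sup>2 \<le> 2 * ?p * ?q" using nA norm_matrix_split[OF ij, of A] by linarith
    then have "(?p - ?q)\<^sup>2 \<le> 0" by (simp add: power2_diff)
    then show ?thesis by simp
  qed simp
  have "norm (A $ i) = 1" for i
  proof -
    have "(norm A)\<^sup>2 = (\<Sum>k\<in>(UNIV :: 'n set). (norm (A $ i))\<^sup>2)"
      unfolding norm_matrix_rows by (intro sum.cong refl arg_cong[where f = "\<lambda>r. r\<^sup>2"] eq)
    then have "(norm (A $ i))\<^sup>2 = 1" using nA by simp
    then have "norm (A $ i) = 1 \<or> norm (A $ i) = - 1" by (simp only: power2_eq_1_iff)
    then show ?thesis using norm_ge_zero[of "A $ i"] by linarith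
  qed
  then show ?thesis
    using orth by (simp add: orthogonal_matrix_orthonormal_rows orthogonal_def row_def)
qed

text \<open>A maximizer exists by compactness and is orthogonal, so the maximum is 1; a matrix with
  determinant of modulus 1 is then itself a maximizer.\<close>

lemma det_norm_bound:
  fixes A :: "real^'n^'n"
  assumes A: "(norm A)\<^sup>2 \<le> CARD('n)"
  shows "\<bar>det A\<bar> \<le> 1" and "\<bar>det A\<bar> = 1 \<Longrightarrow> orthogonal_matrix A"
proof -
  let ?K = "cball 0 (sqrt (CARD('n))) :: (real^'n^'n) set"
  have K: "B \<in> ?K \<longleftrightarrow> (norm B)\<^sup>2 \<le> CARD('n)" for B :: "real^'n^'n"
    using real_sqrt_le_iff[of "(norm B)\<^sup>2" "real CARD('n)"] by simp
  have "continuous_on ?K (\<lambda>B. \<bar>det B\<bar>)" by (intro continuous_intros continuous_on_det)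
  moreover have "?K \<noteq> {}" by simp
  ultimately obtain M where M: "M \<in> ?K" "\<forall>B\<in>?K. \<bar>det B\<bar> \<le> \<bar>det M\<bar>"
    using continuous_attains_sup[OF compact_cball] by blast
  have "orthogonal_matrix M" using M K by (intro det_maximizer_orthogonal) auto
  then have dM: "\<bar>det M\<bar> = 1" using det_orthogonal_matrix by fastforce
  show "\<bar>det A\<bar> \<le> 1" using M(2) K A dM by metis
  assume "\<bar>det A\<bar> = 1"
  then show "orthogonal_matrix A" using M(2) K A dM by (intro det_maximizer_orthogonal) auto
qed

text \<open>A permutation other than the identity moves at least two points, so after
  differentiating one entry of its product an off-diagonal zero of the identity matrix
  remains.\<close>

lemma has_real_derivative_det_at_mat_1:
  fixes A :: "real^'n^'n"
  shows "((\<lambda>t. det (mat 1 + t *\<^sub>R A)) has_real_derivative (\<Sum>k\<in>UNIV. A $ k $ k)) (at 0)"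
proof -
  let ?P = "{p. p permutes (UNIV :: 'n set)}"
  define D where "D p = (\<Sum>i\<in>UNIV. A $ i $ p i * (\<Prod>j\<in>UNIV - {i}. (mat 1 :: real^'n^'n) $ j $ p j))" for p
  have "((\<lambda>t. \<Prod>i\<in>UNIV. (mat 1 + t *\<^sub>R A) $ i $ p i) has_real_derivative D p) (at 0)" for p
  proof -
    have "((\<lambda>t. (mat 1 + t *\<^sub>R A) $ i $ p i) has_real_derivative A $ i $ p i) (at 0)" for i
      by (auto intro!: derivative_eq_intros)
    from has_field_derivative_prod[OF this] show ?thesis by (simp add: D_def)
  qed
  then have "((\<lambda>t. det (mat 1 + t *\<^sub>R A)) has_real_derivative (\<Sum>p\<in>?P. of_int (sign p) * D p)) (at 0)"
    unfolding det_def by (intro DERIV_sum DERIV_cmult)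
  also have "(\<Sum>p\<in>?P. of_int (sign p) * D p) = (\<Sum>p\<in>{id}. of_int (sign p) * D p)"
  proof (rule sum.mono_neutral_right)
    show "\<forall>p\<in>?P - {id}. of_int (sign p) * D p = 0"
    proof
      fix p assume p: "p \<in> ?P - {id}"
      have "(\<Prod>j\<in>UNIV - {i}. (mat 1 :: real^'n^'n) $ j $ p j) = 0" for i
      proof -
        have "\<exists>j\<in>UNIV - {i}. p j \<noteq> j"
        proof (rule ccontr)
          assume "\<not> ?thesis"
          then have fix_j: "p j = j" if "j \<noteq> i" for j using that by blast
          have "inj p" using p permutes_inj by auto
          then have "p i = i" using fix_j by (metis injD)
          then have "p x = id x" for x using fix_j by (cases "x = i") auto
          then have "p = id" by (rule ext)
          then show False using p by simp
        qed
        then obtain j where "j \<in> UNIV - {i}" "p j \<noteq> j" by blast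
        then show ?thesis by (intro prod_zero bexI[of _ j]) (auto simp: mat_def)
      qed
      then show "of_int (sign p) * D p = 0" unfolding D_def by (simp only: mult_zero_right sum.neutral_const)
    qed
  qed (auto simp: permutes_id)
  also have "\<dots> = (\<Sum>k\<in>UNIV. A $ k $ k)" by (simp add: D_def mat_def)
  finally show ?thesis .
qed

section \<open>Volume\<close>

definition coord_proj :: "'k::finite set \<Rightarrow> real^'k \<Rightarrow> real^'k" where
  "coord_proj J x = (\<chi> k. if k \<in> J then x $ k else 0)"

lemma coord_proj_nth [simp]: "coord_proj J x $ k = (if k \<in> J then x $ k else 0)"
  by (simp add: coord_proj_def)

lemma linear_coord_proj: "linear (coord_proj J)"
  by (rule linearI) (simp_all add: vec_eq_iff)

lemma coord_proj_in_coord_space: "coord_proj J x \<in> coord_space J"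
  by (simp add: coord_space_def)

lemma coord_proj_id: "x \<in> coord_space J \<Longrightarrow> coord_proj J x = x"
  by (simp add: coord_space_def vec_eq_iff)

lemma norm_coord_proj_le: "norm (coord_proj J x) \<le> norm x"
  by (rule norm_le_componentwise_cart) simp

text \<open>Extension by the identity off J. If f preserves \<open>coord_space J\<close>, the
  resulting matrix is block diagonal and its determinant is that of f on
  \<open>coord_space J\<close>.\<close>

definition block_ext :: "'k::finite set \<Rightarrow> (real^'k \<Rightarrow> real^'k) \<Rightarrow> real^'k \<Rightarrow> real^'k" where
  "block_ext J f x = f (coord_proj J x) + (x - coord_proj J x)"

lemma linear_block_ext: "linear f \<Longrightarrow> linear (block_ext J f)"
  unfolding block_ext_def
  by (intro linear_compose_add linear_compose_sub linear_compose[OF linear_coord_proj, unfolded o_def]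
      linear_coord_proj linear_ident)

lemma block_ext_coord_space: "x \<in> coord_space J \<Longrightarrow> block_ext J f x = f x"
  by (simp add: block_ext_def coord_proj_id)

lemma block_ext_axis: "linear f \<Longrightarrow> k \<notin> J \<Longrightarrow> block_ext J f (axis k 1) = axis k 1"
proof -
  assume f: "linear f" and k: "k \<notin> J"
  have "coord_proj J (axis k 1) = 0" using k by (auto simp: vec_eq_iff axis_def)
  then show ?thesis using linear_0[OF f] by (simp add: block_ext_def)
qed

lemma block_ext_compose:
  assumes "linear f" "linear g" "g ` coord_space J \<subseteq> coord_space J"
  shows "block_ext J (f \<circ> g) = block_ext J f \<circ> block_ext J g"
proof
  fix x
  let ?p = "coord_proj J x"
  have "g ?p \<in> coord_space J" using assms(3) coord_proj_in_coord_space by blast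
  then have "coord_proj J (block_ext J g x) = g ?p"
    unfolding block_ext_def by (auto simp: vec_eq_iff coord_space_def)
  then show "block_ext J (f \<circ> g) x = (block_ext J f \<circ> block_ext J g) x"
    by (simp add: block_ext_def)
qed

lemma block_ext_id: "block_ext J id = id"
  by (simp add: block_ext_def fun_eq_iff)

text \<open>S times the unit cube in the remaining coordinates. Its Lebesgue measure in the ambient
  type is the volume of S, which brings change of variables within reach.\<close>

definition cylinder :: "'k::finite set \<Rightarrow> (real^'k) set \<Rightarrow> (real^'k) set" where
  "cylinder J S = {x. coord_proj J x \<in> S \<and> (\<forall>k\<in>-J. x $ k \<in> {0..1})}"

lemma prod_Basis_cart:
  fixes g :: "real^'k \<Rightarrow> 'a::comm_monoid_mult"
  shows "(\<Prod>b\<in>Basis. g b) = (\<Prod>k\<in>UNIV. g (axis k 1))"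
proof -
  have B: "Basis = range (\<lambda>k. axis k 1 :: real^'k)" by (auto simp: Basis_vec_def)
  have i: "inj (\<lambda>k. axis k 1 :: real^'k)" by (auto simp: inj_on_def axis_eq_axis)
  show ?thesis unfolding B prod.reindex[OF i] o_def ..
qed

lemma emeasure_lborel_PiE:
  fixes B :: "'k::finite \<Rightarrow> real set"
  assumes B: "\<And>k. B k \<in> sets borel"
  shows "emeasure lborel {x :: real^'k. \<forall>k. x $ k \<in> B k} = (\<Prod>k\<in>UNIV. emeasure lborel (B k))"
proof -
  \<comment> \<open>The product formula for \<open>lborel\<close> is indexed by
    \<open>Basis\<close>; \<kappa> recovers the coordinate from a basis vector.\<close>
  define \<kappa> where "\<kappa> b = (SOME k. b = axis k 1)" for b :: "real^'k"
  have \<kappa>: "\<kappa> (axis k 1) = k" for k unfolding \<kappa>_def by (rule some_equality) (auto simp: axis_eq_axis)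
  have meas: "{x :: real^'k. \<forall>k. x $ k \<in> B k} \<in> sets borel"
  proof -
    have "(\<lambda>x :: real^'k. x $ k) \<in> borel_measurable borel" for k
      by (intro borel_measurable_continuous_onI continuous_intros)
    from measurable_sets[OF this B] have "(\<lambda>x :: real^'k. x $ k) -` B k \<in> sets borel" for k by simp
    then have "(\<Inter>k\<in>UNIV. (\<lambda>x :: real^'k. x $ k) -` B k) \<in> sets borel" by (intro sets.finite_INT) auto
    also have "(\<Inter>k\<in>UNIV. (\<lambda>x :: real^'k. x $ k) -` B k) = {x. \<forall>k. x $ k \<in> B k}" by auto
    finally show ?thesis .
  qed
  have ind: "indicator {x :: real^'k. \<forall>k. x $ k \<in> B k} x = (\<Prod>b\<in>Basis. indicator (B (\<kappa> b)) (x \<bullet> b) :: ennreal)" for x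
    unfolding prod_Basis_cart \<kappa> by (auto simp: indicator_def inner_axis)
  have "emeasure lborel {x :: real^'k. \<forall>k. x $ k \<in> B k}
      = (\<integral>\<^sup>+x. (\<Prod>b\<in>Basis. indicator (B (\<kappa> b)) (x \<bullet> b)) \<partial>lborel)"
    using meas by (simp flip: ind)
  also have "\<dots> = (\<Prod>b\<in>(Basis :: (real^'k) set). (\<integral>\<^sup>+x. indicator (B (\<kappa> b)) x \<partial>lborel))"
    using B by (intro nn_integral_lborel_prod) auto
  also have "\<dots> = (\<Prod>k\<in>UNIV. emeasure lborel (B k))"
    unfolding prod_Basis_cart \<kappa> using B by simp
  finally show ?thesis .
qed

text \<open>Lebesgue measure restricted to the unit cube off J and projected to J is the product
  measure, because the cube has mass 1; agreement on boxes identifies it.\<close>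

lemma volume_eq_cylinder:
  fixes J :: "'k::finite set"
  assumes S: "S \<subseteq> coord_space J" "S \<in> sets borel"
  shows "volume J S = emeasure lborel (cylinder J S)"
proof -
  interpret product_sigma_finite "\<lambda>_ :: 'k. lborel :: real measure" by standard
  define \<phi> where "\<phi> = (\<lambda>x :: real^'k. restrict (\<lambda>k. x $ k) J)"
  define C where "C = {x :: real^'k. \<forall>k\<in>-J. x $ k \<in> {0..1}}"
  let ?\<Pi> = "Pi\<^sub>M J (\<lambda>_. lborel :: real measure)"
  have nth: "(\<lambda>x :: real^'k. x $ k) \<in> borel_measurable borel" for k
    by (intro borel_measurable_continuous_onI continuous_intros)
  have \<phi>: "\<phi> \<in> measurable lborel ?\<Pi>"
    unfolding \<phi>_def using nth by (intro measurable_restrict) simp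
  have C: "C \<in> sets lborel"
  proof -
    have "C = (\<Inter>k\<in>-J. {x. 0 \<le> x $ k} \<inter> {x. x $ k \<le> 1})" by (auto simp: C_def)
    also have "closed \<dots>"
      by (intro closed_INT ballI closed_Int closed_Collect_le continuous_intros)
    finally show ?thesis by simp
  qed
  have N: "emeasure (distr (density lborel (indicator C)) ?\<Pi> \<phi>) X = emeasure lborel (C \<inter> \<phi> -` X)"
    if X: "X \<in> sets ?\<Pi>" for X
  proof -
    have "\<phi> -` X \<in> sets lborel" using measurable_sets[OF \<phi> X] by simp
    then show ?thesis using \<phi> C X by (subst emeasure_distr) (simp_all add: emeasure_restricted)
  qed
  have eq: "distr (density lborel (indicator C)) ?\<Pi> \<phi> = ?\<Pi>"
  proof (rule PiM_eqI)
    fix A :: "'k \<Rightarrow> real set" assume A: "\<And>k. k \<in> J \<Longrightarrow> A k \<in> sets lborel"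
    define B where "B k = (if k \<in> J then A k else {0..1})" for k
    have "emeasure (distr (density lborel (indicator C)) ?\<Pi> \<phi>) (PiE J A) = emeasure lborel (C \<inter> \<phi> -` PiE J A)"
      using A by (intro N sets_PiM_I_finite) auto
    also have "C \<inter> \<phi> -` PiE J A = {x. \<forall>k. x $ k \<in> B k}"
      by (auto simp: C_def \<phi>_def B_def PiE_iff split: if_splits)
    also have "emeasure lborel \<dots> = (\<Prod>k\<in>UNIV. emeasure lborel (B k))"
      using A by (intro emeasure_lborel_PiE) (auto simp: B_def)
    also have "\<dots> = (\<Prod>k\<in>J. emeasure lborel (A k))"
      by (intro prod.mono_neutral_cong_right) (auto simp: B_def)
    finally show "emeasure (distr (density lborel (indicator C)) ?\<Pi> \<phi>) (PiE J A) = (\<Prod>k\<in>J. emeasure lborel (A k))" .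
  qed auto
  have inj: "\<phi> x = \<phi> s \<longleftrightarrow> coord_proj J x = s" if "s \<in> S" for x s
    using that S(1) by (auto simp: \<phi>_def restrict_def fun_eq_iff vec_eq_iff coord_space_def subset_iff)
  \<comment> \<open>Images of measurable sets need care: here the image under \<phi> is a preimage
    under the measurable map \<psi>, which pads with zeros.\<close>
  have "\<phi> ` S \<in> sets ?\<Pi>"
  proof -
    define \<psi> :: "('k \<Rightarrow> real) \<Rightarrow> real^'k" where "\<psi> f = (\<chi> k. if k \<in> J then f k else 0)" for f
    have \<psi>_nth: "(\<lambda>f. \<psi> f $ k) \<in> borel_measurable ?\<Pi>" for k
      by (cases "k \<in> J") (simp_all add: \<psi>_def)
    have "\<psi> \<in> borel_measurable ?\<Pi>"
    proof (rule borel_measurable_euclidean_space[THEN iffD2], rule ballI)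
      fix b :: "real^'k" assume "b \<in> Basis"
      then obtain k where b: "b = axis k 1" by (auto simp: Basis_vec_def)
      show "(\<lambda>f. \<psi> f \<bullet> b) \<in> borel_measurable ?\<Pi>"
        unfolding b inner_axis inner_real_def mult_1_right by (rule \<psi>_nth)
    qed
    from measurable_sets[OF this S(2)] have "\<psi> -` S \<inter> space ?\<Pi> \<in> sets ?\<Pi>" .
    also have "\<psi> -` S \<inter> space ?\<Pi> = \<phi> ` S"
    proof (intro set_eqI iffI)
      fix f assume f: "f \<in> \<psi> -` S \<inter> space ?\<Pi>"
      then have "f = \<phi> (\<psi> f)" by (auto simp: \<phi>_def \<psi>_def space_PiM PiE_iff extensional_def fun_eq_iff)
      then show "f \<in> \<phi> ` S" using f by blast
    next
      fix f assume "f \<in> \<phi> ` S"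
      then obtain s where s: "s \<in> S" "f = \<phi> s" by blast
      have "\<psi> f = s" using s S(1) by (auto simp: \<phi>_def \<psi>_def vec_eq_iff coord_space_def subset_iff)
      moreover have "f \<in> space ?\<Pi>" using s(2) by (auto simp: space_PiM \<phi>_def)
      ultimately show "f \<in> \<psi> -` S \<inter> space ?\<Pi>" using s(1) by simp
    qed
    finally show ?thesis .
  qed
  from N[OF this] have "volume J S = emeasure lborel (C \<inter> \<phi> -` (\<phi> ` S))"
    by (simp add: volume_def eq) (simp add: \<phi>_def)
  also have "C \<inter> \<phi> -` (\<phi> ` S) = cylinder J S"
    using inj by (fastforce simp: C_def cylinder_def image_iff)
  finally show ?thesis .
qed

lemma compact_cylinder:
  assumes "compact S"
  shows "compact (cylinder J S)"
proof -
  obtain R where R: "\<forall>x\<in>S. norm x \<le> R" using compact_imp_bounded[OF assms] by (auto simp: bounded_iff)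
  have "cylinder J S = coord_proj J -` S \<inter> (\<Inter>k\<in>-J. {x. 0 \<le> x $ k} \<inter> {x. x $ k \<le> 1})"
    by (auto simp: cylinder_def)
  also have "closed \<dots>"
    using linear_continuous_at[OF linear_coord_proj[unfolded linear_conv_bounded_linear]]
    by (intro closed_Int closed_INT ballI closed_Collect_le continuous_intros
        continuous_closed_vimage[OF compact_imp_closed[OF assms]]) auto
  finally have "closed (cylinder J S)" .
  moreover have "norm x \<le> R + real CARD('a)" if x: "x \<in> cylinder J S" for x :: "real^'a"
  proof -
    have "norm (x - coord_proj J x) \<le> (\<Sum>k\<in>UNIV. \<bar>(x - coord_proj J x) $ k\<bar>)" by (rule norm_le_l1_cart)
    also have "\<dots> \<le> (\<Sum>k\<in>(UNIV :: 'a set). 1)" using x by (intro sum_mono) (auto simp: cylinder_def)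
    finally have "norm (x - coord_proj J x) \<le> real CARD('a)" by simp
    moreover have "norm (coord_proj J x) \<le> R" using x R by (auto simp: cylinder_def)
    ultimately show ?thesis using norm_triangle_sub[of x "coord_proj J x"] by linarith
  qed
  ultimately show ?thesis by (auto simp: compact_eq_bounded_closed bounded_iff)
qed

lemma cylinder_affine_image:
  assumes T: "linear T" "T ` coord_space J \<subseteq> coord_space J" and c: "c \<in> coord_space J"
    and S: "S \<subseteq> coord_space J"
  shows "cylinder J ((\<lambda>x. c + T x) ` S) = (\<lambda>x. c + block_ext J T x) ` cylinder J S"
proof (intro set_eqI iffI)
  fix x assume x: "x \<in> cylinder J ((\<lambda>x. c + T x) ` S)"
  then obtain b where b: "b \<in> S" "coord_proj J x = c + T b" by (auto simp: cylinder_def)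
  define z where "z = b + (x - coord_proj J x)"
  have pz: "coord_proj J z = b" using b(1) S by (auto simp: z_def vec_eq_iff coord_space_def)
  have "z $ k = x $ k" if "k \<notin> J" for k using b(1) S that by (auto simp: z_def coord_space_def)
  then have "z \<in> cylinder J S" using x b(1) by (simp add: cylinder_def pz)
  moreover have "x = c + block_ext J T z" using b(2) by (simp add: block_ext_def pz) (simp add: z_def)
  ultimately show "x \<in> (\<lambda>x. c + block_ext J T x) ` cylinder J S" by blast
next
  fix x assume "x \<in> (\<lambda>x. c + block_ext J T x) ` cylinder J S"
  then obtain z where z: "z \<in> cylinder J S" "x = c + block_ext J T z" by blast
  let ?b = "coord_proj J z"
  have b: "?b \<in> S" using z by (simp add: cylinder_def)
  have cT: "c + T ?b \<in> coord_space J"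
    using c T(2) coord_proj_in_coord_space by (blast intro: coord_space_add)
  have x: "x $ k = z $ k" if "k \<notin> J" for k
    using cT that by (auto simp: z(2) block_ext_def coord_space_def)
  have "coord_proj J x = c + T ?b"
    using cT by (auto simp: z(2) block_ext_def vec_eq_iff coord_space_def)
  then show "x \<in> cylinder J ((\<lambda>x. c + T x) ` S)" using b z(1) x by (auto simp: cylinder_def)
qed

lemma compact_unit_ball: "compact (unit_ball J)"
  by (simp add: unit_ball_def compact_Int_closed closed_coord_space)

lemma unit_ball_subset: "unit_ball J \<subseteq> coord_space J"
  by (simp add: unit_ball_def)

lemma emeasure_compact:
  "compact X \<Longrightarrow> emeasure lborel X = ennreal (measure lebesgue (X :: 'a::euclidean_space set))"
proof -
  assume X: "compact X"
  then have "X \<in> sets borel" by (simp add: borel_compact)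
  moreover have "emeasure lborel X \<noteq> \<infinity>" using emeasure_compact_finite[OF X] by simp
  ultimately show ?thesis by (simp add: emeasure_eq_ennreal_measure)
qed

text \<open>The library states \<open>measure_linear_image\<close> only for well-ordered index types.\<close>

lemma measure_linear_image_cart:
  fixes f :: "real^'n \<Rightarrow> real^'n"
  assumes "linear f" "S \<in> lmeasurable"
  shows "measure lebesgue (f ` S) = \<bar>det (matrix f)\<bar> * measure lebesgue S"
proof -
  define scales where "scales f \<longleftrightarrow> (\<forall>S\<in>lmeasurable. f ` S \<in> lmeasurable \<and>
      measure lebesgue (f ` S) = \<bar>det (matrix f)\<bar> * measure lebesgue S)" for f :: "real^'n \<Rightarrow> real^'n"
  have scales_unimodular: "scales h" if h: "linear h" and det: "\<bar>det (matrix h)\<bar> = 1"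
    and box: "\<And>a b. measure lebesgue (h ` cbox a b) = measure lebesgue (cbox a b)" for h
  proof -
    have res: "h ` S \<in> lmeasurable \<and> 1 * measure lebesgue S = measure lebesgue (h ` S)" if "S \<in> lmeasurable" for S
      by (rule measure_linear_sufficient[OF h that]) (simp add: box)
    show ?thesis unfolding scales_def det using res by metis
  qed
  have "scales f"
  \<comment> \<open>The induction runs over compositions, maps with a vanishing coordinate, diagonal
    maps, coordinate swaps and shears. The last two have determinant of modulus 1 and are checked on
    boxes.\<close>
  proof (rule induct_linear_elementary[OF assms(1)])
    fix f g :: "real^'n \<Rightarrow> real^'n"
    assume fg: "linear f" "linear g" "scales f" "scales g"
    have "(f \<circ> g) ` S \<in> lmeasurable \<and> measure lebesgue ((f \<circ> g) ` S) = \<bar>det (matrix (f \<circ> g))\<bar> * measure lebesgue S"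
      if "S \<in> lmeasurable" for S
    proof -
      have "g ` S \<in> lmeasurable" using fg(4) that by (simp add: scales_def)
      moreover have "(f \<circ> g) ` S = f ` (g ` S)" by (simp add: image_comp)
      ultimately show ?thesis
        using fg(3,4) that by (simp add: scales_def matrix_compose[OF fg(2,1)] det_mul abs_mult)
    qed
    then show "scales (f \<circ> g)" by (simp add: scales_def)
  next
    fix f :: "real^'n \<Rightarrow> real^'n" and i assume f: "linear f" "\<And>x. f x $ i = 0"
    have "axis i 1 \<notin> range f"
    proof
      assume "axis i 1 \<in> range f"
      then obtain x where "axis i 1 = f x" by blast
      then have "axis i (1::real) $ i = 0" using f(2)[of x] by simp
      then show False by simp
    qed
    then have ninj: "\<not> inj f" using linear_injective_imp_surjective[OF f(1)] by blast
    have "negligible (f ` S)" for S by (rule negligible_linear_singular_image[OF f(1) ninj])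
    moreover have "det (matrix f) = 0" using det_nz_iff_inj[OF f(1)] ninj by blast
    ultimately show "scales f" by (simp add: scales_def negligible_iff_measure)
  next
    fix c :: "'n \<Rightarrow> real"
    have "det (matrix (\<lambda>x :: real^'n. \<chi> i. c i * x $ i)) = prod c UNIV"
      by (subst det_diagonal) (auto simp: matrix_def axis_def)
    then show "scales (\<lambda>x. \<chi> i. c i * x $ i)"
      by (simp add: scales_def measurable_stretch measure_stretch)
  next
    fix m n :: 'n assume "m \<noteq> n"
    let ?\<sigma> = "Transposition.transpose m n"
    let ?h = "\<lambda>x :: real^'n. \<chi> i. x $ ?\<sigma> i"
    have perm: "?\<sigma> permutes UNIV" by (rule permutes_swap_id) auto
    show "scales ?h"
    proof (rule scales_unimodular)
      show "linear ?h" by (rule linearI) (simp_all add: vec_eq_iff)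
      have "matrix ?h = (\<chi> i. mat 1 $ ?\<sigma> i)" by (simp add: vec_eq_iff matrix_def mat_def axis_def)
      then show "\<bar>det (matrix ?h)\<bar> = 1"
        using det_permute_rows[OF perm, of "mat 1 :: real^'n^'n"] by (simp add: abs_mult sign_def)
      fix a b :: "real^'n"
      have "?h ` cbox a b = cbox (?h a) (?h b)"
      proof (intro set_eqI iffI)
        fix x assume "x \<in> cbox (?h a) (?h b)"
        then have "?h x \<in> cbox a b"
          unfolding mem_box_cart by (auto) (metis transpose_involutory)+
        moreover have "x = ?h (?h x)" by (simp add: vec_eq_iff)
        ultimately show "x \<in> ?h ` cbox a b" by blast
      qed (auto simp: mem_box_cart)
      moreover have "(\<Prod>i\<in>UNIV. b $ ?\<sigma> i - a $ ?\<sigma> i) = (\<Prod>i\<in>UNIV. b $ i - a $ i)"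
        using prod.permute[OF perm, of "\<lambda>i. b $ i - a $ i"] by (simp add: o_def)
      moreover have "cbox (?h a) (?h b) = {} \<longleftrightarrow> cbox a b = {}"
        using calculation(1) by blast
      ultimately show "measure lebesgue (?h ` cbox a b) = measure lebesgue (cbox a b)"
        by (simp add: content_cbox_if_cart)
    qed
  next
    fix m n :: 'n assume mn: "m \<noteq> n"
    let ?h = "\<lambda>x :: real^'n. \<chi> i. if i = m then x $ m + x $ n else x $ i"
    have lin: "linear ?h" by (rule linearI) (auto simp: vec_eq_iff algebra_simps)
    show "scales ?h"
    proof (rule scales_unimodular[OF lin])
      have "matrix ?h = (\<chi> k. if k = m then row m (mat 1) + 1 *s row n (mat 1) else row k (mat 1))"
        by (auto simp: vec_eq_iff matrix_def mat_def axis_def row_def)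
      also have "det \<dots> = det (mat 1 :: real^'n^'n)" by (rule det_row_operation[OF mn])
      finally show "\<bar>det (matrix ?h)\<bar> = 1" by simp
      fix a b :: "real^'n"
      show "measure lebesgue (?h ` cbox a b) = measure lebesgue (cbox a b)"
      proof (cases "cbox a b = {}")
        case False
        \<comment> \<open>The formula for sheared boxes wants a nonnegative n-th lower coordinate,
          so the box is translated to have its lower corner at 0.\<close>
        have cb: "cbox a b = (+) a ` cbox 0 (b - a)" using cbox_translation[of a 0 "b - a"] by simp
        then have ne: "cbox 0 (b - a) \<noteq> {}" using False by auto
        have "?h ` cbox a b = (+) (?h a) ` ?h ` cbox 0 (b - a)"
          unfolding cb image_image using linear_add[OF lin] by simp
        then have "measure lebesgue (?h ` cbox a b) = measure lebesgue (?h ` cbox 0 (b - a))"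
          by (simp only: measure_translation)
        also have "\<dots> = measure lebesgue (cbox 0 (b - a))"
          by (rule measure_shear_interval[OF mn ne]) simp
        also have "\<dots> = measure lebesgue (cbox a b)" unfolding cb by (rule measure_translation[symmetric])
        finally show ?thesis .
      qed simp
    qed
  qed
  then show ?thesis using assms(2) by (simp add: scales_def)
qed

lemma volume_ellipsoid:
  assumes T: "linear T" "T ` coord_space J \<subseteq> coord_space J" and c: "c \<in> coord_space J"
  shows "volume J ((\<lambda>x. c + T x) ` unit_ball J)
    = ennreal (\<bar>det (matrix (block_ext J T))\<bar> * measure lebesgue (cylinder J (unit_ball J)))"
proof -
  let ?E = "(\<lambda>x. c + T x) ` unit_ball J" and ?C = "cylinder J (unit_ball J)"
  have cpE: "compact ?E"
    using T(1) by (intro compact_continuous_image compact_unit_ball continuous_intros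
        linear_continuous_on) (simp add: linear_conv_bounded_linear)
  have E: "?E \<subseteq> coord_space J"
    using T(2) c unit_ball_subset by (blast intro: coord_space_add)
  have lin: "linear (block_ext J T)" by (rule linear_block_ext[OF T(1)])
  have eq: "cylinder J ?E = (+) c ` (block_ext J T ` ?C)"
    by (simp add: cylinder_affine_image[OF T c unit_ball_subset] image_image)
  have "volume J ?E = emeasure lborel (cylinder J ?E)"
    using cpE E by (intro volume_eq_cylinder) (auto intro: borel_compact)
  also have "\<dots> = ennreal (measure lebesgue (cylinder J ?E))"
    by (intro emeasure_compact compact_cylinder cpE)
  also have "measure lebesgue (cylinder J ?E) = measure lebesgue (block_ext J T ` ?C)"
    unfolding eq by (rule measure_translation)
  also have "\<dots> = \<bar>det (matrix (block_ext J T))\<bar> * measure lebesgue ?C"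
    by (intro measure_linear_image_cart lin lmeasurable_compact compact_cylinder compact_unit_ball)
  finally show ?thesis .
qed

text \<open>Positivity lets this common factor be cancelled, so that comparing volumes of ellipsoids
  is comparing determinants.\<close>

lemma measure_cylinder_unit_ball_pos: "0 < measure lebesgue (cylinder J (unit_ball J))"
proof -
  define p :: "real^'a" where "p = (\<chi> k. if k \<in> J then 0 else 1 / 2)"
  have "cball p (1 / 2) \<subseteq> cylinder J (unit_ball J)"
  proof
    fix x assume x: "x \<in> cball p (1 / 2)"
    have d: "norm (x - p) \<le> 1 / 2" using x by (simp add: dist_norm norm_minus_commute)
    have "coord_proj J x = coord_proj J (x - p)" by (simp add: vec_eq_iff p_def)
    then have "norm (coord_proj J x) \<le> 1" using norm_coord_proj_le[of J "x - p"] d by simp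
    then have "coord_proj J x \<in> unit_ball J" by (simp add: unit_ball_def coord_proj_in_coord_space)
    moreover have "x $ k \<in> {0..1}" if "k \<in> - J" for k
      using component_le_norm_cart[of "x - p" k] d that by (simp add: p_def abs_le_iff)
    ultimately show "x \<in> cylinder J (unit_ball J)" by (simp add: cylinder_def)
  qed
  then have "measure lebesgue (cball p (1 / 2)) \<le> measure lebesgue (cylinder J (unit_ball J))"
    by (intro measure_mono_fmeasurable lmeasurable_compact compact_cylinder compact_unit_ball) auto
  moreover have "0 < measure lebesgue (cball p (1 / 2))"
    using content_cball_pos[of "1 / 2" p] by simp
  ultimately show ?thesis by linarith
qed

section \<open>Ellipsoids of minimal volume\<close>

lemma inner_coord_proj: "x \<in> coord_space J \<Longrightarrow> x \<bullet> coord_proj J y = x \<bullet> y"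
  unfolding inner_vec_def by (rule sum.cong) (auto simp: coord_space_def)

lemma linear_eq_axis:
  fixes f g :: "real^'n \<Rightarrow> real^'n"
  assumes "linear f" "linear g" "\<And>k. f (axis k 1) = g (axis k 1)"
  shows "f = g"
  using linear_eq_stdbasis[OF assms(1,2)] assms(3) by (auto simp: Basis_vec_def)

lemma block_ext_eq:
  assumes "linear f" "\<And>k. k \<notin> J \<Longrightarrow> f (axis k 1) = axis k 1"
  shows "block_ext J f = f"
proof (rule linear_eq_axis[OF linear_block_ext[OF assms(1)] assms(1)])
  fix k show "block_ext J f (axis k 1) = f (axis k 1)"
    using assms by (cases "k \<in> J") (simp_all add: block_ext_coord_space axis_in_coord_space block_ext_axis)
qed

lemma bij_betw_coord_space:
  assumes f: "linear f" "inj_on f (coord_space J)" "f ` coord_space J \<subseteq> coord_space J"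
  shows "bij_betw f (coord_space J) (coord_space J)"
proof -
  have span: "span (coord_space J) = coord_space J" using subspace_coord_space by (simp add: span_eq_iff)
  have "dim (f ` coord_space J) = dim (coord_space J)"
    using f(1,2) by (intro dim_image_eq) (simp_all only: span)
  then have "f ` coord_space J = coord_space J"
    using f by (intro subspace_dim_equal linear_subspace_image subspace_coord_space) simp_all
  then show ?thesis using f(2) by (simp add: bij_betw_def)
qed

text \<open>Inverting the extension gives a map that is linear on the whole type and again the
  identity off J, which is what \<open>block_ext J g = g\<close> records.\<close>

lemma block_ext_inverse:
  assumes T: "linear T" "bij_betw T (coord_space J) (coord_space J)"
  obtains g where "linear g" "\<And>x. g (block_ext J T x) = x" "\<And>x. block_ext J T (g x) = x"
    "bij_betw g (coord_space J) (coord_space J)" "block_ext J g = g"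
proof -
  have img: "T ` coord_space J = coord_space J" and inj: "inj_on T (coord_space J)"
    using T(2) by (simp_all add: bij_betw_def)
  have lin: "linear (block_ext J T)" by (rule linear_block_ext[OF T(1)])
  have "inj (block_ext J T)"
    unfolding linear_injective_0[OF lin]
  proof (intro allI impI)
    fix x assume x: "block_ext J T x = 0"
    let ?p = "coord_proj J x"
    have Tp: "T ?p \<in> coord_space J" using img coord_proj_in_coord_space by blast
    have comp: "T ?p $ k + (x - ?p) $ k = 0" for k using x by (simp add: block_ext_def vec_eq_iff)
    have "T ?p $ k = 0" for k
      using comp[of k] Tp by (cases "k \<in> J") (auto simp: coord_space_def)
    then have "T ?p = 0" by (simp add: vec_eq_iff)
    then have "?p = 0"
      using inj linear_0[OF T(1)] coord_proj_in_coord_space coord_space_zero by (metis inj_onD)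
    then show "x = 0" using x linear_0[OF T(1)] by (simp add: block_ext_def)
  qed
  then obtain g where g: "linear g" "\<And>x. g (block_ext J T x) = x" "\<And>x. block_ext J T (g x) = x"
    using linear_injective_isomorphism[OF lin] by blast
  have "g x \<in> coord_space J" if x: "x \<in> coord_space J" for x
  proof -
    obtain x' where x': "x' \<in> coord_space J" "x = T x'" using img x by blast
    then have "g x = x'" using g(2)[of x'] by (simp add: block_ext_coord_space)
    then show ?thesis using x' by simp
  qed
  moreover have "inj_on g (coord_space J)" using g(3) by (metis inj_onI)
  ultimately have "bij_betw g (coord_space J) (coord_space J)" by (intro bij_betw_coord_space g(1)) auto
  moreover have "block_ext J g = g"
  proof (rule block_ext_eq[OF g(1)])
    show "g (axis k 1) = axis k 1" if "k \<notin> J" for k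
      using g(2)[of "axis k 1"] block_ext_axis[OF T(1) that] by simp
  qed
  ultimately show ?thesis using that g by blast
qed

lemma det_block_ext_inverse:
  fixes f g :: "real^'n \<Rightarrow> real^'n"
  assumes "linear f" "linear g" "\<And>x. g (f x) = x"
  shows "det (matrix g) * det (matrix f) = 1"
proof -
  have "g \<circ> f = id" using assms(3) by auto
  then show ?thesis
    using matrix_compose[OF assms(1,2)] by (metis det_mul matrix_id)
qed

section \<open>John's theorem\<close>

definition min_ellipsoid :: "'k::finite set \<Rightarrow> (real^'k) set \<Rightarrow> (real^'k) set \<Rightarrow> bool" where
  "min_ellipsoid J K E \<longleftrightarrow> ellipsoid J E \<and> K \<subseteq> E \<and>
     (\<forall>E'. ellipsoid J E' \<and> K \<subseteq> E' \<longrightarrow> volume J E \<le> volume J E')"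

lemma Low_eq: "Low J K = (THE E. min_ellipsoid J K E)"
  by (simp add: Low_def min_ellipsoid_def)

lemma ellipsoid_linear_image:
  assumes "linear T" "bij_betw T (coord_space J) (coord_space J)"
  shows "ellipsoid J (T ` unit_ball J)"
  unfolding ellipsoid_def using assms by (intro exI[of _ T] exI[of _ 0]) (simp add: coord_space_zero)

lemma volume_linear_image:
  assumes "linear T" "T ` coord_space J \<subseteq> coord_space J"
  shows "volume J (T ` unit_ball J)
    = ennreal (\<bar>det (matrix (block_ext J T))\<bar> * measure lebesgue (cylinder J (unit_ball J)))"
  using volume_ellipsoid[OF assms coord_space_zero] by simp

lemma ennreal_mult_cylinder_le_iff:
  "ennreal (\<bar>a\<bar> * measure lebesgue (cylinder J (unit_ball J))) \<le> ennreal (\<bar>b\<bar> * measure lebesgue (cylinder J (unit_ball J)))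
    \<longleftrightarrow> \<bar>a\<bar> \<le> \<bar>b\<bar>"
  using measure_cylinder_unit_ball_pos[of J] by (simp add: ennreal_le_iff)

text \<open>In the coordinates of E' the map T0 becomes U and the centre becomes w, so U maps K into
  the unit ball about w. John's condition for the form |Uy|^2 bounds the Frobenius norm of U, and
  \<open>det_norm_bound\<close> turns this into a determinant of modulus at most 1. Equality makes U
  orthogonal and w zero.\<close>

lemma john_minimal:
  fixes J :: "'k::finite set"
  assumes J: "J \<noteq> {}" and K: "K \<subseteq> unit_ball J" "john J K" "\<And>x. x \<in> K \<Longrightarrow> - x \<in> K"
    and T0: "linear T0" "bij_betw T0 (coord_space J) (coord_space J)"
    and E': "ellipsoid J E'" "T0 ` K \<subseteq> E'"
  shows "volume J (T0 ` unit_ball J) \<le> volume J E'"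
    and "volume J E' \<le> volume J (T0 ` unit_ball J) \<Longrightarrow> E' = T0 ` unit_ball J"
proof -
  obtain T c where T: "linear T" "bij_betw T (coord_space J) (coord_space J)" and c: "c \<in> coord_space J"
    and E'_eq: "E' = (\<lambda>x. c + T x) ` unit_ball J"
    using E'(1) unfolding ellipsoid_def by blast
  obtain g where g: "linear g" "\<And>x. g (block_ext J T x) = x" "\<And>x. block_ext J T (g x) = x"
    "bij_betw g (coord_space J) (coord_space J)" "block_ext J g = g"
    using block_ext_inverse[OF T] by blast
  obtain g0 where g0: "linear g0" "\<And>x. g0 (block_ext J T0 x) = x" "\<And>x. block_ext J T0 (g0 x) = x"
    "bij_betw g0 (coord_space J) (coord_space J)" "block_ext J g0 = g0"
    using block_ext_inverse[OF T0] by blast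
  define U where "U = g \<circ> block_ext J T0"
  define w where "w = g c"
  have lin0: "linear (block_ext J T0)" by (rule linear_block_ext[OF T0(1)])
  have U: "linear U" unfolding U_def by (rule linear_compose[OF lin0 g(1)])
  have inv_T: "g (T b) = b" if "b \<in> coord_space J" for b
    using g(2)[of b] that by (simp add: block_ext_coord_space)
  have coord: "x \<in> coord_space J" if "x \<in> unit_ball J" for x using that by (simp add: unit_ball_def)
  have U_K: "norm (U y - w) \<le> 1" if y: "y \<in> K" for y
  proof -
    have "T0 y \<in> E'" using y E'(2) by blast
    then obtain b where b: "b \<in> unit_ball J" "T0 y = c + T b" unfolding E'_eq by blast
    have "U y = g (c + T b)" using coord[of y] y K(1) b(2) by (auto simp: U_def block_ext_coord_space)
    then have "U y - w = b" using linear_add[OF g(1)] inv_T coord[OF b(1)] by (simp add: w_def)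
    then show ?thesis using b(1) by (simp add: unit_ball_def)
  qed
  have quad: "y \<bullet> adjoint U (U y) \<le> 1 - (norm w)\<^sup>2" if y: "y \<in> K" for y
  proof -
    \<comment> \<open>Adding the inequalities for y and -y removes the cross term with w.\<close>
    have "(norm (U y - w))\<^sup>2 \<le> 1" "(norm (U (- y) - w))\<^sup>2 \<le> 1"
      using U_K[OF y] U_K[OF K(3)[OF y]] by (simp_all add: abs_square_le_1)
    then have "(norm (U y))\<^sup>2 + (norm w)\<^sup>2 \<le> 1"
      by (simp add: power2_norm_eq_inner linear_neg[OF U] inner_diff_left inner_diff_right
          inner_commute algebra_simps)
    then show ?thesis by (simp add: adjoint_works[OF U] power2_norm_eq_inner)
  qed
  have lin_quad: "linear (\<lambda>y. adjoint U (U y))"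
    using linear_compose[OF U adjoint_linear[OF U]] by (simp add: o_def)
  from johnD[OF K(2) lin_quad quad]
  have tr: "(\<Sum>k\<in>J. (norm (U (axis k 1)))\<^sup>2) \<le> real (card J) * (1 - (norm w)\<^sup>2)"
    by (simp add: adjoint_works[OF U] power2_norm_eq_inner)
  \<comment> \<open>Off J the map is the identity and adds \<open>card (- J)\<close> to the squared
    norm, which completes the bound to the dimension of the ambient type.\<close>
  have off: "U (axis k 1) = axis k 1" if "k \<notin> J" for k
    using block_ext_axis[OF T0(1) that] block_ext_axis[OF g(1) that] g(5) by (simp add: U_def)
  have norm_U: "(norm (matrix U))\<^sup>2 = (\<Sum>k\<in>J. (norm (U (axis k 1)))\<^sup>2) + real (card (- J))"
  proof -
    have "(norm (matrix U))\<^sup>2 = (\<Sum>k\<in>J. (norm (U (axis k 1)))\<^sup>2) + (\<Sum>k\<in>- J. (norm (U (axis k 1)))\<^sup>2)"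
      unfolding norm_matrix_columns[OF U] by (subst sum.union_disjoint[symmetric]) auto
    also have "(\<Sum>k\<in>- J. (norm (U (axis k 1)))\<^sup>2) = (\<Sum>k\<in>- J. 1)"
      by (rule sum.cong) (simp_all add: off norm_axis_1)
    finally show ?thesis by simp
  qed
  have card: "real (card J) + real (card (- J)) = real CARD('k)"
    using card_Un_disjoint[of J "- J"] by simp
  have "real (card J) * (1 - (norm w)\<^sup>2) \<le> real (card J) * 1" by (intro mult_left_mono) auto
  then have bound: "(norm (matrix U))\<^sup>2 \<le> real CARD('k)" using tr norm_U card by simp
  have det_U: "det (matrix U) = det (matrix g) * det (matrix (block_ext J T0))"
    unfolding U_def by (simp add: matrix_compose[OF lin0 g(1)] det_mul)
  have det_g: "\<bar>det (matrix g)\<bar> * \<bar>det (matrix (block_ext J T))\<bar> = 1"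
    using det_block_ext_inverse[OF linear_block_ext[OF T(1)] g(1,2)] by (simp flip: abs_mult)
  then have det_T: "\<bar>det (matrix (block_ext J T0))\<bar> = \<bar>det (matrix U)\<bar> * \<bar>det (matrix (block_ext J T))\<bar>"
    unfolding det_U abs_mult by (simp add: mult_ac)
  have img: "T ` coord_space J \<subseteq> coord_space J" "T0 ` coord_space J \<subseteq> coord_space J"
    using T(2) T0(2) by (simp_all add: bij_betw_def)
  have vol': "volume J E' = ennreal (\<bar>det (matrix (block_ext J T))\<bar> * measure lebesgue (cylinder J (unit_ball J)))"
    unfolding E'_eq by (rule volume_ellipsoid[OF T(1) img(1) c])
  note vol0 = volume_linear_image[OF T0(1) img(2)]
  have "\<bar>det (matrix (block_ext J T0))\<bar> \<le> \<bar>det (matrix (block_ext J T))\<bar>"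
    unfolding det_T using det_norm_bound(1)[OF bound] by (simp add: mult_left_le_one_le)
  then show "volume J (T0 ` unit_ball J) \<le> volume J E'"
    unfolding vol' vol0 ennreal_mult_cylinder_le_iff .
  assume "volume J E' \<le> volume J (T0 ` unit_ball J)"
  then have "\<bar>det (matrix (block_ext J T))\<bar> \<le> \<bar>det (matrix (block_ext J T0))\<bar>"
    unfolding vol' vol0 ennreal_mult_cylinder_le_iff .
  then have "\<bar>det (matrix (block_ext J T))\<bar> \<le> \<bar>det (matrix U)\<bar> * \<bar>det (matrix (block_ext J T))\<bar>"
    unfolding det_T .
  moreover have "0 < \<bar>det (matrix (block_ext J T))\<bar>" using det_g by (metis abs_ge_zero less_eq_real_def mult_zero_right zero_neq_one)
  ultimately have "1 \<le> \<bar>det (matrix U)\<bar>" by simp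
  then have "\<bar>det (matrix U)\<bar> = 1" using det_norm_bound(1)[OF bound] by simp
  then have "orthogonal_matrix (matrix U)" by (rule det_norm_bound(2)[OF bound])
  then have ot: "orthogonal_transformation U" using U by (simp add: orthogonal_transformation_matrix)
  have iso: "norm (U x) = norm x" for x using orthogonal_transformation_norm[OF ot] .
  \<comment> \<open>For an isometry the left side of the trace inequality is \<open>card J\<close>
    exactly, which leaves no room for w.\<close>
  have "real (card J) \<le> real (card J) * (1 - (norm w)\<^sup>2)" using tr by (simp add: iso norm_axis_1)
  moreover have "0 < real (card J)" using J by (simp add: card_gt_0_iff)
  ultimately have "(norm w)\<^sup>2 \<le> 0" by (simp add: mult_le_cancel_left1)
  then have "w = 0" by simp
  then have c0: "c = 0" using g(3)[of c] linear_0[OF linear_block_ext[OF T(1)]] by (simp add: w_def)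
  have gb: "g x \<in> coord_space J" if "x \<in> coord_space J" for x using g(4) that by (auto simp: bij_betw_def)
  have g0b: "g0 x \<in> coord_space J" if "x \<in> coord_space J" for x using g0(4) that by (auto simp: bij_betw_def)
  show "E' = T0 ` unit_ball J"
  proof (intro set_eqI iffI)
    fix x assume "x \<in> E'"
    then obtain b where b: "b \<in> unit_ball J" "x = T b" unfolding E'_eq c0 by auto
    have x: "x \<in> coord_space J" using b coord img by blast
    have "T0 (g0 x) = x" using g0(3)[of x] g0b[OF x] by (simp add: block_ext_coord_space)
    moreover have "U (g0 x) = b" unfolding U_def using g0(3)[of x] inv_T coord[OF b(1)] b(2) by simp
    then have "norm (g0 x) \<le> 1" using iso[of "g0 x"] b(1) by (simp add: unit_ball_def)
    then have "g0 x \<in> unit_ball J" using g0b[OF x] by (simp add: unit_ball_def)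
    ultimately show "x \<in> T0 ` unit_ball J" by (metis imageI)
  next
    fix x assume "x \<in> T0 ` unit_ball J"
    then obtain b where b: "b \<in> unit_ball J" "x = T0 b" by blast
    have x: "x \<in> coord_space J" using b coord img by blast
    have "T (g x) = x" using g(3)[of x] gb[OF x] by (simp add: block_ext_coord_space)
    moreover have "g x = U b" unfolding U_def using coord[OF b(1)] b(2) by (simp add: block_ext_coord_space)
    then have "g x \<in> unit_ball J" using iso[of b] b(1) gb[OF x] by (simp add: unit_ball_def)
    ultimately show "x \<in> E'" unfolding E'_eq c0 by force
  qed
qed

lemma det_block_ext_scaleR: "det (matrix (block_ext J ((*\<^sub>R) c) :: real^'k::finite \<Rightarrow> real^'k)) = c ^ card J"
proof -
  have entry: "matrix (block_ext J ((*\<^sub>R) c)) $ i $ j = (if i = j then if i \<in> J then c else 1 else 0)" for i j :: 'k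
    by (simp add: matrix_def block_ext_def axis_def)
  have "det (matrix (block_ext J ((*\<^sub>R) c) :: real^'k \<Rightarrow> real^'k)) = (\<Prod>i\<in>UNIV. if i \<in> J then c else 1)"
    by (subst det_diagonal) (simp_all add: entry)
  also have "\<dots> = (\<Prod>i\<in>J. c)" by (intro prod.mono_neutral_cong_right) auto
  finally show ?thesis by simp
qed

text \<open>
  First-order optimality: perturbing the identity in direction \<open>t G\<close> and rescaling back into the unit ball
  cannot increase the determinant, and the derivative at \<open>t = 0\<close> is John's condition.
\<close>

lemma john_if_det_maximal:
  fixes J :: "'k::finite set"
  assumes K: "K \<subseteq> unit_ball J"
    and max: "\<And>f. linear f \<Longrightarrow> f ` coord_space J \<subseteq> coord_space J \<Longrightarrow> f ` K \<subseteq> unit_ball J \<Longrightarrow>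
      \<bar>det (matrix (block_ext J f))\<bar> \<le> 1"
  shows "john J K"
  unfolding john_def
proof (intro allI impI, rule ccontr)
  fix h :: "real^'k \<Rightarrow> real^'k" and M
  let ?n = "card J"
  let ?tr = "\<Sum>k\<in>J. axis k 1 \<bullet> h (axis k 1)"
  assume h: "linear h \<and> (\<forall>x\<in>K. x \<bullet> h x \<le> M)" and "\<not> ?tr \<le> real ?n * M"
  then have gt: "?tr > real ?n * M" by simp
  \<comment> \<open>The compression of h to \<open>coord_space J\<close>: the same form there and
    the same partial trace, now as the full trace of a matrix.\<close>
  define G where "G x = coord_proj J (h (coord_proj J x))" for x
  have G: "linear G"
    unfolding G_def using h
    by (intro linear_compose[OF linear_compose[OF linear_coord_proj] linear_coord_proj, unfolded o_def]) simp
  obtain C where C: "0 < C" "\<And>x. norm (G x) \<le> C * norm x" using linear_bounded_pos[OF G] by blast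
  have "(\<Sum>k\<in>UNIV. matrix G $ k $ k) = (\<Sum>k\<in>UNIV. if k \<in> J then axis k 1 \<bullet> h (axis k 1) else 0)"
  proof (rule sum.cong)
    fix k
    have "coord_proj J (axis k 1) = axis k (1::real)" if "k \<in> J"
      using that by (intro coord_proj_id axis_in_coord_space)
    then show "matrix G $ k $ k = (if k \<in> J then axis k 1 \<bullet> h (axis k 1) else 0)"
      by (simp add: matrix_def G_def inner_axis')
  qed simp
  also have "\<dots> = ?tr" by (intro sum.mono_neutral_cong_right) auto
  finally have trace: "(\<Sum>k\<in>UNIV. matrix G $ k $ k) = ?tr" .
  \<comment> \<open>An upper bound for |x + tGx|^2 over x in K, using |x| <= 1, the bound M on the
    form and |Gx| <= C.\<close>
  define \<beta> where "\<beta> t = 1 + 2 * t * M + t\<^sup>2 * C\<^sup>2" for t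
  \<comment> \<open>Squaring avoids the modulus and the square root. \<phi> vanishes at 0 with
    derivative 2(tr - nM), positive if the condition fails, while maximality makes \<phi>
    nonpositive for small t > 0.\<close>
  define \<phi> where "\<phi> t = (det (mat 1 + t *\<^sub>R matrix G))\<^sup>2 - \<beta> t ^ ?n" for t
  have "(\<phi> has_real_derivative 2 * ?tr - real ?n * (2 * M)) (at 0)"
  proof -
    have d1: "((\<lambda>t. (det (mat 1 + t *\<^sub>R matrix G))\<^sup>2) has_real_derivative 2 * ?tr) (at 0)"
      using DERIV_power[OF has_real_derivative_det_at_mat_1[of "matrix G"], of 2] trace by simp
    have "(\<beta> has_real_derivative 2 * M) (at 0)"
      unfolding \<beta>_def by (auto intro!: derivative_eq_intros)
    then have d2: "((\<lambda>t. \<beta> t ^ ?n) has_real_derivative real ?n * (2 * M)) (at 0)"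
      using DERIV_power[of \<beta> "2 * M" 0 UNIV ?n] by (simp add: \<beta>_def)
    show ?thesis unfolding \<phi>_def by (rule DERIV_diff[OF d1 d2])
  qed
  moreover have "0 < 2 * ?tr - real ?n * (2 * M)" using gt by simp
  ultimately obtain d where d: "0 < d" "\<And>t. 0 < t \<Longrightarrow> t < d \<Longrightarrow> \<phi> 0 < \<phi> (0 + t)"
    using DERIV_pos_inc_right by blast
  \<comment> \<open>The second bound keeps \<beta> t positive when M is negative, so that its square
    root can be divided by.\<close>
  define t where "t = min (d / 2) (1 / (2 * \<bar>M\<bar> + 2))"
  have t: "0 < t" "t < d" using d(1) by (auto simp: t_def)
  have "t * (2 * \<bar>M\<bar> + 2) \<le> 1"
  proof (rule pos_le_divide_eq[THEN iffD1])
    show "0 < 2 * \<bar>M\<bar> + 2" by linarith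
    show "t \<le> 1 / (2 * \<bar>M\<bar> + 2)" by (simp add: t_def)
  qed
  moreover have "- (2 * t * M) \<le> t * (2 * \<bar>M\<bar>)"
    using mult_left_mono[OF abs_ge_minus_self[of M], of t] t(1) by (simp add: mult.commute)
  moreover have "0 \<le> t\<^sup>2 * C\<^sup>2" by simp
  ultimately have \<beta>: "0 < \<beta> t" using t(1) unfolding \<beta>_def distrib_left by linarith
  define b where "b = sqrt (\<beta> t)"
  have b: "0 < b" "b\<^sup>2 = \<beta> t" using \<beta> by (simp_all add: b_def)
  define f where "f x = (1 / b) *\<^sub>R (x + t *\<^sub>R G x)" for x
  have f: "linear f"
    unfolding f_def by (rule linearI) (simp_all add: linear_add[OF G] linear_cmul[OF G] algebra_simps)
  have f_coord: "f x \<in> coord_space J" if "x \<in> coord_space J" for x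
    using that unfolding f_def G_def by (intro coord_space_scale coord_space_add coord_proj_in_coord_space)
  have f_K: "f x \<in> unit_ball J" if x: "x \<in> K" for x
  proof -
    have xB: "norm x \<le> 1" "x \<in> coord_space J" using x K by (auto simp: unit_ball_def)
    have "x \<bullet> G x \<le> M"
      using h x xB(2) by (simp add: G_def inner_coord_proj coord_proj_id)
    then have le1: "2 * t * (x \<bullet> G x) \<le> 2 * t * M" using t(1) by simp
    have "C * norm x \<le> C" using C(1) xB(1) by (intro mult_left_le) auto
    then have "norm (G x) \<le> C" using C(2)[of x] by linarith
    then have "(norm (G x))\<^sup>2 \<le> C\<^sup>2" by (simp add: power_mono)
    then have le2: "t\<^sup>2 * (norm (G x))\<^sup>2 \<le> t\<^sup>2 * C\<^sup>2" by (simp add: mult_left_mono)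
    have le3: "(norm x)\<^sup>2 \<le> 1" using xB(1) by (simp add: abs_square_le_1)
    have "(norm (x + t *\<^sub>R G x))\<^sup>2 = (norm x)\<^sup>2 + 2 * t * (x \<bullet> G x) + t\<^sup>2 * (norm (G x))\<^sup>2"
      by (simp only: power2_norm_eq_inner)
        (simp add: inner_add_left inner_add_right inner_commute power2_eq_square algebra_simps)
    also have "\<dots> \<le> b\<^sup>2" using le1 le2 le3 unfolding b(2) \<beta>_def by linarith
    finally have "norm (x + t *\<^sub>R G x) \<le> b" by (rule power2_le_imp_le) (use b(1) in simp)
    then have "norm (f x) \<le> 1" using b(1) by (simp add: f_def)
    then show ?thesis using f_coord[OF xB(2)] by (simp add: unit_ball_def)
  qed
  have "block_ext J f = block_ext J ((*\<^sub>R) (1 / b)) \<circ> (\<lambda>x. x + t *\<^sub>R G x)"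
  proof
    fix x
    let ?p = "coord_proj J x"
    have pp: "coord_proj J ?p = ?p" by (rule coord_proj_id[OF coord_proj_in_coord_space])
    have Gp: "G ?p = G x" by (simp add: G_def pp)
    have pG: "coord_proj J (x + t *\<^sub>R G x) = ?p + t *\<^sub>R G x"
      by (simp add: linear_add[OF linear_coord_proj] linear_cmul[OF linear_coord_proj] G_def
          coord_proj_id[OF coord_proj_in_coord_space])
    show "block_ext J f x = (block_ext J ((*\<^sub>R) (1 / b)) \<circ> (\<lambda>x. x + t *\<^sub>R G x)) x"
      by (simp add: block_ext_def f_def Gp pG)
  qed
  moreover have lin: "linear (\<lambda>x. x + t *\<^sub>R G x)"
    by (rule linearI) (simp_all add: linear_add[OF G] linear_cmul[OF G] algebra_simps)
  moreover have "matrix (\<lambda>x. x + t *\<^sub>R G x) = mat 1 + t *\<^sub>R matrix G"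
    by (simp add: vec_eq_iff matrix_def mat_def axis_def)
  moreover have "linear (block_ext J ((*\<^sub>R) (1 / b)))" by (intro linear_block_ext linear_scaleR)
  ultimately have det_f: "det (matrix (block_ext J f)) = (1 / b) ^ ?n * det (mat 1 + t *\<^sub>R matrix G)"
    by (simp only: matrix_compose det_mul det_block_ext_scaleR)
  have "\<bar>det (matrix (block_ext J f))\<bar> \<le> 1" using f f_coord f_K by (intro max) auto
  then have "\<bar>det (mat 1 + t *\<^sub>R matrix G)\<bar> \<le> b ^ ?n"
    using b(1) unfolding det_f by (simp add: abs_mult power_one_over field_simps)
  then have "\<bar>det (mat 1 + t *\<^sub>R matrix G)\<bar>\<^sup>2 \<le> (b ^ ?n)\<^sup>2" by (intro power_mono) auto
  also have "(b ^ ?n)\<^sup>2 = \<beta> t ^ ?n" unfolding b(2)[symmetric] by (simp add: power_mult[symmetric] mult.commute)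
  finally have "\<phi> t \<le> 0" by (simp add: \<phi>_def)
  moreover have "\<phi> 0 = 0" by (simp add: \<phi>_def \<beta>_def)
  ultimately show False using d(2)[OF t] by simp
qed

text \<open>S maximizes the determinant among linear maps of K into the unit ball; its inverse image
  of the ball is the Loewner ellipsoid of K. A further map f gives the competitor f o S, so f cannot
  increase the determinant and \<open>john_if_det_maximal\<close> applies to S K.\<close>

lemma john_position_exists:
  fixes J :: "'k::finite set"
  assumes K: "K \<in> sym_convex_bodies J"
  obtains S where "linear S" "bij_betw S (coord_space J) (coord_space J)" "S ` K \<subseteq> unit_ball J" "john J (S ` K)"
proof -
  note KD = sym_convex_bodiesD[OF K]
  obtain m where m: "0 < m" "cball 0 m \<inter> coord_space J \<subseteq> K" by (rule sym_convex_bodies_inner_ball[OF K])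
  obtain R where R: "0 < R" "\<forall>x\<in>K. norm x \<le> R" by (rule sym_convex_bodies_outer_ball[OF K])
  \<comment> \<open>Fixing the coordinate vectors off J makes the set bounded and ties the ambient
    determinant to the one on \<open>coord_space J\<close>. On J the columns are bounded because K
    contains a ball.\<close>
  define \<A> :: "(real^'k^'k) set" where
    "\<A> = {A. (\<forall>x\<in>K. A *v x \<in> unit_ball J) \<and> (\<forall>k\<in>- J. A *v axis k 1 = axis k 1)}"
  have cont: "continuous_on UNIV (\<lambda>A :: real^'k^'k. A *v x)" for x
    by (intro linear_continuous_on linear_conv_bounded_linear[THEN iffD1] linearI)
      (simp_all add: matrix_vector_mult_add_rdistrib scaleR_matrix_vector_assoc)
  have "\<A> = (\<Inter>x\<in>K. (\<lambda>A. A *v x) -` unit_ball J) \<inter> (\<Inter>k\<in>- J. (\<lambda>A. A *v axis k 1) -` {axis k 1})"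
    by (auto simp: \<A>_def)
  also have "closed \<dots>"
    by (intro closed_Int closed_INT ballI closed_vimage cont closed_singleton
        compact_imp_closed[OF compact_unit_ball])
  finally have "closed \<A>" .
  moreover have "(norm A)\<^sup>2 \<le> real CARD('k) * (1 / m\<^sup>2 + 1)" if A: "A \<in> \<A>" for A
  proof -
    have "(norm A)\<^sup>2 = (\<Sum>k\<in>UNIV. (norm (A *v axis k 1))\<^sup>2)"
      using norm_matrix_columns[of "(*v) A"] by simp
    also have "\<dots> \<le> (\<Sum>k\<in>(UNIV :: 'k set). 1 / m\<^sup>2 + 1)"
    proof (rule sum_mono)
      fix k
      show "(norm (A *v axis k 1))\<^sup>2 \<le> 1 / m\<^sup>2 + 1"
      proof (cases "k \<in> J")
        case True
        have "m *\<^sub>R axis k 1 \<in> K"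
          using m(1) True by (intro subsetD[OF m(2)]) (simp add: norm_axis_1 coord_space_scale axis_in_coord_space)
        then have "A *v (m *\<^sub>R axis k 1) \<in> unit_ball J" using A by (simp add: \<A>_def)
        then have "m * norm (A *v axis k 1) \<le> 1"
          using m(1) by (simp add: unit_ball_def matrix_vector_mult_scaleR)
        then have "norm (A *v axis k 1) \<le> 1 / m" using m(1) by (simp add: field_simps)
        then have "(norm (A *v axis k 1))\<^sup>2 \<le> (1 / m)\<^sup>2" by (intro power_mono) auto
        then show ?thesis by (simp add: power_one_over)
      next
        case False
        then show ?thesis using A by (simp add: \<A>_def norm_axis_1)
      qed
    qed
    finally show ?thesis by simp
  qed
  then have "norm A \<le> sqrt (real CARD('k) * (1 / m\<^sup>2 + 1))" if "A \<in> \<A>" for A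
    using that by (simp add: real_le_rsqrt)
  ultimately have cp: "compact \<A>" by (auto simp: compact_eq_bounded_closed bounded_iff)
  \<comment> \<open>The dilation by 1/R is a competitor with nonzero determinant, so the maximizer
    is invertible.\<close>
  define A0 where "A0 = matrix (block_ext J ((*\<^sub>R) (1 / R)) :: real^'k \<Rightarrow> real^'k)"
  have works: "matrix f *v x = f x" if "linear f" for f :: "real^'k \<Rightarrow> real^'k" and x
    using matrix_works[of f x] that by (simp add: linear_matrix_vector_mul_eq)
  have lin0: "linear (block_ext J ((*\<^sub>R) (1 / R)))" by (intro linear_block_ext linear_scaleR)
  have "A0 \<in> \<A>"
    unfolding \<A>_def A0_def
    using R KD(1) block_ext_axis[of "(*\<^sub>R) (1 / R)"]
    by (auto simp: works[OF lin0] block_ext_coord_space unit_ball_def coord_space_scale subset_iff linear_scaleR)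
  moreover have "continuous_on \<A> (\<lambda>A. \<bar>det A\<bar>)" by (intro continuous_intros continuous_on_det)
  ultimately obtain A where A: "A \<in> \<A>" "\<forall>B\<in>\<A>. \<bar>det B\<bar> \<le> \<bar>det A\<bar>"
    using continuous_attains_sup[OF cp] by (metis empty_iff)
  have "0 < \<bar>det A0\<bar>" using R(1) by (simp add: A0_def det_block_ext_scaleR)
  then have det_A: "0 < \<bar>det A\<bar>" using A(2) \<open>A0 \<in> \<A>\<close> by fastforce
  define S where "S = (*v) A"
  have S: "linear S" by (simp add: S_def)
  have matrix_S: "matrix S = A" by (simp add: S_def)
  have S_K: "S ` K \<subseteq> unit_ball J" using A(1) by (auto simp: \<A>_def S_def)
  have "S x \<in> coord_space J" if x: "x \<in> coord_space J" for x
  proof (cases "x = 0")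
    case True then show ?thesis using linear_0[OF S] by (simp add: coord_space_zero)
  next
    case False
    have "(m / norm x) *\<^sub>R x \<in> K" using m(1) x False by (intro subsetD[OF m(2)]) (simp add: coord_space_scale)
    then have "S ((m / norm x) *\<^sub>R x) \<in> coord_space J" using S_K unit_ball_subset by blast
    then show ?thesis using m(1) False by (simp add: linear_cmul[OF S] coord_space_scale_iff)
  qed
  then have S_coord: "S ` coord_space J \<subseteq> coord_space J" by blast
  have "inj S" using det_nz_iff_inj[OF S] det_A by (simp add: matrix_S)
  then have bij: "bij_betw S (coord_space J) (coord_space J)"
    by (intro bij_betw_coord_space S S_coord) (auto intro: inj_on_subset)
  have ext_S: "block_ext J S = S" using A(1) by (intro block_ext_eq S) (auto simp: \<A>_def S_def)
  have "john J (S ` K)"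
  proof (rule john_if_det_maximal[OF S_K])
    fix f assume f: "linear f" "f ` coord_space J \<subseteq> coord_space J" "f ` S ` K \<subseteq> unit_ball J"
    have lin: "linear (f \<circ> S)" by (rule linear_compose[OF S f(1)])
    have "matrix (block_ext J (f \<circ> S)) \<in> \<A>"
      unfolding \<A>_def
      using f(3) KD(1) block_ext_axis[OF lin] by (auto simp: works[OF linear_block_ext[OF lin]] block_ext_coord_space subset_iff)
    then have "\<bar>det (matrix (block_ext J (f \<circ> S)))\<bar> \<le> \<bar>det A\<bar>" using A(2) by blast
    also have "det (matrix (block_ext J (f \<circ> S))) = det (matrix (block_ext J f)) * det A"
      unfolding block_ext_compose[OF f(1) S S_coord] ext_S
      by (simp add: matrix_compose[OF S linear_block_ext[OF f(1)]] det_mul matrix_S)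
    finally show "\<bar>det (matrix (block_ext J f))\<bar> \<le> 1" using det_A by (simp add: abs_mult)
  qed
  then show ?thesis using that[OF S bij S_K] by blast
qed

lemma min_ellipsoid_john:
  assumes J: "J \<noteq> {}" and K: "K \<subseteq> unit_ball J" "john J K" "\<And>x. x \<in> K \<Longrightarrow> - x \<in> K"
    and T: "linear T" "bij_betw T (coord_space J) (coord_space J)"
  shows "min_ellipsoid J (T ` K) E \<longleftrightarrow> E = T ` unit_ball J"
proof -
  have min: "min_ellipsoid J (T ` K) (T ` unit_ball J)"
    unfolding min_ellipsoid_def
    using ellipsoid_linear_image[OF T] john_minimal(1)[OF J K T] K(1) by blast
  show ?thesis
  proof
    assume E: "min_ellipsoid J (T ` K) E"
    then have "volume J E \<le> volume J (T ` unit_ball J)" using min unfolding min_ellipsoid_def by blast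
    moreover have "ellipsoid J E" "T ` K \<subseteq> E" using E unfolding min_ellipsoid_def by blast+
    ultimately show "E = T ` unit_ball J" by (intro john_minimal(2)[OF J K T])
  qed (use min in simp)
qed

text \<open>\<open>Low\<close> is a definite description, so an equation for it is informative only
  once existence and uniqueness are known; these come from a John position S of K, pulled back by
  its inverse g. Minimality of the unit ball then bounds the determinant of every f taking K into
  the ball, because the preimage of the ball under an invertible f is an ellipsoid containing
  K.\<close>

lemma Low_eq_unit_ball_iff:
  fixes J :: "'k::finite set"
  assumes J: "J \<noteq> {}" and K: "K \<in> sym_convex_bodies J"
  shows "Low J K = unit_ball J \<longleftrightarrow> K \<subseteq> unit_ball J \<and> john J K"
proof
  assume "K \<subseteq> unit_ball J \<and> john J K"
  then have "min_ellipsoid J (id ` K) E \<longleftrightarrow> E = id ` unit_ball J" for E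
    using sym_convex_bodiesD(4)[OF K] by (intro min_ellipsoid_john J linear_id bij_betw_id) auto
  then show "Low J K = unit_ball J" by (simp add: Low_eq)
next
  assume Low: "Low J K = unit_ball J"
  obtain S where S: "linear S" "bij_betw S (coord_space J) (coord_space J)" "S ` K \<subseteq> unit_ball J" "john J (S ` K)"
    using john_position_exists[OF K] by blast
  obtain g where g: "linear g" "\<And>x. g (block_ext J S x) = x" "bij_betw g (coord_space J) (coord_space J)"
    using block_ext_inverse[OF S(1,2)] by metis
  have "g (S x) = x" if "x \<in> K" for x
    using g(2)[of x] sym_convex_bodiesD(1)[OF K] that by (auto simp: block_ext_coord_space)
  then have gS: "g ` S ` K = K" by (force simp: image_image)
  have minus: "- y \<in> S ` K" if "y \<in> S ` K" for y
  proof -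
    obtain x where x: "x \<in> K" "y = S x" using \<open>y \<in> S ` K\<close> by blast
    have "- y = S (- x)" using x(2) linear_neg[OF S(1)] by simp
    then show ?thesis using sym_convex_bodiesD(4)[OF K x(1)] by blast
  qed
  have "min_ellipsoid J K E \<longleftrightarrow> E = g ` unit_ball J" for E
    using min_ellipsoid_john[OF J S(3,4) minus g(1,3)] unfolding gS .
  \<comment> \<open>The equivalence for all E gives unique existence, so the description satisfies
    its defining property.\<close>
  then have "min_ellipsoid J K (Low J K)" by (simp add: Low_eq)
  then have min: "min_ellipsoid J K (unit_ball J)" by (simp add: Low)
  then have KB: "K \<subseteq> unit_ball J" by (simp add: min_ellipsoid_def)
  moreover have "john J K"
  proof (rule john_if_det_maximal[OF KB])
    fix f assume f: "linear f" "f ` coord_space J \<subseteq> coord_space J" "f ` K \<subseteq> unit_ball J"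
    have lin: "linear (block_ext J f)" by (rule linear_block_ext[OF f(1)])
    show "\<bar>det (matrix (block_ext J f))\<bar> \<le> 1"
    proof (cases "det (matrix (block_ext J f)) = 0")
      case False
      then have "inj (block_ext J f)" using det_nz_iff_inj[OF lin] by simp
      then have "inj_on f (coord_space J)"
        by (metis block_ext_coord_space inj_onD inj_onI iso_tuple_UNIV_I)
      then have bij: "bij_betw f (coord_space J) (coord_space J)" by (intro bij_betw_coord_space f)
      obtain h where h: "linear h" "\<And>x. h (block_ext J f x) = x" "bij_betw h (coord_space J) (coord_space J)"
        "block_ext J h = h"
        using block_ext_inverse[OF f(1) bij] by metis
      have "h (f x) = x" if "x \<in> K" for x
        using h(2)[of x] sym_convex_bodiesD(1)[OF K] that by (auto simp: block_ext_coord_space)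
      then have "K \<subseteq> h ` unit_ball J" using f(3) by (metis image_subset_iff imageI subsetI)
      then have "volume J (id ` unit_ball J) \<le> volume J (h ` unit_ball J)"
        using min ellipsoid_linear_image[OF h(1,3)] by (simp add: min_ellipsoid_def)
      moreover have "h ` coord_space J \<subseteq> coord_space J" using h(3) by (simp add: bij_betw_def)
      ultimately have "\<bar>det (matrix (id :: real^'k \<Rightarrow> real^'k))\<bar> \<le> \<bar>det (matrix h)\<bar>"
        using volume_linear_image[OF linear_id, of J] volume_linear_image[OF h(1), of J]
        by (simp only: block_ext_id h(4) ennreal_mult_cylinder_le_iff image_id id_apply subset_refl)
      then have "1 \<le> \<bar>det (matrix h)\<bar>" by simp
      moreover have "\<bar>det (matrix h)\<bar> * \<bar>det (matrix (block_ext J f))\<bar> = 1"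
        using det_block_ext_inverse[OF lin h(1,2)] by (simp flip: abs_mult)
      ultimately show ?thesis
        using mult_right_mono[of 1 "\<bar>det (matrix h)\<bar>" "\<bar>det (matrix (block_ext J f))\<bar>"] by simp
    qed simp
  qed
  ultimately show "K \<subseteq> unit_ball J \<and> john J K" by blast
qed

section \<open>Bodies in Loewner position\<close>

lemma multi_indices_nonempty: "(\<And>i. I i \<noteq> {}) \<Longrightarrow> multi_indices I \<noteq> {}"
  by (simp add: multi_indices_eq_PiE PiE_eq_empty_iff)

lemma convex_unit_ball: "convex (unit_ball J)"
  by (simp add: unit_ball_def convex_Int convex_coord_space)

lemma proj_tensor_subset_unit_ball:
  assumes D: "\<And>i. D i \<subseteq> unit_ball (I i)"
  shows "proj_tensor D \<subseteq> unit_ball (multi_indices I)"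
  unfolding proj_tensor_eq
proof (rule hull_minimal)
  show "convex (unit_ball (multi_indices I))" by (rule convex_unit_ball)
  show "tensors D \<subseteq> unit_ball (multi_indices I)"
  proof
    fix T assume "T \<in> tensors D"
    then obtain x where x: "T = tensor x" "\<And>i. x i \<in> D i" unfolding tensors_def by blast
    have xB: "norm (x i) \<le> 1" "x i \<in> coord_space (I i)" for i
      using x(2)[of i] D[of i] by (auto simp: unit_ball_def)
    have "norm T \<le> 1" unfolding x(1) norm_tensor using xB(1) by (intro prod_le_1) auto
    moreover have "T \<in> coord_space (multi_indices I)" unfolding x(1) by (intro tensor_in_coord_space xB(2))
    ultimately show "T \<in> unit_ball (multi_indices I)" by (simp add: unit_ball_def)
  qed
qed

lemma Low_proj_tensor:
  assumes I: "\<And>i. I i \<noteq> {}" and D: "\<And>i. D i \<in> sym_convex_bodies (I i)"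
    and john: "\<And>i. john (I i) (D i)" and ball: "\<And>i. D i \<subseteq> unit_ball (I i)"
  shows "Low (multi_indices I) (proj_tensor D) = unit_ball (multi_indices I)"
  unfolding Low_eq_unit_ball_iff[OF multi_indices_nonempty[of I, OF I] proj_tensor_sym_convex_bodies[of D I, OF D]]
proof
  show "proj_tensor D \<subseteq> unit_ball (multi_indices I)" by (rule proj_tensor_subset_unit_ball[OF ball])
  show "john (multi_indices I) (proj_tensor D)"
    unfolding proj_tensor_eq by (rule john_mono[OF john_tensors[of I D, OF john] hull_subset])
qed

text \<open>The factors are normalised by their outer radii R_i. The tensor of longest vectors lies
  in the unit ball, so the product of the R_i is at most 1; \<open>john_norm_bound\<close> gives at
  least 1. Dividing by the R_i therefore changes neither tensor product, and John's condition
  descends to the factors.\<close>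

lemma lowner_body_factors:
  assumes I: "\<And>i. I i \<noteq> {}" and P: "P \<in> lowner_bodies I"
  obtains D where "\<And>i. D i \<in> sym_convex_bodies (I i)" "\<And>i. john (I i) (D i)" "\<And>i. D i \<subseteq> unit_ball (I i)"
    "proj_tensor D \<subseteq> P" "P \<subseteq> inj_tensor I D"
proof -
  have "P \<in> tensorial_bodies I" using P by (simp add: lowner_bodies_def)
  then obtain Q where Q: "\<And>i. Q i \<in> sym_convex_bodies (I i)" and QP: "proj_tensor Q \<subseteq> P" "P \<subseteq> inj_tensor I Q"
    unfolding tensorial_bodies_def by blast
  have "Low (multi_indices I) (proj_tensor Q) = unit_ball (multi_indices I)"
    using P conv_tensor_eq_proj_tensor[of Q I P, OF Q QP] by (simp add: lowner_bodies_def low_tensor_def)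
  then have ball: "proj_tensor Q \<subseteq> unit_ball (multi_indices I)" and john: "john (multi_indices I) (proj_tensor Q)"
    unfolding Low_eq_unit_ball_iff[OF multi_indices_nonempty[of I, OF I] proj_tensor_sym_convex_bodies[of Q I, OF Q]]
    by blast+
  have "\<exists>q. q \<in> Q i \<and> 0 < norm q \<and> (\<forall>x\<in>Q i. norm x \<le> norm q)" for i
  proof -
    have "Q i \<noteq> {}" using sym_convex_bodies_zero[OF Q] by blast
    then obtain q where q: "q \<in> Q i" "\<forall>x\<in>Q i. norm x \<le> norm q"
      using continuous_attains_sup[OF sym_convex_bodiesD(2)[OF Q], of i norm] continuous_on_norm_id by blast
    obtain m where m: "0 < m" "cball 0 m \<inter> coord_space (I i) \<subseteq> Q i"
      by (rule sym_convex_bodies_inner_ball[OF Q])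
    have "m *\<^sub>R base_vec (I i) \<in> Q i"
      using m(1) by (intro subsetD[OF m(2)]) (simp add: norm_base_vec coord_space_scale base_vec_in_coord_space I)
    then have "norm (m *\<^sub>R base_vec (I i)) \<le> norm q" using q(2) by blast
    then have "0 < norm q" using m(1) by (simp add: norm_base_vec del: zero_less_norm_iff)
    then show ?thesis using q by blast
  qed
  then obtain q where q: "\<And>i. q i \<in> Q i" "\<And>i. 0 < norm (q i)" "\<And>i x. x \<in> Q i \<Longrightarrow> norm x \<le> norm (q i)"
    by metis
  define R where "R i = norm (q i)" for i
  have R: "0 < R i" "x \<in> Q i \<Longrightarrow> norm x \<le> R i" for i x using q by (simp_all add: R_def)
  have "tensor q \<in> unit_ball (multi_indices I)" using ball tensor_in_proj_tensor[of q Q, OF q(1)] by blast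
  then have le: "(\<Prod>i\<in>UNIV. R i) \<le> 1" by (simp add: unit_ball_def norm_tensor R_def)
  have "1 \<le> (\<Prod>i\<in>UNIV. R i)"
  proof (rule john_norm_bound[OF john multi_indices_nonempty[of I, OF I]])
    have "tensors Q \<subseteq> cball 0 (\<Prod>i\<in>UNIV. R i)"
      unfolding tensors_def using R(2) by (auto simp: norm_tensor intro!: prod_mono)
    then have "proj_tensor Q \<subseteq> cball 0 (\<Prod>i\<in>UNIV. R i)"
      unfolding proj_tensor_eq by (intro hull_minimal) auto
    then show "norm x \<le> (\<Prod>i\<in>UNIV. R i)" if "x \<in> proj_tensor Q" for x using that by auto
    show "0 \<le> (\<Prod>i\<in>UNIV. R i)" by (intro prod_nonneg) (simp add: R_def)
  qed
  with le have "(\<Prod>i\<in>UNIV. R i) = 1" by (rule order_antisym)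
  then have prod: "(\<Prod>i\<in>UNIV. 1 / R i) = 1" by (simp only: prod_dividef) simp
  define D where "D = (\<lambda>i. (*\<^sub>R) (1 / R i) ` Q i)"
  have pos: "0 < 1 / R i" for i using R(1) by simp
  have D: "D i \<in> sym_convex_bodies (I i)" for i
    unfolding D_def by (rule scale_sym_convex_bodies[OF Q pos])
  have norm_D: "norm x \<le> 1" if "x \<in> D i" for i x
    using that R(1)[of i] R(2)[of _ i] by (auto simp: D_def)
  have D_ball: "D i \<subseteq> unit_ball (I i)" for i
    using norm_D sym_convex_bodiesD(1)[OF D] by (auto simp: unit_ball_def)
  have eq: "proj_tensor D = proj_tensor Q" "inj_tensor I D = inj_tensor I Q"
    unfolding D_def by (rule proj_inj_tensor_rescale[OF pos prod])+
  have "john (multi_indices I) (tensors D)"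
  proof (rule john_convex_hullD)
    show "john (multi_indices I) (convex hull tensors D)" using john by (simp flip: proj_tensor_eq add: eq)
    show "norm T \<le> 1" if "T \<in> tensors D" for T
    proof -
      obtain x where x: "T = tensor x" "\<And>i. x i \<in> D i" using \<open>T \<in> tensors D\<close> unfolding tensors_def by blast
      show ?thesis unfolding x(1) norm_tensor using norm_D[OF x(2)] by (intro prod_le_1) auto
    qed
  qed
  then have "john (I i) (D i)" for i by (rule john_tensor_factor[OF _ norm_D I])
  then show ?thesis using that[of D] D D_ball QP eq by simp
qed

text \<open>\<open>john_body\<close> depends only on the ray of its argument, so slices can be used
  directly, without the correction made in \<open>factor\<close>. The retraction starts again from
  all symmetric bodies and does not pass through the one for the tensorial bodies.\<close>

lemma absolute_retract_lowner_space:
  fixes I :: "'l::finite \<Rightarrow> 'n::finite set"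
  assumes I: "\<And>j. I j \<noteq> {}"
  shows "absolute_retract TYPE('z) (lowner_space I)"
proof -
  let ?M = "multi_indices I"
  interpret Metric_space "tensorial_bodies I" hausdorff_dist by (rule Metric_space_tensorial_bodies)
  interpret Submetric "tensorial_bodies I" hausdorff_dist "lowner_bodies I"
    by unfold_locales (auto simp: lowner_bodies_def)
  \<comment> \<open>The subspace topology is that of the restricted metric, so the general criterion
    applies to the smaller family.\<close>
  have eq: "lowner_space I = Metric_space.mtopology (lowner_bodies I) hausdorff_dist"
    unfolding lowner_space_def tensorial_space_def by (rule mtopology_submetric[symmetric])
  define r where "r X = sandwich I (\<lambda>i. john_body (I i) (slice I X i)) X" for X
  have jb: "john_body (I i) (slice I X i) \<in> sym_convex_bodies (I i)" if "X \<in> sym_convex_bodies ?M" for X i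
    using that I by (intro john_body_sym_convex_bodies slice_sym_convex_bodies)
  show ?thesis
    unfolding eq
  proof (rule absolute_retract_hausdorff)
    show "lowner_bodies I \<subseteq> sym_convex_bodies ?M" by (auto simp: lowner_bodies_def tensorial_bodies_def)
    show "r X \<in> lowner_bodies I" if X: "X \<in> sym_convex_bodies ?M" for X
    proof -
      let ?D = "\<lambda>i. john_body (I i) (slice I X i)"
      have D: "?D i \<in> sym_convex_bodies (I i)" for i by (rule jb[OF X])
      have "conv_tensor I (r X) = proj_tensor ?D"
        unfolding r_def by (intro conv_tensor_eq_proj_tensor D sandwich_bounds)
      moreover have "Low ?M (proj_tensor ?D) = unit_ball ?M"
        using X I by (intro Low_proj_tensor D john_john_body slice_sym_convex_bodies john_body_subset)
      moreover have "r X \<in> tensorial_bodies I"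
        unfolding r_def by (intro sandwich_tensorial_bodies D X)
      ultimately show ?thesis by (simp add: lowner_bodies_def low_tensor_def)
    qed
    show "r P = P" if P: "P \<in> lowner_bodies I" for P
    proof -
      obtain D where D: "\<And>i. D i \<in> sym_convex_bodies (I i)" "\<And>i. john (I i) (D i)" "\<And>i. D i \<subseteq> unit_ball (I i)"
        and DP: "proj_tensor D \<subseteq> P" "P \<subseteq> inj_tensor I D"
        using lowner_body_factors[of I P, OF I P] by blast
      obtain \<gamma> where \<gamma>: "\<And>i. 0 < \<gamma> i" "\<And>i. slice I P i = (*\<^sub>R) (\<gamma> i / (\<Prod>j\<in>UNIV. \<gamma> j)) ` D i"
        "base_radius I P = 1 / (\<Prod>j\<in>UNIV. \<gamma> j)"
        using slice_eq_scaled_factor[of D I P, OF D(1) DP I] by blast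
      \<comment> \<open>The slice is a positive multiple of D i, and the normalisation undoes the
        multiple without its value being known.\<close>
      have "john_body (I i) (slice I P i) = D i" for i
        unfolding \<gamma>(2) using \<gamma>(1) D I by (intro john_body_scale divide_pos_pos prod_pos) auto
      moreover have "convex P" using P sym_convex_bodiesD(3) by (auto simp: lowner_bodies_def tensorial_bodies_def)
      ultimately show ?thesis using sandwich_eq[OF DP] by (simp add: r_def)
    qed
    \<comment> \<open>One t for X, and t^2 from \<open>john_body\<close> for each slot.\<close>
    show "scaled_within (t ^ (1 + 2 * CARD('l))) (r X) (r Y)"
      if "1 \<le> t" "X \<in> sym_convex_bodies ?M" "Y \<in> sym_convex_bodies ?M"
        "scaled_within t X Y" "scaled_within t Y X" for t X Y
    proof -
      have "scaled_within (t * (t\<^sup>2) ^ CARD('l)) (r X) (r Y)"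
        unfolding r_def
        using that I
        by (intro scaled_within_sandwich scaled_within_john_body scaled_within_slice
            slice_sym_convex_bodies jb one_le_power)
      then show ?thesis by (simp add: power_mult)
    qed
  qed
qed

theorem theorem4p3:
  fixes I :: "'l::finite \<Rightarrow> 'n::finite set" and d :: "'l \<Rightarrow> nat"
  assumes "\<And>i. card (I i) = d i" and "\<And>i. d i \<ge> 2"
  shows "absolute_retract TYPE('z) (tensorial_space I) \<and>
         absolute_retract TYPE('z) (lowner_space I)"
proof -
  have "I i \<noteq> {}" for i
  proof
    assume "I i = {}"
    then show False using assms(1)[of i] assms(2)[of i] by simp
  qed
  then show ?thesis by (simp add: absolute_retract_tensorial_space absolute_retract_lowner_space)
qed

end
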